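(* Let $m\ge 3$ and let $\{\beta_{i,\ell}: i=1,2,\ \ell=1,\dots,m\}\subset[0,1)$ be such that, for every $i\in\{1,2\}$ and every $j\in\{1,\dots,m\}$, $$3(1+\beta_{i,j})<2\sum_{\ell=1}^m\beta_{i,\ell}+\sum_{\ell=1}^m\beta_{3-i,\ell}\quad\text{and}\quad \sum_{\ell=1}^m\beta_{i,\ell}<2 .$$ Then, given any $m$ distinct points $P_1,\dots,P_m\in\mathbb{R}^2$, there exists a continuous solution $(u_1,u_2)$ on $\mathbb{R}^2$ to the system $$\begin{cases}-\Delta u_1=2K_1e^{2u_1}-K_2e^{2u_2}&\text{in }\mathbb{R}^2,\\ -\Delta u_2=2K_2e^{2u_2}-K_1e^{2u_1}&\text{in }\mathbb{R}^2,\end{cases}\qquad K_i(x):=\prod_{\ell=1}^m\frac{1}{|x-P_\ell|^{2\beta_{i,\ell}}},\quad i=1,2,$$ such that, for $i=1,2$, $$u_i(x)=-\beta_i\log|x|+\text{a bounded continuous function}\quad\text{on }B_1^c,\qquad \beta_i:=2-\sum_{\ell=1}^m\beta_{i,\ell}.$$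
   Context: $B_1$ is the unit ball of $\mathbb{R}^2$ centered at the origin and $B_1^c=\mathbb{R}^2\setminus B_1$. The equations are understood in the sense of distributions. *)

theory Defs
  imports "HOL-Analysis.Analysis"
begin

definition partial_deriv :: "'a::euclidean_space \<Rightarrow> ('a \<Rightarrow> real) \<Rightarrow> 'a \<Rightarrow> real" where
  "partial_deriv b f x = frechet_derivative f (at x) b"

definition laplacian :: "('a::euclidean_space \<Rightarrow> real) \<Rightarrow> 'a \<Rightarrow> real" where
  "laplacian f x = (\<Sum>b\<in>Basis. partial_deriv b (partial_deriv b f) x)"

primrec C_k :: "nat \<Rightarrow> ('a::euclidean_space \<Rightarrow> real) \<Rightarrow> bool" where
  "C_k 0 f \<longleftrightarrow> continuous_on UNIV f"
| "C_k (Suc k) f \<longleftrightarrow>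
     (\<forall>x. f differentiable (at x)) \<and> (\<forall>b\<in>Basis. C_k k (partial_deriv b f))"

definition test_function :: "('a::euclidean_space \<Rightarrow> real) \<Rightarrow> bool" where
  "test_function \<phi> \<longleftrightarrow> (\<forall>k. C_k k \<phi>) \<and> compact (closure {x. \<phi> x \<noteq> 0})"

definition locally_integrable :: "('a::euclidean_space \<Rightarrow> real) \<Rightarrow> bool" where
  "locally_integrable f \<longleftrightarrow> (\<forall>S. compact S \<longrightarrow> set_integrable lebesgue S f)"

text \<open>The equation \<open>- \<Delta> u = f\<close> in the sense of distributions on the whole space. Local
  integrability is demanded so that both sides are distributions: without it the integrals below
  could take the default value 0.\<close>

definition neg_laplace_eq_distr ::
    "('a::euclidean_space \<Rightarrow> real) \<Rightarrow> ('a \<Rightarrow> real) \<Rightarrow> bool" where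
  "neg_laplace_eq_distr u f \<longleftrightarrow>
     locally_integrable u \<and> locally_integrable f \<and>
     (\<forall>\<phi>. test_function \<phi> \<longrightarrow>
        - (LINT x|lebesgue. u x * laplacian \<phi> x) = (LINT x|lebesgue. f x * \<phi> x))"

text \<open>At the points \<open>P l\<close> the value of \<open>singular_weight\<close> is 0 by the conventions for \<open>powr\<close> and
  division (even where \<open>\<beta> i l = 0\<close>). This is a null set, hence irrelevant to the equations.\<close>

definition singular_weight ::
    "nat \<Rightarrow> (nat \<Rightarrow> nat \<Rightarrow> real) \<Rightarrow> (nat \<Rightarrow> real^2) \<Rightarrow> nat \<Rightarrow> real^2 \<Rightarrow> real" where
  "singular_weight m \<beta> P i x = (\<Prod>l=1..m. 1 / norm (x - P l) powr (2 * \<beta> i l))"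

end

theory Submission
  imports Defs "HOL-Complex_Analysis.Great_Picard"
begin

text \<open>
  Let \<open>d\<close> be the chordal distance on the plane and \<open>G = - ln d / pi \<ge> 0\<close>. Moving the growth at infinity
  into the weights \<open>k\<^sub>i\<close>, the system becomes \<open>w\<^sub>i = c\<^sub>i + \<integral> G (2 k\<^sub>i exp w\<^sub>i - k\<^sub>j exp w\<^sub>j)\<close> with masses
  \<open>F\<^sub>i = 2 pi (2 \<beta>\<^sub>i + \<beta>\<^sub>j) / 3\<close>, the Euler equation of entropy minus half the interaction energy.
  The interaction is positive definite, so replacing its negative, which is concave, by the linearization
  at a density \<open>g\<close> and minimizing gives an explicit step \<open>g \<mapsto> F exp (W g) / Z\<close> that lowers the energy by
  at least the relative entropy. Young's inequality \<open>g t \<le> g ln g - g + exp t\<close> with \<open>t = b G\<close> bounds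
  each potential by the entropy as soon as \<open>exp (b G)\<close> is uniformly integrable; the hypothesis on \<open>\<beta>\<close>
  says exactly that some such \<open>b\<close> exceeds \<open>F\<close>, which makes the energy coercive and the iterates uniformly
  bounded. By equicontinuity of the potentials a subsequence converges, and since consecutive iterates
  approach each other the limit is a fixed point.
\<close>

section \<open>Positive definiteness of logarithmic kernels\<close>

text \<open>On the sphere behind the chordal distance the transformed weights are the area density
  times conical singularities; the prescribed growth is exactly the one that makes infinity a
  regular point. The masses solve \<open>2 F\<^sub>i - F\<^sub>j = 2 pi \<beta>\<^sub>i\<close>, the
  total mass of the right-hand side that produces this growth, so they come from inverting the
  matrix with rows (2, -1) and (-1, 2). Components are indexed by \<open>bool\<close>, so that
  \<open>\<not> i\<close> is the other one. Since \<open>exp (b G)\<close> is the power -b/pi of the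
  distance, it is integrable against a singularity of exponent -2 \<beta>(i,l) once b/pi + 2
  \<beta>(i,l) < 2; inserting F for b gives the first hypothesis of the theorem. No minimizer of the
  energy is ever needed. A lower bound and monotonicity along the iteration suffice, and the
  compactness comes from the potentials rather than from the densities.\<close>

definition toda_form :: "(bool \<Rightarrow> 'a measure) \<Rightarrow> ('a \<Rightarrow> 'a \<Rightarrow> real) \<Rightarrow> (bool \<Rightarrow> 'a \<Rightarrow> real) \<Rightarrow> real" where
  "toda_form \<mu> N h = (\<Sum>i\<in>UNIV. \<integral>x. (2 * (\<integral>y. N x y * h i y \<partial>\<mu> i) - (\<integral>y. N x y * h (\<not> i) y \<partial>\<mu> (\<not> i))) * h i x \<partial>\<mu> i)"

locale two_finite_measures =
  fixes \<mu> :: "bool \<Rightarrow> 'a::topological_space measure"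
  assumes finite_mu: "\<And>i. finite_measure (\<mu> i)"
    and sets_mu[measurable_cong]: "\<And>i. sets (\<mu> i) = sets borel"
begin

sublocale finite_measure "\<mu> i" for i by (rule finite_mu)

lemma borel_measurable_mu: "borel_measurable (\<mu> i) = borel_measurable borel"
  by (rule measurable_cong_sets[OF sets_mu refl])

lemma kernel_integral_measurable:
  fixes N :: "'a \<Rightarrow> 'a \<Rightarrow> real" and f :: "'a \<Rightarrow> real"
  assumes [measurable]: "case_prod N \<in> borel_measurable (borel \<Otimes>\<^sub>M borel)" "f \<in> borel_measurable borel"
  shows "(\<lambda>x. \<integral>y. N x y * f y \<partial>\<mu> i) \<in> borel_measurable borel"
  by (rule borel_measurable_lebesgue_integral) measurable

lemma kernel_integrable:
  fixes N :: "'a \<Rightarrow> 'a \<Rightarrow> real" and f :: "'a \<Rightarrow> real"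
  assumes N[measurable]: "case_prod N \<in> borel_measurable (borel \<Otimes>\<^sub>M borel)" and NK: "\<And>x y. \<bar>N x y\<bar> \<le> K"
    and f[measurable]: "f \<in> borel_measurable borel" and fB: "\<And>x. \<bar>f x\<bar> \<le> B"
  shows "integrable (\<mu> i) (\<lambda>y. N x y * f y)"
proof (rule integrable_const_bound[of _ "K * B"], rule AE_I2)
  show "norm (N x y * f y) \<le> K * B" for y
    using mult_mono[OF NK[of x y] fB[of y]] NK[of x y] by (simp add: abs_mult)
qed measurable

lemma kernel_integral_bounded:
  fixes N :: "'a \<Rightarrow> 'a \<Rightarrow> real" and f :: "'a \<Rightarrow> real"
  assumes N: "case_prod N \<in> borel_measurable (borel \<Otimes>\<^sub>M borel)" and NK: "\<And>x y. \<bar>N x y\<bar> \<le> K"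
    and f: "f \<in> borel_measurable borel" and fB: "\<And>x. \<bar>f x\<bar> \<le> B"
  shows "\<bar>\<integral>y. N x y * f y \<partial>\<mu> i\<bar> \<le> K * B * measure (\<mu> i) (space (\<mu> i))"
proof -
  have "\<bar>\<integral>y. N x y * f y \<partial>\<mu> i\<bar> \<le> (\<integral>y. \<bar>N x y * f y\<bar> \<partial>\<mu> i)" by (rule integral_abs_bound)
  also have "\<dots> \<le> (\<integral>y. K * B \<partial>\<mu> i)"
  proof (rule integral_mono)
    show "integrable (\<mu> i) (\<lambda>y. \<bar>N x y * f y\<bar>)" using kernel_integrable[OF assms] by simp
    show "\<bar>N x y * f y\<bar> \<le> K * B" for y
      using mult_mono[OF NK[of x y] fB[of y]] NK[of x y] by (simp add: abs_mult)
  qed simp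
  finally show ?thesis by (simp add: mult_ac)
qed

lemma form_integrable:
  fixes N :: "'a \<Rightarrow> 'a \<Rightarrow> real" and h :: "bool \<Rightarrow> 'a \<Rightarrow> real"
  assumes N: "case_prod N \<in> borel_measurable (borel \<Otimes>\<^sub>M borel)" and NK: "\<And>x y. \<bar>N x y\<bar> \<le> K"
    and h: "\<And>i. h i \<in> borel_measurable borel" and hB: "\<And>i x. \<bar>h i x\<bar> \<le> B"
  shows "integrable (\<mu> i) (\<lambda>x. (2 * (\<integral>y. N x y * h i y \<partial>\<mu> i) - (\<integral>y. N x y * h (\<not> i) y \<partial>\<mu> (\<not> i))) * h i x)"
proof -
  define I where "I j x = (\<integral>y. N x y * h j y \<partial>\<mu> j)" for j x
  have Im[measurable]: "I j \<in> borel_measurable borel" for j unfolding I_def by (rule kernel_integral_measurable[OF N h])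
  have [measurable]: "h i \<in> borel_measurable borel" by (rule h)
  define T where "T j = K * B * measure (\<mu> j) (space (\<mu> j))" for j
  have Ib: "\<bar>I j x\<bar> \<le> T j" for j x unfolding I_def T_def by (rule kernel_integral_bounded[OF N NK h hB])
  have "integrable (\<mu> i) (\<lambda>x. (2 * I i x - I (\<not> i) x) * h i x)"
  proof (rule integrable_const_bound[of _ "(2 * T i + T (\<not> i)) * B"], rule AE_I2)
    fix x
    have "\<bar>2 * I i x - I (\<not> i) x\<bar> \<le> 2 * T i + T (\<not> i)" using Ib[of i x] Ib[of "\<not> i" x] by linarith
    from mult_mono[OF this hB[of i x]] show "norm ((2 * I i x - I (\<not> i) x) * h i x) \<le> (2 * T i + T (\<not> i)) * B"
      using Ib[of i x] Ib[of "\<not> i" x] by (simp add: abs_mult)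
  qed measurable
  thus ?thesis by (simp add: I_def)
qed

lemma toda_form_sum:
  assumes N: "\<And>k. k \<in> A \<Longrightarrow> case_prod (N k) \<in> borel_measurable (borel \<Otimes>\<^sub>M borel)" and NK: "\<And>k x y. k \<in> A \<Longrightarrow> \<bar>N k x y\<bar> \<le> K"
    and h: "\<And>i. h i \<in> borel_measurable borel" and hB: "\<And>i x. \<bar>h i x\<bar> \<le> B"
  shows "toda_form \<mu> (\<lambda>x y. \<Sum>k\<in>A. c k * N k x y) h = (\<Sum>k\<in>A. c k * toda_form \<mu> (N k) h)"
proof -
  let ?I = "\<lambda>k j x. \<integral>y. N k x y * h j y \<partial>\<mu> j"
  let ?S = "\<lambda>j x. \<Sum>k\<in>A. c k * ?I k j x"
  let ?T = "\<lambda>k i x. (2 * ?I k i x - ?I k (\<not> i) x) * h i x"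
  have 1: "(\<integral>y. (\<Sum>k\<in>A. c k * N k x y) * h j y \<partial>\<mu> j) = (\<Sum>k\<in>A. c k * ?I k j x)" for x j
  proof -
    have "(\<integral>y. (\<Sum>k\<in>A. c k * N k x y) * h j y \<partial>\<mu> j) = (\<integral>y. (\<Sum>k\<in>A. c k * (N k x y * h j y)) \<partial>\<mu> j)"
      by (simp only: sum_distrib_right mult.assoc)
    also have "\<dots> = (\<Sum>k\<in>A. \<integral>y. c k * (N k x y * h j y) \<partial>\<mu> j)"
      by (intro Bochner_Integration.integral_sum integrable_mult_right kernel_integrable[OF N NK h hB])
    finally show ?thesis by simp
  qed
  have "(\<integral>x. (2 * ?S i x - ?S (\<not> i) x) * h i x \<partial>\<mu> i)
     = (\<Sum>k\<in>A. c k * (\<integral>x. ?T k i x \<partial>\<mu> i))" for i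
  proof -
    have "(\<integral>x. (2 * ?S i x - ?S (\<not> i) x) * h i x \<partial>\<mu> i)
      = (\<integral>x. (\<Sum>k\<in>A. c k * ?T k i x) \<partial>\<mu> i)"
      by (intro Bochner_Integration.integral_cong refl)
         (simp add: sum_distrib_left sum_distrib_right sum_subtractf algebra_simps)
    also have "\<dots> = (\<Sum>k\<in>A. \<integral>x. c k * ?T k i x \<partial>\<mu> i)"
      by (intro Bochner_Integration.integral_sum integrable_mult_right form_integrable[OF N NK h hB])
    finally show ?thesis by simp
  qed
  hence "toda_form \<mu> (\<lambda>x y. \<Sum>k\<in>A. c k * N k x y) h = (\<Sum>i\<in>UNIV. \<Sum>k\<in>A. c k * (\<integral>x. ?T k i x \<partial>\<mu> i))"
    unfolding toda_form_def 1 by simp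
  also have "\<dots> = (\<Sum>k\<in>A. c k * toda_form \<mu> (N k) h)"
    unfolding toda_form_def by (subst sum.swap) (simp only: sum_distrib_left)
  finally show ?thesis .
qed

text \<open>A constant kernel sees only the total masses a and b, so the form collapses to the
  quadratic form of the matrix with rows (2, -1) and (-1, 2), a sum of squares.\<close>

lemma toda_form_one_nonneg: "0 \<le> toda_form \<mu> (\<lambda>x y. 1) h"
proof -
  define a where "a = (\<integral>x. h True x \<partial>\<mu> True)"
  define b where "b = (\<integral>x. h False x \<partial>\<mu> False)"
  have "toda_form \<mu> (\<lambda>x y. 1) h = (2 * b - a) * b + (2 * a - b) * a"
    unfolding toda_form_def by (simp add: UNIV_bool a_def b_def)
  also have "\<dots> = a\<^sup>2 + b\<^sup>2 + (a - b)\<^sup>2" by (simp add: power2_eq_square algebra_simps)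
  finally show ?thesis by simp
qed

lemma abs_inner_power_le_1:
  fixes x y :: "'b::real_inner"
  assumes "norm x \<le> 1" "norm y \<le> 1" shows "\<bar>(x \<bullet> y) ^ n\<bar> \<le> 1"
proof -
  have "\<bar>x \<bullet> y\<bar> \<le> norm x * norm y" by (rule Cauchy_Schwarz_ineq2)
  also have "\<dots> \<le> 1" using assms by (simp add: mult_le_one)
  finally show ?thesis unfolding power_abs by (simp add: power_le_one)
qed

text \<open>A Schur product argument: one factor of the power is expanded in the orthonormal basis
  and its two halves are absorbed into the two copies of h. This leaves a sum of forms with the next
  lower power, whence the induction over arbitrary h.\<close>

lemma toda_form_inner_power_nonneg:
  fixes \<Phi> :: "'a \<Rightarrow> 'b::euclidean_space"
  assumes Phi[measurable]: "\<Phi> \<in> borel_measurable borel" and n1: "\<And>x. norm (\<Phi> x) \<le> 1"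
    and "\<And>i. h i \<in> borel_measurable borel" and "\<And>i x. \<bar>h i x\<bar> \<le> B"
  shows "0 \<le> toda_form \<mu> (\<lambda>x y. (\<Phi> x \<bullet> \<Phi> y) ^ n) h"
  using assms(3,4)
proof (induction n arbitrary: h)
  case 0
  show ?case using toda_form_one_nonneg by simp
next
  case (Suc n)
  note h[measurable] = Suc.prems(1) and hB = Suc.prems(2)
  define N where "N x y = (\<Phi> x \<bullet> \<Phi> y) ^ n" for x y
  have Nm: "case_prod N \<in> borel_measurable (borel \<Otimes>\<^sub>M borel)" unfolding N_def by measurable
  have NK: "\<bar>N x y\<bar> \<le> 1" for x y
    unfolding N_def by (intro abs_inner_power_le_1 n1)
  \<comment> \<open>The new densities stay bounded by B because the coordinates of a vector of norm
    at most 1 are at most 1.\<close>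
  define g where "g c i x = h i x * (\<Phi> x \<bullet> c)" for c i x
  have gm: "g c i \<in> borel_measurable borel" for c i unfolding g_def by measurable
  have gB: "\<bar>g c i x\<bar> \<le> B" if "c \<in> Basis" for c i x
  proof -
    have "\<bar>\<Phi> x \<bullet> c\<bar> \<le> 1" using Basis_le_norm[OF that, of "\<Phi> x"] n1[of x] by simp
    from mult_mono[OF hB[of i x] this] show ?thesis using hB[of i x] by (simp add: g_def abs_mult)
  qed
  let ?I = "\<lambda>c j x. \<integral>y. N x y * g c j y \<partial>\<mu> j"
  let ?S = "\<lambda>j x. \<Sum>c\<in>Basis. (\<Phi> x \<bullet> c) * ?I c j x"
  let ?T = "\<lambda>c i x. (2 * ?I c i x - ?I c (\<not> i) x) * g c i x"
  have inner: "(\<integral>y. (\<Phi> x \<bullet> \<Phi> y) ^ Suc n * h j y \<partial>\<mu> j) = (\<Sum>c\<in>Basis. (\<Phi> x \<bullet> c) * ?I c j x)" for x j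
  proof -
    have "(\<integral>y. (\<Phi> x \<bullet> \<Phi> y) ^ Suc n * h j y \<partial>\<mu> j) = (\<integral>y. (\<Sum>c\<in>Basis. (\<Phi> x \<bullet> c) * (N x y * g c j y)) \<partial>\<mu> j)"
      unfolding power_Suc N_def g_def
      by (subst euclidean_inner[of "\<Phi> x"]) (simp add: sum_distrib_right sum_distrib_left mult_ac)
    also have "\<dots> = (\<Sum>c\<in>Basis. \<integral>y. (\<Phi> x \<bullet> c) * (N x y * g c j y) \<partial>\<mu> j)"
      by (intro Bochner_Integration.integral_sum integrable_mult_right kernel_integrable[OF Nm NK gm gB])
    finally show ?thesis by simp
  qed
  have "(\<integral>x. (2 * ?S i x - ?S (\<not> i) x) * h i x \<partial>\<mu> i)
     = (\<Sum>c\<in>Basis. \<integral>x. ?T c i x \<partial>\<mu> i)" for i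
  proof -
    have "(\<integral>x. (2 * ?S i x - ?S (\<not> i) x) * h i x \<partial>\<mu> i)
      = (\<integral>x. (\<Sum>c\<in>Basis. ?T c i x) \<partial>\<mu> i)"
      by (intro Bochner_Integration.integral_cong refl)
         (simp add: g_def[of _ i] sum_distrib_left sum_distrib_right sum_subtractf algebra_simps)
    also have "\<dots> = (\<Sum>c\<in>Basis. \<integral>x. ?T c i x \<partial>\<mu> i)"
      by (intro Bochner_Integration.integral_sum form_integrable[OF Nm NK gm gB])
    finally show ?thesis .
  qed
  hence "toda_form \<mu> (\<lambda>x y. (\<Phi> x \<bullet> \<Phi> y) ^ Suc n) h = (\<Sum>c\<in>Basis. toda_form \<mu> N (g c))"
    unfolding toda_form_def inner by (subst sum.swap) simp
  moreover have "0 \<le> toda_form \<mu> N (g c)" if "c \<in> Basis" for c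
    unfolding N_def by (rule Suc.IH[OF gm gB[OF that]])
  ultimately show ?case by (simp add: sum_nonneg)
qed

text \<open>Dominated convergence is applied twice: in y with dominating function H x y * B, and
  then in x, where the bound K on the integrals of H, uniform in x, supplies a constant dominating
  function on a finite measure.\<close>

lemma toda_form_tendsto:
  assumes N[measurable]: "\<And>n. case_prod (N n) \<in> borel_measurable (borel \<Otimes>\<^sub>M borel)" "case_prod H \<in> borel_measurable (borel \<Otimes>\<^sub>M borel)"
    and le: "\<And>n i x. AE y in \<mu> i. \<bar>N n x y\<bar> \<le> H x y" and lim: "\<And>i x. AE y in \<mu> i. (\<lambda>n. N n x y) \<longlonglongrightarrow> H x y"
    and Hi: "\<And>i x. integrable (\<mu> i) (\<lambda>y. H x y)" and HK: "\<And>i x. (\<integral>y. H x y \<partial>\<mu> i) \<le> K"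
    and h[measurable]: "\<And>i. h i \<in> borel_measurable borel" and hB: "\<And>i x. \<bar>h i x\<bar> \<le> B"
  shows "(\<lambda>n. toda_form \<mu> (N n) h) \<longlonglongrightarrow> toda_form \<mu> H h"
proof -
  have B0: "B \<ge> 0" using hB[of True undefined] by linarith
  define I where "I n j x = (\<integral>y. N n x y * h j y \<partial>\<mu> j)" for n j x
  define J where "J j x = (\<integral>y. H x y * h j y \<partial>\<mu> j)" for j x
  have Im: "I n j \<in> borel_measurable borel" "J j \<in> borel_measurable borel" for n j
    unfolding I_def J_def by (rule kernel_integral_measurable[OF N(1) h], rule kernel_integral_measurable[OF N(2) h])
  have sec: "(\<lambda>y. N n x y * h j y) \<in> borel_measurable (\<mu> j)" "(\<lambda>y. H x y * h j y) \<in> borel_measurable (\<mu> j)" for n j x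
    unfolding borel_measurable_mu by measurable
  have pb: "norm (a * h j y) \<le> b * B" if "\<bar>a\<bar> \<le> b" for a b j y
    using mult_mono[OF that hB[of j y]] that by (simp add: abs_mult)
  have ae: "AE y in \<mu> j. norm (N n x y * h j y) \<le> H x y * B" for n j x
    using le[of n x j] by eventually_elim (rule pb)
  have lim1: "(\<lambda>n. I n j x) \<longlonglongrightarrow> J j x" for j x
    unfolding I_def J_def
  proof (rule integral_dominated_convergence[where w="\<lambda>y. H x y * B"])
    show "AE y in \<mu> j. (\<lambda>n. N n x y * h j y) \<longlonglongrightarrow> H x y * h j y"
      using lim[where x=x and i=j] by eventually_elim (intro tendsto_intros)
  qed (use Hi sec ae in auto)
  have Ib: "\<bar>I n j x\<bar> \<le> K * B" for n j x
  proof -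
    have "integrable (\<mu> j) (\<lambda>y. N n x y * h j y)"
    proof (rule Bochner_Integration.integrable_bound)
      show "integrable (\<mu> j) (\<lambda>y. H x y * B)" using Hi by simp
      show "AE y in \<mu> j. norm (N n x y * h j y) \<le> norm (H x y * B)"
        using ae[where x=x and n=n and j=j] by eventually_elim simp
    qed (rule sec)
    hence "(\<integral>y. \<bar>N n x y * h j y\<bar> \<partial>\<mu> j) \<le> (\<integral>y. H x y * B \<partial>\<mu> j)"
      using ae[where x=x and n=n and j=j] Hi by (intro integral_mono_AE) auto
    also have "\<dots> \<le> K * B" using HK B0 by (simp add: mult_right_mono)
    finally show ?thesis unfolding I_def by (rule order_trans[OF integral_abs_bound])
  qed
  have "(\<lambda>n. \<integral>x. (2 * I n i x - I n (\<not> i) x) * h i x \<partial>\<mu> i) \<longlonglongrightarrow> (\<integral>x. (2 * J i x - J (\<not> i) x) * h i x \<partial>\<mu> i)" for i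
  proof (rule integral_dominated_convergence[where w="\<lambda>y. 3 * (K * B) * B"])
    show "AE x in \<mu> i. (\<lambda>n. (2 * I n i x - I n (\<not> i) x) * h i x) \<longlonglongrightarrow> (2 * J i x - J (\<not> i) x) * h i x"
      by (intro AE_I2 tendsto_intros lim1)
    show "AE x in \<mu> i. norm ((2 * I n i x - I n (\<not> i) x) * h i x) \<le> 3 * (K * B) * B" for n
    proof (intro AE_I2 pb)
      show "\<bar>2 * I n i x - I n (\<not> i) x\<bar> \<le> 3 * (K * B)" for x using Ib[of n i x] Ib[of n "\<not> i" x] by linarith
    qed
    show "(\<lambda>x. (2 * I n i x - I n (\<not> i) x) * h i x) \<in> borel_measurable (\<mu> i)" for n
      unfolding borel_measurable_mu by (intro borel_measurable_times borel_measurable_diff Im h borel_measurable_const)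
    show "(\<lambda>x. (2 * J i x - J (\<not> i) x) * h i x) \<in> borel_measurable (\<mu> i)"
      unfolding borel_measurable_mu by (intro borel_measurable_times borel_measurable_diff Im h borel_measurable_const)
  qed simp
  thus ?thesis unfolding toda_form_def I_def J_def by (intro tendsto_sum)
qed

text \<open>Expand \<open>- ln (1 - s)\<close> as the series of \<open>s ^ k / k\<close>; powers of inner products are positive definite.\<close>

lemma toda_form_log_nonneg:
  fixes \<Phi> :: "'a \<Rightarrow> 'b::euclidean_space"
  assumes Phi[measurable]: "\<Phi> \<in> borel_measurable borel" and n1: "\<And>x. norm (\<Phi> x) \<le> 1"
    and nonneg: "\<And>x y. 0 \<le> \<Phi> x \<bullet> \<Phi> y" and less: "\<And>i x. AE y in \<mu> i. \<Phi> x \<bullet> \<Phi> y < 1"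
    and Hi: "\<And>i x. integrable (\<mu> i) (\<lambda>y. - ln (1 - \<Phi> x \<bullet> \<Phi> y))" and HK: "\<And>i x. (\<integral>y. - ln (1 - \<Phi> x \<bullet> \<Phi> y) \<partial>\<mu> i) \<le> K"
    and h: "\<And>i. h i \<in> borel_measurable borel" and hB: "\<And>i x. \<bar>h i x\<bar> \<le> B"
  shows "0 \<le> toda_form \<mu> (\<lambda>x y. - ln (1 - \<Phi> x \<bullet> \<Phi> y)) h"
proof -
  \<comment> \<open>The term k = 0 vanishes because \<open>1 / real 0 = 0\<close>, so the sum really
    starts at k = 1.\<close>
  define N where "N n x y = (\<Sum>k<n. 1 / real k * (\<Phi> x \<bullet> \<Phi> y) ^ k)" for n x y
  have sums: "(\<lambda>k. 1 / real k * t ^ k) sums - ln (1 - t)" if "0 \<le> t" "t < 1" for t :: real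
    using sums_minus[OF ln_series'[of "-t"]] that by simp
  have "(\<lambda>n. toda_form \<mu> (N n) h) \<longlonglongrightarrow> toda_form \<mu> (\<lambda>x y. - ln (1 - \<Phi> x \<bullet> \<Phi> y)) h"
  proof (rule toda_form_tendsto[OF _ _ _ _ Hi HK h hB])
    show "case_prod (N n) \<in> borel_measurable (borel \<Otimes>\<^sub>M borel)" for n unfolding N_def by measurable
    show "(\<lambda>(x, y). - ln (1 - \<Phi> x \<bullet> \<Phi> y)) \<in> borel_measurable (borel \<Otimes>\<^sub>M borel)" by measurable
    show "AE y in \<mu> i. \<bar>N n x y\<bar> \<le> - ln (1 - \<Phi> x \<bullet> \<Phi> y)" for n i x
      using less[of x i]
    proof eventually_elim
      case (elim y)
      have "N n x y \<le> - ln (1 - \<Phi> x \<bullet> \<Phi> y)"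
        unfolding N_def sums_unique[OF sums[OF nonneg elim]]
        by (rule sum_le_suminf[OF sums_summable[OF sums[OF nonneg elim]]]) (simp_all add: nonneg)
      moreover have "0 \<le> N n x y" unfolding N_def by (intro sum_nonneg mult_nonneg_nonneg zero_le_power nonneg) simp
      ultimately show ?case by simp
    qed
    show "AE y in \<mu> i. (\<lambda>n. N n x y) \<longlonglongrightarrow> - ln (1 - \<Phi> x \<bullet> \<Phi> y)" for i x
      using less[of x i]
    proof eventually_elim
      case (elim y)
      show ?case using sums[OF nonneg elim] unfolding sums_def N_def .
    qed
  qed
  moreover have "\<exists>n0. \<forall>n\<ge>n0. 0 \<le> toda_form \<mu> (N n) h"
  proof (intro exI allI impI)
    fix n
    have K1: "\<bar>(\<Phi> x \<bullet> \<Phi> y) ^ k\<bar> \<le> 1" for k x y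
      by (intro abs_inner_power_le_1 n1)
    have "toda_form \<mu> (N n) h = (\<Sum>k<n. 1 / real k * toda_form \<mu> (\<lambda>x y. (\<Phi> x \<bullet> \<Phi> y) ^ k) h)"
      unfolding N_def by (rule toda_form_sum[OF _ K1 h hB]) measurable
    thus "0 \<le> toda_form \<mu> (N n) h" using toda_form_inner_power_nonneg[OF Phi n1 h hB] by (simp add: sum_nonneg)
  qed
  ultimately show ?thesis by (rule LIMSEQ_le_const)
qed

end

section \<open>The energy-decreasing iteration\<close>

lemma le_exp_div: fixes t b :: real assumes "b > 0" shows "t \<le> exp (b * t) / b"
proof -
  have "b * t \<le> exp (b * t)" using exp_ge_add_one_self[of "b * t"] by linarith
  thus ?thesis using assms by (simp add: field_simps)
qed

text \<open>Converts the exponential integrability of the kernel into uniform second moments, on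
  which the truncation in \<open>G_L1_continuous\<close> and the estimate in
  \<open>pot_tendsto_0\<close> rest.\<close>

lemma square_le_exp_div: fixes t b :: real assumes "b > 0" "t \<ge> 0" shows "t\<^sup>2 \<le> 2 * exp (b * t) / b\<^sup>2"
proof -
  have "1 + b * t + (b * t)\<^sup>2 / 2 \<le> exp (b * t)"
    using exp_lower_Taylor_quadratic[of "b * t"] assms by simp
  moreover have "b * t \<ge> 0" using assms by simp
  ultimately have "(b * t)\<^sup>2 \<le> 2 * exp (b * t)" by argo
  thus ?thesis using assms by (simp add: field_simps power_mult_distrib)
qed

lemma young_entropy:
  fixes a t :: real assumes "a > 0" shows "a * t \<le> a * ln a - a + exp t"
proof -
  have "1 + (t - ln a) \<le> exp (t - ln a)" by (rule exp_ge_add_one_self)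
  also have "\<dots> = exp t / a" using assms by (simp add: exp_diff)
  finally show ?thesis using assms by (simp add: field_simps)
qed

text \<open>With r = sqrt a and s = sqrt b, the bound ln (s/r) \<le> s/r - 1 shows that relative
  entropy dominates the Hellinger term (r - s)^2. Multiplying by (r + s)^2, which is at most 4 M,
  produces (a - b)^2.\<close>

lemma square_diff_le_relative_entropy:
  fixes a b M :: real
  assumes "0 < a" "0 < b" "a \<le> M" "b \<le> M"
  shows "(a - b)\<^sup>2 \<le> 4 * M * (a * ln (a / b) - a + b)"
proof -
  define r s where "r = sqrt a" and "s = sqrt b"
  have rs: "r > 0" "s > 0" "a = r\<^sup>2" "b = s\<^sup>2" using assms by (auto simp: r_def s_def)
  have "ln (s / r) \<le> s / r - 1" using rs by (intro ln_le_minus_one) auto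
  moreover have "ln (a / b) = - 2 * ln (s / r)"
    using rs by (simp add: ln_div ln_realpow)
  ultimately have "ln (a / b) \<ge> 2 - 2 * (s / r)" by simp
  hence "a * ln (a / b) \<ge> a * (2 - 2 * (s / r))" using assms(1) by (intro mult_left_mono) auto
  hence "a * ln (a / b) \<ge> r\<^sup>2 * (2 - 2 * (s / r))" by (simp only: rs(3)[symmetric])
  also have "r\<^sup>2 * (2 - 2 * (s / r)) = 2 * r\<^sup>2 - 2 * r * s"
    using rs by (simp add: power2_eq_square field_simps)
  finally have 1: "(r - s)\<^sup>2 \<le> a * ln (a / b) - a + b"
    using rs by (simp add: power2_eq_square algebra_simps)
  have "(r + s)\<^sup>2 \<le> 4 * M"
  proof -
    have "(r + s)\<^sup>2 \<le> 2 * r\<^sup>2 + 2 * s\<^sup>2" using sum_squares_ge_zero[of "r - s" 0]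
      by (simp add: power2_eq_square algebra_simps)
    thus ?thesis using assms rs by linarith
  qed
  hence "(r + s)\<^sup>2 * (r - s)\<^sup>2 \<le> 4 * M * (a * ln (a / b) - a + b)"
    using 1 assms by (intro mult_mono) auto
  moreover have "(a - b)\<^sup>2 = (r + s)\<^sup>2 * (r - s)\<^sup>2"
    using rs by (simp add: power2_eq_square algebra_simps)
  ultimately show ?thesis by simp
qed

text \<open>\<open>F i\<close> is the mass of component \<open>i\<close>; \<open>F i < b i\<close> is the subcriticality condition.\<close>

locale toda_kernel = two_finite_measures \<mu>
  for \<mu> :: "bool \<Rightarrow> 'a::{metric_space, second_countable_topology} measure" +
  fixes G :: "'a \<Rightarrow> 'a \<Rightarrow> real" and F b C :: "bool \<Rightarrow> real"
  assumes mu_pos: "\<And>i. 0 < measure (\<mu> i) UNIV"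
    and F_pos: "\<And>i. 0 < F i" and F_less: "\<And>i. F i < b i"
    and G_meas[measurable]: "case_prod G \<in> borel_measurable (borel \<Otimes>\<^sub>M borel)"
    and G_nonneg: "\<And>x y. 0 \<le> G x y"
    and G_sym: "\<And>x y. G x y = G y x"
    and exp_integrable: "\<And>i y. integrable (\<mu> i) (\<lambda>x. exp (b i * G x y))"
    and exp_bound: "\<And>i y. (\<integral>x. exp (b i * G x y) \<partial>\<mu> i) \<le> C i"
    and G_cont: "\<And>i x. AE y in \<mu> i. isCont (\<lambda>z. G z y) x"
begin

lemma space_mu[simp]: "space (\<mu> i) = UNIV"
  using sets_eq_imp_space_eq[OF sets_mu[of i]] by simp

declare borel_measurable_mu[simp]

lemma b_pos: "0 < b i" using F_pos[of i] F_less[of i] by linarith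

lemma G_meas'[measurable (raw)]:
  assumes "f \<in> measurable N borel" "g \<in> measurable N borel"
  shows "(\<lambda>x. G (f x) (g x)) \<in> borel_measurable N"
  using measurable_compose[OF measurable_Pair[OF assms] G_meas] by simp

lemma exp_integrable2: "integrable (\<mu> i) (\<lambda>y. exp (b i * G x y))"
  using exp_integrable[of i x] by (simp add: G_sym[of x])

lemma exp_bound2: "(\<integral>y. exp (b i * G x y) \<partial>\<mu> i) \<le> C i"
  using exp_bound[of i x] by (simp add: G_sym[of x])

lemma G_integrable: "integrable (\<mu> i) (\<lambda>y. G x y)"
  by (rule Bochner_Integration.integrable_bound[OF integrable_divide[OF exp_integrable2[of i x], of "b i"]])
     (use le_exp_div[OF b_pos[of i]] G_nonneg b_pos[of i] in \<open>auto intro!: AE_I2\<close>)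

lemma G_bound: "(\<integral>y. G x y \<partial>\<mu> i) \<le> C i / b i"
proof -
  have "(\<integral>y. G x y \<partial>\<mu> i) \<le> (\<integral>y. exp (b i * G x y) / b i \<partial>\<mu> i)"
    by (intro integral_mono G_integrable integrable_divide exp_integrable2 le_exp_div b_pos)
  also have "\<dots> \<le> C i / b i"
    using exp_bound2[where i=i and x=x] b_pos[of i] by (simp add: divide_right_mono)
  finally show ?thesis .
qed

lemma G2_integrable: "integrable (\<mu> i) (\<lambda>y. (G x y)\<^sup>2)"
proof (rule Bochner_Integration.integrable_bound)
  show "integrable (\<mu> i) (\<lambda>y. 2 * exp (b i * G x y) / (b i)\<^sup>2)"
    by (intro integrable_divide integrable_mult_right exp_integrable2)
qed (use square_le_exp_div[OF b_pos[of i] G_nonneg] in \<open>auto intro!: AE_I2\<close>)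

lemma G2_bound: "(\<integral>y. (G x y)\<^sup>2 \<partial>\<mu> i) \<le> 2 * C i / (b i)\<^sup>2"
proof -
  have "(\<integral>y. (G x y)\<^sup>2 \<partial>\<mu> i) \<le> (\<integral>y. 2 * exp (b i * G x y) / (b i)\<^sup>2 \<partial>\<mu> i)"
    by (intro integral_mono G2_integrable integrable_divide integrable_mult_right exp_integrable2
         square_le_exp_div b_pos G_nonneg)
  also have "\<dots> \<le> 2 * C i / (b i)\<^sup>2"
    using exp_bound2[where i=i and x=x] b_pos[of i] by (simp add: divide_right_mono)
  finally show ?thesis .
qed

lemma C_nonneg: "0 \<le> C i"
proof -
  have "0 \<le> (\<integral>y. exp (b i * G x y) \<partial>\<mu> i)" for x by (rule integral_nonneg_AE) auto
  thus ?thesis using exp_bound2[of i] order_trans by blast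
qed

section \<open>Potentials and their modulus of continuity\<close>

definition pot :: "bool \<Rightarrow> ('a \<Rightarrow> real) \<Rightarrow> 'a \<Rightarrow> real" where
  "pot i f x = (\<integral>y. G x y * f y \<partial>\<mu> i)"

definition W :: "(bool \<Rightarrow> 'a \<Rightarrow> real) \<Rightarrow> bool \<Rightarrow> 'a \<Rightarrow> real" where
  "W g i x = 2 * pot i (g i) x - pot (\<not> i) (g (\<not> i)) x"

lemma pot_integrable:
  assumes [measurable]: "f \<in> borel_measurable borel" and "\<And>x. \<bar>f x\<bar> \<le> M"
  shows "integrable (\<mu> i) (\<lambda>y. G x y * f y)"
proof (rule Bochner_Integration.integrable_bound)
  show "integrable (\<mu> i) (\<lambda>y. G x y * M)" by (intro integrable_mult_left G_integrable)
  have "norm (G x y * f y) \<le> norm (G x y * M)" for y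
    using assms(2)[of y] G_nonneg[of x y] by (auto simp: abs_mult intro!: mult_left_mono)
  thus "AE y in \<mu> i. norm (G x y * f y) \<le> norm (G x y * M)" by simp
qed simp

lemma pot_meas[measurable]:
  assumes [measurable]: "f \<in> borel_measurable borel"
  shows "pot i f \<in> borel_measurable borel"
  unfolding pot_def
  by (rule borel_measurable_lebesgue_integral) measurable

lemma pot_le:
  assumes [measurable]: "f \<in> borel_measurable borel" and M: "\<And>x. \<bar>f x\<bar> \<le> M"
  shows "\<bar>pot i f x\<bar> \<le> M * (C i / b i)"
proof -
  have M0: "M \<ge> 0" using M[of undefined] by linarith
  have "\<bar>pot i f x\<bar> \<le> (\<integral>y. \<bar>G x y * f y\<bar> \<partial>\<mu> i)" unfolding pot_def by (rule integral_abs_bound)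
  also have "\<dots> \<le> (\<integral>y. M * G x y \<partial>\<mu> i)"
  proof (rule integral_mono)
    show "integrable (\<mu> i) (\<lambda>y. \<bar>G x y * f y\<bar>)" using pot_integrable[OF assms] by simp
    show "integrable (\<mu> i) (\<lambda>y. M * G x y)" using G_integrable by simp
    show "\<bar>G x y * f y\<bar> \<le> M * G x y" for y
      using mult_left_mono[OF M[of y] G_nonneg[of x y]] G_nonneg[of x y] by (simp add: abs_mult mult.commute)
  qed
  also have "\<dots> \<le> M * (C i / b i)" using G_bound[where x=x and i=i] M0 by (simp add: mult_left_mono del: times_divide_eq_right)
  finally show ?thesis .
qed

lemma pot_nonneg: "(\<And>x. 0 \<le> f x) \<Longrightarrow> 0 \<le> pot i f x"
  unfolding pot_def by (rule integral_nonneg_AE) (auto simp: G_nonneg)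

lemma pot_diff:
  assumes "f \<in> borel_measurable borel" "\<And>x. \<bar>f x\<bar> \<le> M"
    "g \<in> borel_measurable borel" "\<And>x. \<bar>g x\<bar> \<le> N"
  shows "pot i (\<lambda>x. f x - g x) x = pot i f x - pot i g x"
  unfolding pot_def using pot_integrable[OF assms(1,2)] pot_integrable[OF assms(3,4)]
  by (simp add: right_diff_distrib)

text \<open>Fubini and the symmetry of \<open>G\<close>; the uniform bound on potentials of bounded
  functions gives the absolute integrability. This is what makes the interaction form
  symmetric.\<close>

lemma pot_sym:
  assumes [measurable]: "f \<in> borel_measurable borel" and M: "\<And>x. \<bar>f x\<bar> \<le> M"
    and [measurable]: "h \<in> borel_measurable borel" and N: "\<And>x. \<bar>h x\<bar> \<le> N"
  shows "(\<integral>x. pot j f x * h x \<partial>\<mu> i) = (\<integral>y. pot i h y * f y \<partial>\<mu> j)"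
proof -
  interpret P: pair_sigma_finite "\<mu> i" "\<mu> j" ..
  have N0: "N \<ge> 0" using N[of undefined] by linarith
  have M0: "M \<ge> 0" using M[of undefined] by linarith
  have int: "integrable (\<mu> i \<Otimes>\<^sub>M \<mu> j) (\<lambda>(x,y). G x y * f y * h x)"
  proof (rule P.Fubini_integrable)
    show "integrable (\<mu> i) (\<lambda>x. \<integral>y. norm (case (x, y) of (x, y) \<Rightarrow> G x y * f y * h x) \<partial>\<mu> j)"
    proof (rule integrable_const_bound[of _ "M * (C j / b j) * N"], rule AE_I2)
      fix x
      have "(\<integral>y. norm (G x y * f y * h x) \<partial>\<mu> j) = (\<integral>y. \<bar>h x\<bar> * (G x y * \<bar>f y\<bar>) \<partial>\<mu> j)"
        by (intro Bochner_Integration.integral_cong) (auto simp: abs_mult G_nonneg)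
      also have "\<dots> = \<bar>h x\<bar> * pot j (\<lambda>y. \<bar>f y\<bar>) x" unfolding pot_def by simp
      also have "\<dots> \<le> N * (M * (C j / b j))"
        using pot_le[of "\<lambda>y. \<bar>f y\<bar>" M j x] M N[of x] N0
        by (intro mult_mono) (auto simp: abs_le_iff intro!: pot_nonneg)
      finally show "norm (\<integral>y. norm (case (x, y) of (x, y) \<Rightarrow> G x y * f y * h x) \<partial>\<mu> j) \<le> M * (C j / b j) * N"
        by (simp add: mult_ac)
    qed measurable
    show "AE x in \<mu> i. integrable (\<mu> j) (\<lambda>y. case (x, y) of (x, y) \<Rightarrow> G x y * f y * h x)"
      using pot_integrable[OF assms(1,2)] by simp
  qed measurable
  have "(\<integral>x. pot j f x * h x \<partial>\<mu> i) = (\<integral>x. (\<integral>y. G x y * f y * h x \<partial>\<mu> j) \<partial>\<mu> i)"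
    unfolding pot_def using pot_integrable[OF assms(1,2)] by simp
  also have "\<dots> = (\<integral>y. (\<integral>x. G x y * f y * h x \<partial>\<mu> i) \<partial>\<mu> j)"
    by (rule P.Fubini_integral[symmetric]) (rule int)
  also have "\<dots> = (\<integral>y. pot i h y * f y \<partial>\<mu> j)"
    unfolding pot_def by (subst G_sym) (simp add: mult_ac)
  finally show ?thesis .
qed

text \<open>Continuity of the kernel sections in L1, although the kernel may be unbounded. Below a
  level N dominated convergence applies on the finite measure; the part above N costs at most the
  second moment divided by N, uniformly in the base point.\<close>

lemma G_L1_continuous: "((\<lambda>z. \<integral>y. \<bar>G z y - G x y\<bar> \<partial>\<mu> i) \<longlongrightarrow> 0) (at x)"
proof (rule tendsto_at_iff_sequentially[THEN iffD2])
  show "\<forall>X. (\<forall>n. X n \<in> UNIV - {x}) \<longrightarrow> X \<longlonglongrightarrow> x \<longrightarrow> ((\<lambda>z. \<integral>y. \<bar>G z y - G x y\<bar> \<partial>\<mu> i) \<circ> X) \<longlonglongrightarrow> 0"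
  proof (intro allI impI)
    fix X :: "nat \<Rightarrow> 'a" assume X: "X \<longlonglongrightarrow> x"
    show "((\<lambda>z. \<integral>y. \<bar>G z y - G x y\<bar> \<partial>\<mu> i) \<circ> X) \<longlonglongrightarrow> 0"
      unfolding comp_def
    proof (rule LIMSEQ_I)
      fix e :: real assume e: "e > 0"
      define D where "D = 2 * C i / (b i)\<^sup>2"
      have D: "D \<ge> 0" "\<And>z. (\<integral>y. (G z y)\<^sup>2 \<partial>\<mu> i) \<le> D" using G2_bound C_nonneg by (auto simp: D_def)
      \<comment> \<open>The level makes the two tails, each at most D / N, together smaller than e /
        2; adding 1 keeps it positive when D = 0.\<close>
      define N where "N = 4 * D / e + 1"
      have N: "N > 0" "2 * D / N < e / 2" using D e by (auto simp: N_def field_simps add_nonneg_pos)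
      define m where "m t = min t N" for t :: real
      let ?d = "\<lambda>n y. \<bar>m (G (X n) y) - m (G x y)\<bar>"
      have lim: "(\<lambda>n. \<integral>y. (?d n y) \<partial>\<mu> i) \<longlonglongrightarrow> (\<integral>y. 0 \<partial>\<mu> i)"
      proof (rule integral_dominated_convergence[where w="\<lambda>_. N"])
        show "AE y in \<mu> i. (\<lambda>n. (?d n y)) \<longlonglongrightarrow> 0"
          using G_cont[where x=x and i=i]
        proof eventually_elim
          case (elim y)
          hence "(\<lambda>n. G (X n) y) \<longlonglongrightarrow> G x y"
            using X isCont_tendsto_compose by blast
          hence "(\<lambda>n. (?d n y)) \<longlonglongrightarrow> \<bar>m (G x y) - m (G x y)\<bar>"
            unfolding m_def by (intro tendsto_intros)
          thus ?case by simp
        qed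
        show "AE y in \<mu> i. norm (?d n y) \<le> N" for n
        proof (rule AE_I2)
          fix y
          show "norm (?d n y) \<le> N"
            using G_nonneg[of "X n" y] G_nonneg[of x y] N(1) by (auto simp: m_def min_def)
        qed
      qed (auto simp: m_def)
      hence "\<exists>n0. \<forall>n\<ge>n0. \<bar>\<integral>y. (?d n y) \<partial>\<mu> i\<bar> < e / 2"
        using LIMSEQ_D[OF lim half_gt_zero[OF e]] by simp
      then obtain n0 where n0: "\<And>n. n \<ge> n0 \<Longrightarrow> \<bar>\<integral>y. (?d n y) \<partial>\<mu> i\<bar> < e / 2"
        by blast
      have "norm ((\<integral>y. \<bar>G (X n) y - G x y\<bar> \<partial>\<mu> i) - 0) < e" if n: "n \<ge> n0" for n
      proof -
        have t: "\<bar>t - m t\<bar> \<le> t\<^sup>2 / N" if "t \<ge> 0" for t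
        proof (cases "t \<le> N")
          case False
          have "t * N \<le> t * t" using False N(1) by (intro mult_left_mono) auto
          hence "t \<le> t\<^sup>2 / N" using N(1) by (simp add: field_simps power2_eq_square)
          thus ?thesis using False N(1) by (auto simp: m_def)
        qed (use N(1) in \<open>auto simp: m_def\<close>)
        have p: "\<bar>G (X n) y - G x y\<bar> \<le> (?d n y) + (G (X n) y)\<^sup>2 / N + (G x y)\<^sup>2 / N" for y
          using t[OF G_nonneg[of "X n" y]] t[OF G_nonneg[of x y]] by linarith
        have i1: "integrable (\<mu> i) (\<lambda>y. (?d n y))"
        proof (rule integrable_const_bound[of _ N], rule AE_I2)
          fix y
          show "norm (?d n y) \<le> N"
            using G_nonneg[of "X n" y] G_nonneg[of x y] N(1) by (auto simp: m_def min_def)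
        qed (auto simp: m_def)
        have i2: "integrable (\<mu> i) (\<lambda>y. (G (X n) y)\<^sup>2 / N)" "integrable (\<mu> i) (\<lambda>y. (G x y)\<^sup>2 / N)"
          using G2_integrable by auto
        have "(\<integral>y. \<bar>G (X n) y - G x y\<bar> \<partial>\<mu> i) \<le> (\<integral>y. (?d n y) + (G (X n) y)\<^sup>2 / N + (G x y)\<^sup>2 / N \<partial>\<mu> i)"
          by (intro integral_mono p) (use i1 i2 G_integrable in auto)
        also have "\<dots> = (\<integral>y. (?d n y) \<partial>\<mu> i) + (\<integral>y. (G (X n) y)\<^sup>2 \<partial>\<mu> i) / N + (\<integral>y. (G x y)\<^sup>2 \<partial>\<mu> i) / N"
          using i1 i2 G2_integrable by simp
        also have "\<dots> \<le> (\<integral>y. (?d n y) \<partial>\<mu> i) + D / N + D / N"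
          using D N(1) by (intro add_mono divide_right_mono) auto
        also have "\<dots> < e / 2 + 2 * D / N" using n0[OF n] by (auto simp: abs_less_iff)
        also have "\<dots> < e" using N(2) by linarith
        finally show ?thesis by (simp add: integral_nonneg_AE abs_of_nonneg)
      qed
      thus "\<exists>no. \<forall>n\<ge>no. norm ((\<integral>y. \<bar>G (X n) y - G x y\<bar> \<partial>\<mu> i) - 0) < e" by blast
    qed
  qed
qed

text \<open>The difference of two values of a potential is at most M times the L1 distance of two
  kernel sections, so one d serves all densities bounded by M. Dividing by M + 1 avoids the case M =
  0.\<close>

lemma pot_equicontinuous:
  assumes "e > 0" "M \<ge> 0"
  shows "\<exists>d>0. \<forall>z. dist z x < d \<longrightarrow> (\<forall>f\<in>borel_measurable borel. (\<forall>y. \<bar>f y\<bar> \<le> M) \<longrightarrow> \<bar>pot i f z - pot i f x\<bar> < e)"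
proof -
  have e: "e / (M + 1) > 0" using assms by simp
  obtain d where d: "d > 0" "\<And>z. z \<noteq> x \<Longrightarrow> dist z x < d \<Longrightarrow> (\<integral>y. \<bar>G z y - G x y\<bar> \<partial>\<mu> i) < e / (M + 1)"
    using tendstoD[OF G_L1_continuous[where x=x and i=i] e] unfolding eventually_at by (auto simp: abs_less_iff)
  show ?thesis
  proof (intro exI[of _ d] conjI d(1) allI impI ballI)
    fix z and f :: "'a \<Rightarrow> real" assume z: "dist z x < d" and f[measurable]: "f \<in> borel_measurable borel" and M: "\<forall>y. \<bar>f y\<bar> \<le> M"
    show "\<bar>pot i f z - pot i f x\<bar> < e"
    proof (cases "z = x")
      case False
      note pi = pot_integrable[OF f M[rule_format]]
      have "\<bar>pot i f z - pot i f x\<bar> = \<bar>\<integral>y. (G z y - G x y) * f y \<partial>\<mu> i\<bar>"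
        unfolding pot_def using pi by (simp add: left_diff_distrib)
      also have "\<dots> \<le> (\<integral>y. \<bar>(G z y - G x y) * f y\<bar> \<partial>\<mu> i)" by (rule integral_abs_bound)
      also have "\<dots> \<le> (\<integral>y. M * \<bar>G z y - G x y\<bar> \<partial>\<mu> i)"
      proof (rule integral_mono)
        show "integrable (\<mu> i) (\<lambda>y. \<bar>(G z y - G x y) * f y\<bar>)"
          using Bochner_Integration.integrable_diff[OF pi[where i=i and x=z] pi[where i=i and x=x]] by (simp add: left_diff_distrib)
        show "integrable (\<mu> i) (\<lambda>y. M * \<bar>G z y - G x y\<bar>)" using G_integrable by simp
        show "\<bar>(G z y - G x y) * f y\<bar> \<le> M * \<bar>G z y - G x y\<bar>" for y
          using mult_left_mono[OF M[rule_format, of y], of "\<bar>G z y - G x y\<bar>"] by (simp add: abs_mult mult.commute)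
      qed
      also have "\<dots> = M * (\<integral>y. \<bar>G z y - G x y\<bar> \<partial>\<mu> i)" by simp
      also have "\<dots> \<le> M * (e / (M + 1))" using d(2)[OF False z] assms by (intro mult_left_mono) auto
      also have "\<dots> < e" using assms by (simp add: field_simps)
      finally show ?thesis .
    qed (use assms in simp)
  qed
qed

end

text \<open>Positive definiteness is split off because for the concrete kernel it is proved with the
  integrability and the bounds derived in \<open>toda_kernel\<close>.\<close>

locale toda_potential = toda_kernel \<mu> G F b C
  for \<mu> :: "bool \<Rightarrow> 'a::{metric_space, second_countable_topology} measure" and G F b C +
  assumes pos_def: "\<And>h B. \<lbrakk>\<And>i. h i \<in> borel_measurable borel; \<And>i x. \<bar>h i x\<bar> \<le> B\<rbrakk> \<Longrightarrow> 0 \<le> toda_form \<mu> G h"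
begin

section \<open>Bounded Borel functions, the class in which the iteration lives\<close>

definition bmeas :: "('a \<Rightarrow> real) \<Rightarrow> bool" where
  "bmeas f \<longleftrightarrow> f \<in> borel_measurable borel \<and> (\<exists>B. \<forall>x. \<bar>f x\<bar> \<le> B)"

lemma bmeasI: "f \<in> borel_measurable borel \<Longrightarrow> (\<And>x. \<bar>f x\<bar> \<le> B) \<Longrightarrow> bmeas f"
  unfolding bmeas_def by blast

lemma bmeas_meas: "bmeas f \<Longrightarrow> f \<in> borel_measurable borel"
  unfolding bmeas_def by blast

lemma bmeas_integrable: assumes "bmeas f" shows "integrable (\<mu> i) f"
proof -
  obtain B where "\<And>x. \<bar>f x\<bar> \<le> B" using assms unfolding bmeas_def by blast
  thus ?thesis using bmeas_meas[OF assms] by (intro integrable_const_bound[of _ B]) auto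
qed

lemma bmeas_const: "bmeas (\<lambda>x. c)"
  by (rule bmeasI[of _ "\<bar>c\<bar>"]) auto

lemma bmeas_add: assumes "bmeas f" "bmeas g" shows "bmeas (\<lambda>x. f x + g x)"
proof -
  obtain B C where "\<And>x. \<bar>f x\<bar> \<le> B" "\<And>x. \<bar>g x\<bar> \<le> C" using assms unfolding bmeas_def by blast
  hence "\<bar>f x + g x\<bar> \<le> B + C" for x by (meson abs_triangle_ineq add_mono order_trans)
  thus ?thesis using assms[THEN bmeas_meas] by (intro bmeasI[of _ "B + C"]) auto
qed

lemma bmeas_mult: assumes "bmeas f" "bmeas g" shows "bmeas (\<lambda>x. f x * g x)"
proof -
  obtain B C where B: "\<And>x. \<bar>f x\<bar> \<le> B" "\<And>x. \<bar>g x\<bar> \<le> C" using assms unfolding bmeas_def by blast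
  have "\<bar>f x * g x\<bar> \<le> B * C" for x
    unfolding abs_mult using B(1)[of x] B(2)[of x] by (intro mult_mono) auto
  thus ?thesis using assms[THEN bmeas_meas] by (intro bmeasI[of _ "B * C"]) auto
qed

lemma bmeas_diff: assumes "bmeas f" "bmeas g" shows "bmeas (\<lambda>x. f x - g x)"
  using bmeas_add[OF assms(1) bmeas_mult[OF bmeas_const[of "-1"] assms(2)]] by simp

lemma bmeas_exp: assumes "bmeas f" shows "bmeas (\<lambda>x. exp (f x))"
proof -
  obtain B where "\<And>x. \<bar>f x\<bar> \<le> B" using assms unfolding bmeas_def by blast
  thus ?thesis using bmeas_meas[OF assms] by (intro bmeasI[of _ "exp B"]) (auto simp: abs_le_iff)
qed

lemma bmeas_ln: assumes "bmeas f" "c > 0" "\<And>x. c \<le> f x" shows "bmeas (\<lambda>x. ln (f x))"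
proof -
  obtain B where "\<And>x. \<bar>f x\<bar> \<le> B" using assms unfolding bmeas_def by blast
  hence B: "f x \<le> B" for x by (simp add: abs_le_iff)
  have "\<bar>ln (f x)\<bar> \<le> \<bar>ln c\<bar> + \<bar>ln B\<bar>" for x
  proof -
    have "ln c \<le> ln (f x)" using assms(2) assms(3)[of x] by simp
    moreover have "ln (f x) \<le> ln B" using assms(2) assms(3)[of x] B[of x] by simp
    ultimately show ?thesis by linarith
  qed
  thus ?thesis using bmeas_meas[OF assms(1)] by (intro bmeasI) auto
qed

lemma bmeas_pot: assumes "bmeas f" shows "bmeas (pot i f)"
  using assms pot_le pot_meas unfolding bmeas_def by meson

lemma bmeas_W: assumes "\<And>i. bmeas (g i)" shows "bmeas (W g i)"
  unfolding W_def using bmeas_diff[OF bmeas_mult[OF bmeas_const bmeas_pot] bmeas_pot] assms by simp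

lemmas bmeas_intros = bmeas_const bmeas_add bmeas_mult bmeas_diff bmeas_exp bmeas_pot bmeas_W

lemma pot_diff': "bmeas f \<Longrightarrow> bmeas g \<Longrightarrow> pot i (\<lambda>x. f x - g x) x = pot i f x - pot i g x"
  unfolding bmeas_def using pot_diff by meson

lemma W_diff:
  assumes "\<And>i. bmeas (f i)" "\<And>i. bmeas (g i)"
  shows "W (\<lambda>i x. f i x - g i x) i x = W f i x - W g i x"
  unfolding W_def using assms by (simp add: pot_diff')

lemma sum_bool: "(\<Sum>i\<in>UNIV. f i) = f True + f False" for f :: "bool \<Rightarrow> real"
  by (simp add: UNIV_bool)

section \<open>The interaction form, the energy and its decrease along a step\<close>

definition Q :: "(bool \<Rightarrow> 'a \<Rightarrow> real) \<Rightarrow> (bool \<Rightarrow> 'a \<Rightarrow> real) \<Rightarrow> real" where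
  "Q f h = (\<Sum>i\<in>UNIV. \<integral>x. W f i x * h i x \<partial>\<mu> i)"

lemma bmeas_common_bound:
  assumes "\<And>i :: bool. bmeas (f i)" shows "\<exists>B\<ge>0. \<forall>i x. \<bar>f i x\<bar> \<le> B"
proof -
  obtain B0 B1 where B: "\<And>x. \<bar>f True x\<bar> \<le> B0" "\<And>x. \<bar>f False x\<bar> \<le> B1"
    using assms[of True] assms[of False] unfolding bmeas_def by blast
  have "\<bar>f i x\<bar> \<le> max 0 (max B0 B1)" for i x using B(1)[of x] B(2)[of x] by (cases i) auto
  thus ?thesis by (intro exI[of _ "max 0 (max B0 B1)"]) simp
qed

lemma Q_nonneg: assumes "\<And>i. bmeas (f i)" shows "0 \<le> Q f f"
proof -
  obtain B where B: "\<And>i x. \<bar>f i x\<bar> \<le> B" using bmeas_common_bound[of f, OF assms] by blast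
  from pos_def[of f, OF bmeas_meas[OF assms] B] show ?thesis
    unfolding Q_def W_def pot_def toda_form_def .
qed

lemma pot_sym': assumes "bmeas f" "bmeas h" shows "(\<integral>x. pot j f x * h x \<partial>\<mu> i) = (\<integral>y. pot i h y * f y \<partial>\<mu> j)"
  using assms pot_sym unfolding bmeas_def by meson

lemma Q_expand:
  assumes "\<And>i. bmeas (f i)" "\<And>i. bmeas (h i)"
  shows "Q f h = 2 * (\<integral>x. pot True (f True) x * h True x \<partial>\<mu> True) - (\<integral>x. pot False (f False) x * h True x \<partial>\<mu> True)
     + (2 * (\<integral>x. pot False (f False) x * h False x \<partial>\<mu> False) - (\<integral>x. pot True (f True) x * h False x \<partial>\<mu> False))"
proof -
  have "(\<integral>x. W f i x * h i x \<partial>\<mu> i) = 2 * (\<integral>x. pot i (f i) x * h i x \<partial>\<mu> i) - (\<integral>x. pot (\<not> i) (f (\<not> i)) x * h i x \<partial>\<mu> i)" for i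
  proof -
    have "integrable (\<mu> i) (\<lambda>x. pot j (f j) x * h i x)" for j
      by (intro bmeas_integrable bmeas_intros assms)
    thus ?thesis unfolding W_def by (simp add: left_diff_distrib mult.assoc)
  qed
  thus ?thesis unfolding Q_def by (simp add: UNIV_bool)
qed

lemma Q_sym: assumes "\<And>i. bmeas (f i)" "\<And>i. bmeas (h i)" shows "Q f h = Q h f"
  unfolding Q_expand[OF assms] Q_expand[OF assms(2,1)]
  using pot_sym'[OF assms(1)[of True] assms(2)[of True], where j=True and i=True]
    pot_sym'[OF assms(1)[of False] assms(2)[of False], where j=False and i=False]
    pot_sym'[OF assms(1)[of True] assms(2)[of False], where j=True and i=False]
    pot_sym'[OF assms(1)[of False] assms(2)[of True], where j=False and i=True]
  by linarith

lemma Q_diff_diff: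
  assumes "\<And>i. bmeas (f i)" "\<And>i. bmeas (g i)"
  shows "Q (\<lambda>i x. f i x - g i x) (\<lambda>i x. f i x - g i x) = Q f f - 2 * Q g f + Q g g"
proof -
  have i: "integrable (\<mu> i) (\<lambda>x. W f i x * f i x)" "integrable (\<mu> i) (\<lambda>x. W f i x * g i x)"
     "integrable (\<mu> i) (\<lambda>x. W g i x * f i x)" "integrable (\<mu> i) (\<lambda>x. W g i x * g i x)" for i
    by (intro bmeas_integrable bmeas_intros assms)+
  have "Q (\<lambda>i x. f i x - g i x) (\<lambda>i x. f i x - g i x) = Q f f - Q f g - (Q g f - Q g g)"
    unfolding Q_def W_diff[OF assms] using i
    by (simp add: left_diff_distrib right_diff_distrib sum_subtractf algebra_simps sum.distrib)
  thus ?thesis using Q_sym[OF assms] by simp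
qed

definition ent :: "bool \<Rightarrow> ('a \<Rightarrow> real) \<Rightarrow> real" where
  "ent i f = (\<integral>x. f x * ln (f x) \<partial>\<mu> i)"

definition energy :: "(bool \<Rightarrow> 'a \<Rightarrow> real) \<Rightarrow> real" where
  "energy g = (\<Sum>i\<in>UNIV. ent i (g i)) - Q g g / 2"

abbreviation partition_fn :: "(bool \<Rightarrow> 'a \<Rightarrow> real) \<Rightarrow> bool \<Rightarrow> real" where
  "partition_fn g i \<equiv> (\<integral>z. exp (W g i z) \<partial>\<mu> i)"

definition step :: "(bool \<Rightarrow> 'a \<Rightarrow> real) \<Rightarrow> bool \<Rightarrow> 'a \<Rightarrow> real" where
  "step g i x = F i * exp (W g i x) / partition_fn g i"

text \<open>The positive lower bound keeps the logarithms of the densities bounded, so that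
  entropies and relative entropies are integrals of bounded functions.\<close>

definition adm :: "(bool \<Rightarrow> 'a \<Rightarrow> real) \<Rightarrow> bool" where
  "adm g \<longleftrightarrow> (\<forall>i. bmeas (g i) \<and> (\<integral>x. g i x \<partial>\<mu> i) = F i \<and> (\<exists>c>0. \<forall>x. c \<le> g i x))"

lemma admD: assumes "adm g" shows "bmeas (g i)" "(\<integral>x. g i x \<partial>\<mu> i) = F i" "g i x > 0"
proof -
  show "bmeas (g i)" "(\<integral>x. g i x \<partial>\<mu> i) = F i" using assms unfolding adm_def by blast+
  show "g i x > 0" using assms unfolding adm_def by (meson less_le_trans)
qed

lemma adm_ln: assumes "adm g" shows "bmeas (\<lambda>x. ln (g i x))"
  using assms bmeas_ln unfolding adm_def by meson

lemma exp_W_bounds: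
  assumes "\<And>i. bmeas (g i)" and L: "\<And>x. \<bar>W g i x\<bar> \<le> L"
  shows "measure (\<mu> i) UNIV * exp (- L) \<le> partition_fn g i"
    "partition_fn g i \<le> measure (\<mu> i) UNIV * exp L"
    "0 < partition_fn g i"
proof -
  have i: "integrable (\<mu> i) (\<lambda>z. exp (W g i z))" by (intro bmeas_integrable bmeas_intros assms)
  have "(\<integral>z. exp (- L) \<partial>\<mu> i) \<le> partition_fn g i"
    using L by (intro integral_mono i) (auto simp: abs_le_iff minus_le_iff)
  thus 1: "measure (\<mu> i) UNIV * exp (- L) \<le> partition_fn g i" by simp
  have "partition_fn g i \<le> (\<integral>z. exp L \<partial>\<mu> i)"
    using L by (intro integral_mono i) (auto simp: abs_le_iff)
  thus "partition_fn g i \<le> measure (\<mu> i) UNIV * exp L" by simp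
  show "0 < partition_fn g i"
    using less_le_trans[OF mult_pos_pos[OF mu_pos[of i] exp_gt_zero] 1] .
qed

text \<open>A bound on the potential that is uniform over a family of densities becomes a sup bound
  on their images under \<open>step\<close>; this is how the iterates are controlled
  pointwise.\<close>

lemma step_bounds:
  assumes "\<And>i. bmeas (g i)" and L: "\<And>x. \<bar>W g i x\<bar> \<le> L"
  shows "F i * exp (- L) / (measure (\<mu> i) UNIV * exp L) \<le> step g i x"
    "step g i x \<le> F i * exp L / (measure (\<mu> i) UNIV * exp (- L))"
proof -
  have e: "F i * exp (- L) \<le> F i * exp (W g i x)" "F i * exp (W g i x) \<le> F i * exp L"
    using L[of x] F_pos[of i] by (auto simp: abs_le_iff)
  have p: "0 < measure (\<mu> i) UNIV * exp (- L)" "0 \<le> F i * exp (W g i x)" "0 \<le> F i * exp L"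
    using mu_pos[of i] F_pos[of i] by simp_all
  note Z = exp_W_bounds[OF assms]
  show "F i * exp (- L) / (measure (\<mu> i) UNIV * exp L) \<le> step g i x"
    unfolding step_def by (rule frac_le[OF p(2) e(1) Z(3,2)])
  show "step g i x \<le> F i * exp L / (measure (\<mu> i) UNIV * exp (- L))"
    unfolding step_def by (rule frac_le[OF p(3) e(2) p(1) Z(1)])
qed

lemma bmeas_W_bound: assumes "\<And>i. bmeas (g i)" shows "\<exists>L. \<forall>x. \<bar>W g i x\<bar> \<le> L"
  using bmeas_W[of g i, OF assms] unfolding bmeas_def by blast

text \<open>Exponentiating and normalizing restores positivity and mass whatever the bounded input
  is, so the iteration may start from a function that is not admissible.\<close>

lemma step_adm: assumes "\<And>i. bmeas (g i)" shows "adm (step g)"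
  unfolding adm_def
proof (intro allI conjI)
  fix i
  obtain L where L: "\<And>x. \<bar>W g i x\<bar> \<le> L" using bmeas_W_bound[of g i, OF assms] by metis
  note Z = exp_W_bounds(3)[OF assms L]
  have e: "step g i = (\<lambda>x. F i / partition_fn g i * exp (W g i x))"
    by (simp add: step_def fun_eq_iff)
  show "bmeas (step g i)" unfolding e by (intro bmeas_mult bmeas_const bmeas_exp bmeas_W assms)
  show "(\<integral>x. step g i x \<partial>\<mu> i) = F i"
  proof -
    have "(\<integral>x. step g i x \<partial>\<mu> i) = F i / partition_fn g i * partition_fn g i"
      unfolding e by (rule integral_mult_right_zero)
    also have "\<dots> = F i" using Z by (metis less_numeral_extra(3) nonzero_eq_divide_eq)
    finally show ?thesis .
  qed
  show "\<exists>c>0. \<forall>x. c \<le> step g i x"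
  proof (intro exI conjI allI)
    show "0 < F i * exp (- L) / (measure (\<mu> i) UNIV * exp L)"
      by (intro divide_pos_pos mult_pos_pos F_pos mu_pos exp_gt_zero)
    show "F i * exp (- L) / (measure (\<mu> i) UNIV * exp L) \<le> step g i x" for x
      by (rule step_bounds(1)[OF assms L])
  qed
qed

text \<open>The logarithm of a step is the potential up to a constant. At a fixed point this is the
  Euler equation, and integrated against any admissible density the constant contributes only
  through the fixed mass.\<close>

lemma ln_step: assumes "\<And>i. bmeas (g i)"
  shows "ln (step g i x) = W g i x + ln (F i / partition_fn g i)"
proof -
  obtain L where L: "\<And>x. \<bar>W g i x\<bar> \<le> L" using bmeas_W_bound[of g i, OF assms] by metis
  note Z = exp_W_bounds(3)[OF assms L]
  have "step g i x = exp (W g i x) * (F i / partition_fn g i)" by (simp add: step_def)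
  thus ?thesis using Z F_pos[of i] by (simp only: ln_mult) (simp add: ln_mult)
qed

text \<open>Relative entropy without the correction terms -g + t of
  \<open>square_diff_le_relative_entropy\<close>; these integrate to zero for admissible densities,
  whose masses agree.\<close>

definition KL :: "(bool \<Rightarrow> 'a \<Rightarrow> real) \<Rightarrow> (bool \<Rightarrow> 'a \<Rightarrow> real) \<Rightarrow> bool \<Rightarrow> real" where
  "KL g t i = (\<integral>x. g i x * ln (g i x / t i x) \<partial>\<mu> i)"

lemma KL_eq: assumes "adm g" "adm t"
  shows "KL g t i = ent i (g i) - (\<integral>x. g i x * ln (t i x) \<partial>\<mu> i)"
proof -
  have "KL g t i = (\<integral>x. g i x * ln (g i x) - g i x * ln (t i x) \<partial>\<mu> i)"
    unfolding KL_def using admD(3)[OF assms(1)] admD(3)[OF assms(2)]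
    by (intro Bochner_Integration.integral_cong refl) (simp add: ln_divide_pos right_diff_distrib)
  also have "\<dots> = ent i (g i) - (\<integral>x. g i x * ln (t i x) \<partial>\<mu> i)"
    unfolding ent_def
    by (intro Bochner_Integration.integral_diff bmeas_integrable bmeas_mult admD(1)[OF assms(1)] adm_ln[OF assms(1)] adm_ln[OF assms(2)])
  finally show ?thesis .
qed

text \<open>Let t be the step from g. As ln t is W g plus a constant, the entropies of t and the
  relative entropies of g to t are expressed through Q g t, Q g g and the same constants. What
  remains of the difference of the two sides is half of Q applied to t - g, which is
  nonnegative.\<close>

lemma energy_step:
  assumes "adm g"
  shows "energy (step g) \<le> energy g - (\<Sum>i\<in>UNIV. KL g (step g) i)"
proof -
  define t where "t = step g"
  have t: "adm t" unfolding t_def by (rule step_adm) (rule admD[OF assms])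
  note g = admD(1)[OF assms] and tb = admD(1)[OF t]
  define l where "l i = ln (F i / partition_fn g i)" for i
  have ln_t: "ln (t i x) = W g i x + l i" for i x unfolding t_def l_def by (rule ln_step[OF g])
  have X: "(\<integral>x. f i x * ln (t i x) \<partial>\<mu> i) = (\<integral>x. W g i x * f i x \<partial>\<mu> i) + l i * F i" if "adm f" for f i
  proof -
    have i: "integrable (\<mu> i) (\<lambda>x. W g i x * f i x)" "integrable (\<mu> i) (\<lambda>x. l i * f i x)"
      by (intro bmeas_integrable bmeas_intros g admD(1)[OF that])+
    have "(\<integral>x. f i x * ln (t i x) \<partial>\<mu> i) = (\<integral>x. W g i x * f i x + l i * f i x \<partial>\<mu> i)"
      unfolding ln_t by (simp only: distrib_left mult.commute)
    thus ?thesis using i admD(2)[OF that, of i] by simp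
  qed
  have "(\<Sum>i\<in>UNIV. KL g t i) = (\<Sum>i\<in>UNIV. ent i (g i)) - Q g g - (\<Sum>i\<in>UNIV. l i * F i)"
    unfolding KL_eq[OF assms t] X[OF assms] Q_def by (simp add: sum_subtractf sum.distrib)
  moreover have "(\<Sum>i\<in>UNIV. ent i (t i)) = Q g t + (\<Sum>i\<in>UNIV. l i * F i)"
    unfolding ent_def X[OF t] Q_def by (simp add: sum.distrib)
  moreover have "0 \<le> Q t t - 2 * Q g t + Q g g"
    using Q_nonneg[of "\<lambda>i x. t i x - g i x", OF bmeas_diff[OF tb g]] unfolding Q_diff_diff[OF tb g] .
  ultimately show ?thesis unfolding energy_def t_def[symmetric] by linarith
qed

text \<open>Turns the decay of relative entropy along the iteration into convergence in \<open>L\<^sup>2\<close>.\<close>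

lemma square_diff_le_KL:
  assumes "adm g" "adm t" "\<And>x. g i x \<le> M" "\<And>x. t i x \<le> M"
  shows "(\<integral>x. (g i x - t i x)\<^sup>2 \<partial>\<mu> i) \<le> 4 * M * KL g t i"
proof -
  note b = admD(1)[OF assms(1), of i] admD(1)[OF assms(2), of i]
  have bk: "bmeas (\<lambda>x. g i x * ln (g i x / t i x))"
  proof -
    have "(\<lambda>x. g i x * ln (g i x / t i x)) = (\<lambda>x. g i x * (ln (g i x) - ln (t i x)))"
      using admD(3)[OF assms(1)] admD(3)[OF assms(2)] by (simp add: ln_divide_pos fun_eq_iff)
    thus ?thesis by (simp only:) (intro bmeas_mult bmeas_diff adm_ln[OF assms(1)] adm_ln[OF assms(2)] b)
  qed
  note i = bmeas_integrable[OF bk, of i] bmeas_integrable[OF b(1), of i] bmeas_integrable[OF b(2), of i]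
  have "(\<integral>x. (g i x - t i x)\<^sup>2 \<partial>\<mu> i) \<le> (\<integral>x. 4 * M * (g i x * ln (g i x / t i x) - g i x + t i x) \<partial>\<mu> i)"
  proof (rule integral_mono)
    show "integrable (\<mu> i) (\<lambda>x. (g i x - t i x)\<^sup>2)" unfolding power2_eq_square
      by (intro bmeas_integrable bmeas_intros b)
  qed (use i admD(3)[OF assms(1)] admD(3)[OF assms(2)] assms(3,4) square_diff_le_relative_entropy in auto)
  also have "\<dots> = 4 * M * (KL g t i - F i + F i)"
    using i admD(2)[OF assms(1), of i] admD(2)[OF assms(2), of i] by (simp add: KL_def)
  finally show ?thesis by simp
qed

lemma KL_nonneg: assumes "adm g" "adm t" shows "0 \<le> KL g t i"
proof -
  obtain B0 B1 where B: "\<And>x. \<bar>g i x\<bar> \<le> B0" "\<And>x. \<bar>t i x\<bar> \<le> B1"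
    using admD(1)[OF assms(1), of i] admD(1)[OF assms(2), of i] unfolding bmeas_def by blast
  \<comment> \<open>The 1 makes M strictly positive, so that it can be divided out at the
    end.\<close>
  define M where "M = max 1 (max B0 B1)"
  have M: "g i x \<le> M" "t i x \<le> M" for x using B(1)[of x] B(2)[of x] by (auto simp: M_def abs_le_iff le_max_iff_disj)
  have "0 \<le> (\<integral>x. (g i x - t i x)\<^sup>2 \<partial>\<mu> i)" by simp
  also have "\<dots> \<le> 4 * M * KL g t i" by (rule square_diff_le_KL[OF assms M])
  finally show ?thesis by (simp add: M_def zero_le_mult_iff)
qed

text \<open>This replaces the logarithmic Hardy-Littlewood-Sobolev inequality, up to an arbitrarily small loss in the constant.\<close>

lemma pot_le_ent:
  assumes "adm g"
  shows "b i * pot i (g i) y \<le> ent i (g i) - F i + C i"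
proof -
  note g = admD(1)[OF assms, of i]
  have ig: "integrable (\<mu> i) (\<lambda>x. G y x * g i x)" using g pot_integrable unfolding bmeas_def by meson
  have ie: "integrable (\<mu> i) (\<lambda>x. g i x * ln (g i x))" "integrable (\<mu> i) (g i)"
    by (intro bmeas_integrable bmeas_mult adm_ln[OF assms] g)+
  have "b i * pot i (g i) y = (\<integral>x. b i * (G y x * g i x) \<partial>\<mu> i)" unfolding pot_def by simp
  also have "\<dots> \<le> (\<integral>x. g i x * ln (g i x) - g i x + exp (b i * G y x) \<partial>\<mu> i)"
  proof (rule integral_mono)
    show "b i * (G y x * g i x) \<le> g i x * ln (g i x) - g i x + exp (b i * G y x)" for x
      using young_entropy[OF admD(3)[OF assms], of i x "b i * G y x"] by (simp add: mult_ac)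
  qed (use ig ie exp_integrable2 in auto)
  also have "\<dots> = ent i (g i) - F i + (\<integral>x. exp (b i * G y x) \<partial>\<mu> i)"
    unfolding ent_def using ie exp_integrable2 admD(2)[OF assms, of i] by simp
  also have "\<dots> \<le> ent i (g i) - F i + C i" using exp_bound2 by simp
  finally show ?thesis .
qed

text \<open>Young's inequality at t = 0, that is a ln a \<ge> a - 1, integrated against a finite
  measure.\<close>

lemma ent_ge: assumes "adm g" shows "F i - measure (\<mu> i) UNIV \<le> ent i (g i)"
proof -
  have ie: "integrable (\<mu> i) (\<lambda>x. g i x * ln (g i x))" "integrable (\<mu> i) (g i)"
    by (intro bmeas_integrable bmeas_mult adm_ln[OF assms] admD(1)[OF assms])+
  have "(\<integral>x. g i x - 1 \<partial>\<mu> i) \<le> ent i (g i)"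
    unfolding ent_def
  proof (rule integral_mono)
    show "g i x - 1 \<le> g i x * ln (g i x)" for x using young_entropy[OF admD(3)[OF assms], of i x 0] by simp
  qed (use ie in auto)
  thus ?thesis using ie admD(2)[OF assms, of i] by simp
qed

text \<open>Half of Q g g is the sum of the two self-interactions minus the cross interaction, and
  the latter is nonnegative since kernel and densities are. Each self-interaction is at most the
  mass times the sup bound on the potential from \<open>pot_le_ent\<close>, and so consumes only the
  fraction F/b < 1 of the entropy.\<close>

lemma energy_ge:
  assumes "adm g"
  shows "(\<Sum>i\<in>UNIV. (1 - F i / b i) * ent i (g i) - F i * (C i - F i) / b i) \<le> energy g"
proof -
  note g = admD(1)[OF assms]
  have g0: "0 \<le> g i x" for i x using admD(3)[OF assms] less_imp_le by blast
  have self: "(\<integral>x. pot i (g i) x * g i x \<partial>\<mu> i) \<le> F i * (ent i (g i) - F i + C i) / b i" for i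
  proof -
    have "(\<integral>x. pot i (g i) x * g i x \<partial>\<mu> i) \<le> (\<integral>x. (ent i (g i) - F i + C i) / b i * g i x \<partial>\<mu> i)"
    proof (rule integral_mono)
      show "pot i (g i) x * g i x \<le> (ent i (g i) - F i + C i) / b i * g i x" for x
        using pot_le_ent[OF assms, of i x] b_pos[of i] g0 by (intro mult_right_mono) (simp_all add: field_simps)
    qed (intro bmeas_integrable bmeas_intros g)+
    thus ?thesis using admD(2)[OF assms, of i] by (simp add: mult.commute)
  qed
  have cross: "0 \<le> (\<integral>x. pot j (g j) x * g i x \<partial>\<mu> i)" for i j
    by (intro integral_nonneg_AE AE_I2 mult_nonneg_nonneg pot_nonneg g0)
  have *: "(2 * p - r + (2 * q - s)) / 2 \<le> p' + q'" if "p \<le> p'" "q \<le> q'" "0 \<le> r" "0 \<le> s" for p q r s p' q' :: real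
    using that by argo
  have "Q g g / 2 \<le> (\<Sum>i\<in>UNIV. F i * (ent i (g i) - F i + C i) / b i)"
    unfolding Q_expand[OF g g] sum_bool
    by (rule *[OF self self cross cross])
  moreover have "(\<Sum>i\<in>UNIV. (1 - F i / b i) * ent i (g i) - F i * (C i - F i) / b i) =
     (\<Sum>i\<in>UNIV. ent i (g i)) - (\<Sum>i\<in>UNIV. F i * (ent i (g i) - F i + C i) / b i)"
    unfolding sum_subtractf[symmetric] using b_pos
    by (intro sum.cong refl) (simp add: add_divide_distrib diff_divide_distrib algebra_simps)
  ultimately show ?thesis unfolding energy_def by linarith
qed

lemma energy_bounded_below: "\<exists>E0. \<forall>g. adm g \<longrightarrow> E0 \<le> energy g"
proof (intro exI allI impI)
  fix g assume g: "adm g"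
  have "(\<Sum>i\<in>UNIV. (1 - F i / b i) * (F i - measure (\<mu> i) UNIV) - F i * (C i - F i) / b i)
      \<le> (\<Sum>i\<in>UNIV. (1 - F i / b i) * ent i (g i) - F i * (C i - F i) / b i)"
    using b_pos less_imp_le[OF F_less] by (intro sum_mono diff_right_mono mult_left_mono ent_ge[OF g]) simp
  also have "\<dots> \<le> energy g" by (rule energy_ge[OF g])
  finally show "(\<Sum>i\<in>UNIV. (1 - F i / b i) * (F i - measure (\<mu> i) UNIV) - F i * (C i - F i) / b i) \<le> energy g" .
qed

text \<open>Both coefficients 1 - F/b are positive and each entropy is bounded below, so an upper
  bound on the weighted sum bounds each entropy separately.\<close>

lemma ent_bounded: "\<exists>K. \<forall>g i. adm g \<longrightarrow> energy g \<le> E \<longrightarrow> ent i (g i) \<le> K"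
proof -
  define \<theta> where "\<theta> i = 1 - F i / b i" for i
  have th: "\<theta> i > 0" for i using b_pos[of i] F_less[of i] by (simp add: \<theta>_def)
  define R where "R = E + (\<Sum>i\<in>UNIV. F i * (C i - F i) / b i)"
  define K where "K i = (R - \<theta> (\<not> i) * (F (\<not> i) - measure (\<mu> (\<not> i)) UNIV)) / \<theta> i" for i
  have "ent i (g i) \<le> K i" if g: "adm g" "energy g \<le> E" for g i
  proof -
    have "(\<Sum>i\<in>UNIV. \<theta> i * ent i (g i)) \<le> R"
      using energy_ge[OF g(1)] g(2) by (simp add: sum_subtractf R_def \<theta>_def)
    hence "\<theta> i * ent i (g i) + \<theta> (\<not> i) * ent (\<not> i) (g (\<not> i)) \<le> R" by (cases i) (simp_all add: UNIV_bool)
    moreover have "\<theta> (\<not> i) * (F (\<not> i) - measure (\<mu> (\<not> i)) UNIV) \<le> \<theta> (\<not> i) * ent (\<not> i) (g (\<not> i))"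
      using th[of "\<not> i"] by (intro mult_left_mono ent_ge[OF g(1)]) simp
    ultimately have "ent i (g i) * \<theta> i \<le> R - \<theta> (\<not> i) * (F (\<not> i) - measure (\<mu> (\<not> i)) UNIV)"
      by (subst mult.commute) linarith
    thus ?thesis unfolding K_def pos_le_divide_eq[OF th[of i]] .
  qed
  moreover have "K i \<le> max (K True) (K False)" for i by (cases i) simp_all
  ultimately show ?thesis by (meson order_trans)
qed

text \<open>On an energy sublevel the entropies are bounded, and \<open>pot_le_ent\<close> turns an
  entropy bound into a bound on the potential at every point. No sup bound on the density enters, so
  the resulting L is common to the whole sublevel.\<close>

lemma W_bounded: "\<exists>L. \<forall>g i x. adm g \<longrightarrow> energy g \<le> E \<longrightarrow> \<bar>W g i x\<bar> \<le> L"
proof -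
  obtain K where K: "\<And>g i. adm g \<Longrightarrow> energy g \<le> E \<Longrightarrow> ent i (g i) \<le> K" using ent_bounded[of E] by blast
  define D where "D i = (K - F i + C i) / b i" for i
  have p: "0 \<le> pot i (g i) x" "pot i (g i) x \<le> D i" if "adm g" "energy g \<le> E" for g i x
  proof -
    show "0 \<le> pot i (g i) x" by (rule pot_nonneg) (use admD(3)[OF that(1)] less_imp_le in blast)
    show "pot i (g i) x \<le> D i"
      using pot_le_ent[OF that(1), of i x] K[OF that, of i] b_pos[of i] by (simp add: D_def field_simps)
  qed
  have "\<bar>W g i x\<bar> \<le> 2 * \<bar>D True\<bar> + 2 * \<bar>D False\<bar>" if "adm g" "energy g \<le> E" for g i x
  proof -
    have "D i \<le> \<bar>D True\<bar> + \<bar>D False\<bar>" for i by (cases i) simp_all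
    from this[of i] this[of "\<not> i"] show ?thesis
      using p[OF that, of i x] p[OF that, of "\<not> i" x] unfolding W_def by linarith
  qed
  thus ?thesis by blast
qed

end

section \<open>Compactness of the iterates and the fixed point\<close>

context toda_potential
begin

lemma W_equicontinuous:
  assumes "e > 0" "M \<ge> 0"
  shows "\<exists>d>0. \<forall>z g i. dist z x < d \<longrightarrow> (\<forall>j. bmeas (g j)) \<longrightarrow> (\<forall>j y. \<bar>g j y\<bar> \<le> M) \<longrightarrow> \<bar>W g i z - W g i x\<bar> < e"
proof -
  \<comment> \<open>\<open>W\<close> contains three potentials when counted with multiplicity, two
    of one component and one of the other.\<close>
  have e3: "e / 3 > 0" using assms by simp
  obtain d where d: "\<And>j. d j > 0" "\<And>j z f. dist z x < d j \<Longrightarrow> f \<in> borel_measurable borel \<Longrightarrow> (\<And>y. \<bar>f y\<bar> \<le> M) \<Longrightarrow> \<bar>pot j f z - pot j f x\<bar> < e / 3"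
    using pot_equicontinuous[OF e3 assms(2), of x] by metis
  show ?thesis
  proof (intro exI[of _ "min (d True) (d False)"] conjI allI impI)
    show "0 < min (d True) (d False)" using d(1) by simp
  next
    fix z and g :: "bool \<Rightarrow> 'a \<Rightarrow> real" and i
    assume z: "dist z x < min (d True) (d False)" and g: "\<forall>j. bmeas (g j)" "\<forall>j y. \<bar>g j y\<bar> \<le> M"
    have "dist z x < d j" for j using z by (cases j) auto
    hence p: "\<bar>pot j (g j) z - pot j (g j) x\<bar> < e / 3" for j using d(2)[of z j "g j"] g bmeas_meas by blast
    show "\<bar>W g i z - W g i x\<bar> < e" unfolding W_def using p[of i] p[of "\<not> i"] by linarith
  qed
qed

lemma continuous_W: assumes "\<And>i. bmeas (g i)" shows "continuous_on UNIV (W g i)"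
proof -
  obtain B where B: "B \<ge> 0" "\<And>i x. \<bar>g i x\<bar> \<le> B" using bmeas_common_bound[of g, OF assms] by blast
  have "\<exists>d>0. \<forall>z. dist z x < d \<longrightarrow> \<bar>W g i z - W g i x\<bar> < e" if "e > 0" for e x
    using W_equicontinuous[OF that B(1), of x] assms B(2) by metis
  thus ?thesis unfolding continuous_on_iff dist_real_def by blast
qed

text \<open>A Cauchy-Schwarz estimate in weighted form: G |h| is at most \<delta>/2 times G^2 plus
  h^2 / (2 \<delta>). The second moments of the kernel are bounded, so \<delta> is chosen first and
  then the L2 norm of h is made small.\<close>

lemma pot_tendsto_0:
  assumes h: "\<And>n. bmeas (h n)" and lim: "(\<lambda>n. \<integral>x. (h n x)\<^sup>2 \<partial>\<mu> i) \<longlonglongrightarrow> 0"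
  shows "(\<lambda>n. pot i (h n) x) \<longlonglongrightarrow> 0"
proof (rule LIMSEQ_I)
  fix e :: real assume e: "e > 0"
  define D where "D = 2 * C i / (b i)\<^sup>2"
  have D: "D \<ge> 0" "(\<integral>y. (G x y)\<^sup>2 \<partial>\<mu> i) \<le> D" using G2_bound C_nonneg by (auto simp: D_def)
  define \<delta> where "\<delta> = e / (D + 1)"
  have del: "\<delta> > 0" "\<delta> * D < e" using e D by (auto simp: \<delta>_def field_simps)
  obtain N where N: "\<And>n. n \<ge> N \<Longrightarrow> (\<integral>x. (h n x)\<^sup>2 \<partial>\<mu> i) < \<delta> * e"
    using LIMSEQ_D[OF lim mult_pos_pos[OF del(1) e]] by (auto simp: abs_less_iff)
  have "norm (pot i (h n) x - 0) < e" if n: "n \<ge> N" for n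
  proof -
    have ih: "integrable (\<mu> i) (\<lambda>y. G x y * h n y)" using h[of n] pot_integrable unfolding bmeas_def by meson
    have ih2: "integrable (\<mu> i) (\<lambda>y. (h n y)\<^sup>2)" unfolding power2_eq_square by (intro bmeas_integrable bmeas_mult h)
    have "\<bar>pot i (h n) x\<bar> \<le> (\<integral>y. \<bar>G x y * h n y\<bar> \<partial>\<mu> i)" unfolding pot_def by (rule integral_abs_bound)
    also have "\<dots> \<le> (\<integral>y. \<delta> / 2 * (G x y)\<^sup>2 + 1 / (2 * \<delta>) * (h n y)\<^sup>2 \<partial>\<mu> i)"
    proof (rule integral_mono)
      fix y
      have "0 \<le> (\<delta> * G x y - \<bar>h n y\<bar>)\<^sup>2 / (2 * \<delta>)" using del(1) by simp
      also have "\<dots> = \<delta> / 2 * (G x y)\<^sup>2 + 1 / (2 * \<delta>) * (h n y)\<^sup>2 - G x y * \<bar>h n y\<bar>"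
        using del(1) by (simp add: power2_eq_square field_simps)
      finally show "\<bar>G x y * h n y\<bar> \<le> \<delta> / 2 * (G x y)\<^sup>2 + 1 / (2 * \<delta>) * (h n y)\<^sup>2"
        using G_nonneg[of x y] by (simp add: abs_mult)
    qed (use ih ih2 G2_integrable in auto)
    also have "\<dots> = \<delta> / 2 * (\<integral>y. (G x y)\<^sup>2 \<partial>\<mu> i) + 1 / (2 * \<delta>) * (\<integral>y. (h n y)\<^sup>2 \<partial>\<mu> i)"
      using ih2 G2_integrable by simp
    also have "\<dots> < \<delta> / 2 * D + 1 / (2 * \<delta>) * (\<delta> * e)"
      using D(2) N[OF n] del(1) by (intro add_le_less_mono mult_left_mono mult_strict_left_mono) auto
    also have "\<dots> < e" using del by (simp add: field_simps)
    finally show ?thesis by simp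
  qed
  thus "\<exists>no. \<forall>n\<ge>no. norm (pot i (h n) x - 0) < e" by blast
qed

theorem fixed_point_exists: "\<exists>g. adm g \<and> step g = g"
proof -
  define g0 where "g0 = (\<lambda>(i::bool) (x::'a). 0 :: real)"
  \<comment> \<open>The zero function \<open>g0\<close> is not admissible, its image f is. Starting
    the sequence one step later makes every \<open>g n\<close> the image of an admissible density
    with energy at most that of f, so that \<open>step_bounds\<close> applies to all of
    them.\<close>
  define g where "g n = (step ^^ Suc (Suc n)) g0" for n
  have step_g: "step (g n) = g (Suc n)" for n by (simp add: g_def)
  have adm_iter: "adm ((step ^^ Suc n) g0)" for n
  proof (induction n)
    case 0 show ?case using step_adm[of g0] bmeas_const[of 0] by (simp add: g0_def)
  next
    case (Suc n) thus ?case using step_adm[of "(step ^^ Suc n) g0", OF admD(1)[OF Suc]] by simp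
  qed
  define f where "f = (step ^^ Suc 0) g0"
  have f: "adm f" "step f = g 0" using adm_iter[of 0] by (simp_all add: f_def g_def)
  have adm: "adm (g n)" for n using adm_iter[of "Suc n"] by (simp add: g_def)
  note bg = admD(1)[OF adm]
  have dec: "energy (g (Suc n)) \<le> energy (g n) - (\<Sum>i\<in>UNIV. KL (g n) (g (Suc n)) i)" for n
    using energy_step[OF adm[of n]] by (simp add: step_g)
  have kl0: "0 \<le> KL (g n) (g (Suc n)) i" for n i by (rule KL_nonneg[OF adm adm])
  have dec': "energy (g (Suc n)) \<le> energy (g n)" for n
    using dec[of n] kl0[of n True] kl0[of n False] by (simp add: sum_bool)
  have decs: "decseq (\<lambda>n. energy (g n))" by (rule decseq_SucI) (rule dec')
  have f_g: "energy (g 0) \<le> energy f"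
    using energy_step[OF f(1)] KL_nonneg[OF f(1) adm[of 0], of True]
       KL_nonneg[OF f(1) adm[of 0], of False] by (simp add: sum_bool f(2))
  have E: "energy (g n) \<le> energy f" for n using decseqD[OF decs, of 0 n] f_g by simp
  obtain L where L: "\<And>g i x. adm g \<Longrightarrow> energy g \<le> energy f \<Longrightarrow> \<bar>W g i x\<bar> \<le> L" using W_bounded by blast
  define B where "B i = F i * exp L / (measure (\<mu> i) UNIV * exp (- L))" for i
  \<comment> \<open>One sup bound for all iterates and both components: L depends only on the energy
    level of f.\<close>
  define M where "M = max (B True) (B False)"
  have BM: "B i \<le> M" for i by (cases i) (simp_all add: M_def)
  have gSuc: "g (Suc n) i x \<le> M" for n i x
    using step_bounds(2)[of "g n" i L x, OF bg L[OF adm E]] BM[of i] by (simp add: step_g B_def)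
  have gM: "g n i x \<le> M" for n i x
  proof (cases n)
    case 0
    show ?thesis using step_bounds(2)[of f i L x, OF admD(1)[OF f(1)] L[OF f(1) order_refl]] BM[of i]
      by (simp add: f(2) B_def 0)
  qed (simp add: gSuc)
  have gabs: "\<bar>g n i x\<bar> \<le> M" for n i x using gM[of n i x] admD(3)[OF adm[of n], of i x] by linarith
  have M0: "M \<ge> 0" using gabs[of 0 True undefined] by linarith
  note WL = L[OF adm E]

  obtain E0 where E0: "\<And>n. E0 \<le> energy (g n)" using energy_bounded_below adm by blast
  obtain e where "(\<lambda>n. energy (g n)) \<longlonglongrightarrow> e" using decseq_convergent[OF decs] E0 by blast
  hence "(\<lambda>n. energy (g n) - energy (g (Suc n))) \<longlonglongrightarrow> e - e" by (intro tendsto_diff LIMSEQ_Suc)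
  hence lim0: "(\<lambda>n. energy (g n) - energy (g (Suc n))) \<longlonglongrightarrow> 0" by simp
  have KL0: "(\<lambda>n. KL (g n) (g (Suc n)) i) \<longlonglongrightarrow> 0" for i
  proof (rule tendsto_sandwich[OF _ _ tendsto_const lim0])
    show "\<forall>\<^sub>F n in sequentially. KL (g n) (g (Suc n)) i \<le> energy (g n) - energy (g (Suc n))"
    proof (rule always_eventually, rule allI)
      fix n show "KL (g n) (g (Suc n)) i \<le> energy (g n) - energy (g (Suc n))"
        using dec[of n] kl0[of n True] kl0[of n False] by (cases i) (simp_all add: sum_bool)
    qed
  qed (simp add: kl0)
  have L2: "(\<lambda>n. \<integral>x. (g n i x - g (Suc n) i x)\<^sup>2 \<partial>\<mu> i) \<longlonglongrightarrow> 0" for i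
  proof (rule tendsto_sandwich[OF _ _ tendsto_const])
    show "(\<lambda>n. 4 * M * KL (g n) (g (Suc n)) i) \<longlonglongrightarrow> 0" using tendsto_mult_left[OF KL0[of i], of "4 * M"] by simp
    show "\<forall>\<^sub>F n in sequentially. (\<integral>x. (g n i x - g (Suc n) i x)\<^sup>2 \<partial>\<mu> i) \<le> 4 * M * KL (g n) (g (Suc n)) i"
      by (intro always_eventually allI square_diff_le_KL adm gM)
  qed simp
  have pot_lim: "(\<lambda>n. pot i (g n i) x - pot i (g (Suc n) i) x) \<longlonglongrightarrow> 0" for i x
    using pot_tendsto_0[of "\<lambda>n x. g n i x - g (Suc n) i x" i x, OF bmeas_diff[OF bg bg] L2] by (simp add: pot_diff' bg)

  obtain S :: "'a set" where S: "countable S" "\<And>X. open X \<Longrightarrow> X \<noteq> {} \<Longrightarrow> \<exists>d\<in>S. d \<in> X"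
    using countable_dense_exists by blast
  \<comment> \<open>Pairing the two components lets a single diagonal subsequence serve both. It
    converges on the countable dense set S; equicontinuity then extends convergence to every
    point.\<close>
  define p where "p n x = (W (g n) True x, W (g n) False x)" for n x
  have pL: "norm (p n x) \<le> 2 * L" for n x
    using norm_Pair_le[of "W (g n) True x" "W (g n) False x"] WL[of n True x] WL[of n False x] by (simp add: p_def)
  have "\<exists>k. strict_mono (k :: nat \<Rightarrow> nat) \<and> (\<forall>x\<in>S. \<exists>l. (\<lambda>n. p (k n) x) \<longlonglongrightarrow> l)"
    by (rule function_convergent_subsequence[of S p "2 * L", OF S(1) pL]) blast+
  then obtain k :: "nat \<Rightarrow> nat" where k: "strict_mono k" "\<And>x. x \<in> S \<Longrightarrow> \<exists>l. (\<lambda>n. p (k n) x) \<longlonglongrightarrow> l"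
    by blast
  have conv_S: "Cauchy (\<lambda>n. W (g (k n)) i x)" if x: "x \<in> S" for i x
  proof -
    obtain l where l: "(\<lambda>n. p (k n) x) \<longlonglongrightarrow> l" using k(2)[OF x] by blast
    show ?thesis using tendsto_fst[OF l] tendsto_snd[OF l] by (cases i) (auto simp: p_def intro!: LIMSEQ_imp_Cauchy)
  qed
  have "Cauchy (\<lambda>n. W (g (k n)) i x)" for i x
  proof (rule metric_CauchyI)
    fix e :: real assume e: "e > 0"
    obtain d where d: "d > 0" "\<And>z n. dist z x < d \<Longrightarrow> \<bar>W (g n) i z - W (g n) i x\<bar> < e / 3"
      using W_equicontinuous[of "e / 3" M x] e M0 bg gabs by fastforce
    obtain z where z: "z \<in> S" "dist z x < d" using S(2)[OF open_ball, of x d] d(1) by (auto simp: dist_commute)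
    obtain N where N: "\<And>m n. m \<ge> N \<Longrightarrow> n \<ge> N \<Longrightarrow> dist (W (g (k m)) i z) (W (g (k n)) i z) < e / 3"
      using metric_CauchyD[OF conv_S[OF z(1)], of "e / 3" i] e by auto
    show "\<exists>N. \<forall>m\<ge>N. \<forall>n\<ge>N. dist (W (g (k m)) i x) (W (g (k n)) i x) < e"
    proof (intro exI[of _ N] allI impI)
      fix m n assume "m \<ge> N" "n \<ge> N"
      from N[OF this] d(2)[OF z(2), of "k m"] d(2)[OF z(2), of "k n"]
      show "dist (W (g (k m)) i x) (W (g (k n)) i x) < e" unfolding dist_real_def by linarith
    qed
  qed
  hence "\<forall>i x. \<exists>l. (\<lambda>n. W (g (k n)) i x) \<longlonglongrightarrow> l"
    using Cauchy_convergent convergent_def by blast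
  then obtain w where w: "\<And>i x. (\<lambda>n. W (g (k n)) i x) \<longlonglongrightarrow> w i x" by metis
  have wmeas[measurable]: "w i \<in> borel_measurable borel" for i
    by (rule borel_measurable_LIMSEQ_real[OF w]) (use bmeas_meas[OF bmeas_W[of "g n" for n, OF bg]] in auto)
  have wL: "\<bar>w i x\<bar> \<le> L" for i x
    by (rule LIMSEQ_le_const2[OF tendsto_rabs[OF w]]) (use WL in auto)

  define Z where "Z i = (\<integral>z. exp (w i z) \<partial>\<mu> i)" for i
  have Zlim: "(\<lambda>n. \<integral>z. exp (W (g (k n)) i z) \<partial>\<mu> i) \<longlonglongrightarrow> Z i" for i
    unfolding Z_def
  proof (rule integral_dominated_convergence[where w="\<lambda>_. exp L"])
    show "AE x in \<mu> i. norm (exp (W (g (k n)) i x)) \<le> exp L" for n using WL by (auto simp: abs_le_iff)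
    show "AE x in \<mu> i. (\<lambda>n. exp (W (g (k n)) i x)) \<longlonglongrightarrow> exp (w i x)" by (intro AE_I2 tendsto_exp w)
  qed (use bmeas_meas[OF bmeas_exp[OF bmeas_W[of "g n" for n, OF bg]]] in auto)
  have Zpos: "Z i > 0" for i
  proof -
    have "measure (\<mu> i) UNIV * exp (- L) \<le> Z i"
      by (rule LIMSEQ_le_const[OF Zlim]) (use exp_W_bounds(1)[of "g (k n)" i L for n, OF bg WL] in blast)
    thus ?thesis using less_le_trans[OF mult_pos_pos[OF mu_pos[of i] exp_gt_zero]] by blast
  qed
  \<comment> \<open>The candidate is the normalized exponential of the limiting potential w.
    Pointwise it is the limit of the successors \<open>g (Suc (k n))\<close>, not of the selected
    iterates \<open>g (k n)\<close>.\<close>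
  define h where "h i x = F i * exp (w i x) / Z i" for i x
  have hlim: "(\<lambda>n. g (Suc (k n)) i x) \<longlonglongrightarrow> h i x" for i x
    unfolding step_g[symmetric] step_def h_def using Zpos[of i] by (intro tendsto_intros w Zlim) auto
  have hmeas: "h i \<in> borel_measurable borel" for i unfolding h_def by measurable
  have hM: "\<bar>h i x\<bar> \<le> M" for i x
    by (rule LIMSEQ_le_const2[OF tendsto_rabs[OF hlim]]) (use gabs in auto)
  have bh: "bmeas (h i)" for i by (rule bmeasI[OF hmeas hM])
  \<comment> \<open>The loop closes here. Dominated convergence gives the potentials of the
    successors; since consecutive iterates have asymptotically equal potentials, those of
    \<open>g (k n)\<close> have the same limit. Hence w is the potential of h itself.\<close>
  have pot_h: "(\<lambda>n. pot i (g (k n) i) x) \<longlonglongrightarrow> pot i (h i) x" for i x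
  proof -
    have "(\<lambda>n. pot i (g (Suc (k n)) i) x) \<longlonglongrightarrow> pot i (h i) x" unfolding pot_def
    proof (rule integral_dominated_convergence[where w="\<lambda>y. G x y * M"])
      show "AE y in \<mu> i. (\<lambda>n. G x y * g (Suc (k n)) i y) \<longlonglongrightarrow> G x y * h i y" by (intro AE_I2 tendsto_intros hlim)
      show "AE y in \<mu> i. norm (G x y * g (Suc (k n)) i y) \<le> G x y * M" for n
        using gabs G_nonneg by (intro AE_I2) (simp add: abs_mult mult_left_mono)
    qed (use bmeas_meas[OF bg] hmeas G_integrable in auto)
    from tendsto_add[OF LIMSEQ_subseq_LIMSEQ[OF pot_lim[of i x] k(1)] this] show ?thesis by (simp add: comp_def)
  qed
  have "(\<lambda>n. W (g (k n)) i x) \<longlonglongrightarrow> W h i x" for i x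
    unfolding W_def by (intro tendsto_intros pot_h)
  hence "w i x = W h i x" for i x using LIMSEQ_unique[OF w] by blast
  hence "w = W h" by (intro ext)
  hence "step h = h" by (intro ext) (simp add: step_def h_def Z_def)
  thus ?thesis using step_adm[of h, OF bh] by metis
qed

end

section \<open>Chordal distance and singular weights\<close>

lemma distr_norm_square:
  "distr lborel borel (\<lambda>x::real^2. (norm x)\<^sup>2) = density lborel (\<lambda>r. ennreal (pi * indicator {0..} r))"
proof (rule measure_eqI_generator_eq[where E="range (\<lambda>a::real. {..a})" and \<Omega>=UNIV and A="\<lambda>n. {..real n}"])
  show "Int_stable (range (\<lambda>a::real. {..a}))"
    by (auto simp: Int_stable_def intro!: image_eqI)
  have s: "sets borel = sigma_sets UNIV (range (\<lambda>a::real. {..a}))"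
    by (simp add: borel_eq_atMost)
  show "sets (distr lborel borel (\<lambda>x::real^2. (norm x)\<^sup>2)) = sigma_sets UNIV (range (\<lambda>a::real. {..a}))"
    "sets (density lborel (\<lambda>r. ennreal (pi * indicator {0..} r))) = sigma_sets UNIV (range (\<lambda>a::real. {..a}))"
    using s by simp_all
  have d: "emeasure (distr lborel borel (\<lambda>x::real^2. (norm x)\<^sup>2)) {..a} = ennreal (pi * max 0 a)" for a
  proof -
    have "emeasure (distr lborel borel (\<lambda>x::real^2. (norm x)\<^sup>2)) {..a} = emeasure lborel {x::real^2. (norm x)\<^sup>2 \<le> a}"
      by (subst emeasure_distr) (auto simp: vimage_def)
    also have "\<dots> = ennreal (pi * max 0 a)"
    proof (cases "a \<ge> 0")
      case True
      have "{x::real^2. (norm x)\<^sup>2 \<le> a} = cball 0 (sqrt a)"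
        using True by (auto simp: real_le_rsqrt sqrt_ge_absD)
      thus ?thesis using True emeasure_cball[of "sqrt a" "0::real^2"] by (simp add: unit_ball_vol_2 max_def)
    next
      case False
      hence "{x::real^2. (norm x)\<^sup>2 \<le> a} = {}" by (auto simp: not_le intro: less_le_trans)
      thus ?thesis using False by simp
    qed
    finally show ?thesis .
  qed
  show "emeasure (distr lborel borel (\<lambda>x::real^2. (norm x)\<^sup>2)) X = emeasure (density lborel (\<lambda>r. ennreal (pi * indicator {0..} r))) X"
    if XE: "X \<in> range (\<lambda>a::real. {..a})" for X
  proof -
    obtain a where X: "X = {..a}" using XE by auto
    have "emeasure (density lborel (\<lambda>r. ennreal (pi * indicator {0..} r))) X
        = (\<integral>\<^sup>+r. ennreal pi * indicator {0..a} r \<partial>lborel)"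
      unfolding X by (subst emeasure_density) (auto intro!: nn_integral_cong simp: indicator_def)
    also have "\<dots> = ennreal (pi * max 0 a)"
      by (subst nn_integral_cmult_indicator) (auto simp: ennreal_mult max_def)
    finally show ?thesis using d X by simp
  qed
  show "emeasure (distr lborel borel (\<lambda>x::real^2. (norm x)\<^sup>2)) {..real n} \<noteq> \<infinity>" for n
    by (simp add: d)
  show "(\<Union>n. {..real n}) = UNIV" by (auto simp: real_arch_simple)
qed auto

text \<open>Polar coordinates in disguise: discs have area pi times the squared radius, so the
  squared norm pushes Lebesgue measure to pi times Lebesgue measure on the half line.\<close>

lemma nn_integral_radial:
  assumes [measurable]: "f \<in> borel_measurable borel"
  shows "(\<integral>\<^sup>+x. f ((norm (x::real^2))\<^sup>2) \<partial>lborel) = ennreal pi * (\<integral>\<^sup>+r. f r * indicator {0..} r \<partial>lborel)"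
proof -
  have "(\<integral>\<^sup>+x. f ((norm (x::real^2))\<^sup>2) \<partial>lborel) = (\<integral>\<^sup>+r. f r \<partial>distr lborel borel (\<lambda>x::real^2. (norm x)\<^sup>2))"
    by (subst nn_integral_distr) auto
  also have "\<dots> = (\<integral>\<^sup>+r. ennreal (pi * indicator {0..} r) * f r \<partial>lborel)"
    unfolding distr_norm_square by (subst nn_integral_density) auto
  also have "\<dots> = (\<integral>\<^sup>+r. ennreal pi * (f r * indicator {0..} r) \<partial>lborel)"
    by (intro nn_integral_cong) (auto simp: indicator_def)
  also have "\<dots> = ennreal pi * (\<integral>\<^sup>+r. f r * indicator {0..} r \<partial>lborel)"
    by (subst nn_integral_cmult) auto
  finally show ?thesis .
qed

lemma nn_integral_bracket_powr:
  assumes p: "p > 1"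
  shows "(\<integral>\<^sup>+x. ennreal ((1 + (norm (x::real^2))\<^sup>2) powr (-p)) \<partial>lborel) = ennreal (pi / (p - 1))"
proof -
  have "(\<integral>\<^sup>+r. ennreal ((1 + r) powr (-p)) * indicator {0..} r \<partial>lborel) = ennreal (0 - (- ((1 + 0) powr (1 - p)) / (p - 1)))"
  proof (rule nn_integral_FTC_atLeast)
    show "((\<lambda>r. - ((1 + r) powr (1 - p)) / (p - 1)) has_real_derivative (1 + x) powr (- p)) (at x)" if "0 \<le> x" for x
    proof -
      have "((\<lambda>r. (1 + r) powr (1 - p)) has_real_derivative ((1 - p) * (1 + x) powr (1 - p - 1)) * 1) (at x)"
        by (rule DERIV_chain2[OF has_real_derivative_powr]) (use that in \<open>auto intro!: derivative_eq_intros\<close>)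
      moreover have "- (((1 - p) * (1 + x) powr (1 - p - 1)) * 1) / (p - 1) = (1 + x) powr (- p)"
      proof -
        have "- ((1 - p) * y * 1) / (p - 1) = y" for y using p by (simp add: field_simps)
        moreover have "1 - p - 1 = - p" by simp
        ultimately show ?thesis by presburger
      qed
      ultimately show ?thesis using DERIV_cdivide[OF DERIV_minus, of _ _ x UNIV "p - 1"] by metis
    qed
    have "((\<lambda>r::real. (1 + r) powr (1 - p)) \<longlongrightarrow> 0) at_top"
      by (rule tendsto_neg_powr) (use p in \<open>auto intro!: filterlim_tendsto_add_at_top tendsto_const filterlim_ident\<close>)
    from tendsto_divide[OF tendsto_minus[OF this] tendsto_const[of "p - 1"]]
    show "((\<lambda>r. - ((1 + r) powr (1 - p)) / (p - 1)) \<longlongrightarrow> 0) at_top" using p by simp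
  qed auto
  thus ?thesis using nn_integral_radial[of "\<lambda>r. ennreal ((1 + r) powr (-p))"] p
    by (simp add: ennreal_mult[symmetric])
qed

lemma nn_integral_norm_powr_ball:
  assumes s: "0 \<le> s" "s < 2"
  shows "(\<integral>\<^sup>+x. ennreal (norm (x::real^2) powr (-s)) * indicator (cball 0 1) x \<partial>lborel) = ennreal (pi / (1 - s / 2))"
proof -
  have "(\<integral>\<^sup>+r. ennreal (indicator {0..1} r * r powr (-s/2)) \<partial>lborel) = ennreal (1 powr (-s/2 + 1) / (-s/2 + 1))"
    by (rule nn_integral_has_integral_lebesgue) (use s has_integral_powr_from_0[of "-s/2" 1] in auto)
  also have "(\<integral>\<^sup>+r. ennreal (indicator {0..1} r * r powr (-s/2)) \<partial>lborel) =
      (\<integral>\<^sup>+r. (ennreal (r powr (-s/2)) * indicator {..1} r) * indicator {0..} r \<partial>lborel)"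
    by (intro nn_integral_cong) (auto simp: indicator_def)
  finally have 1: "(\<integral>\<^sup>+r. (ennreal (r powr (-s/2)) * indicator {..1} r) * indicator {0..} r \<partial>lborel) = ennreal (1 / (1 - s / 2))"
    by simp
  have "(\<integral>\<^sup>+x. ennreal (norm (x::real^2) powr (-s)) * indicator (cball 0 1) x \<partial>lborel)
      = (\<integral>\<^sup>+x. ennreal (((norm (x::real^2))\<^sup>2) powr (-s/2)) * indicator {..1} ((norm x)\<^sup>2) \<partial>lborel)"
  proof (intro nn_integral_cong)
    fix x :: "real^2"
    have "((norm x)\<^sup>2) powr (-s/2) = norm x powr (-s)"
      by (cases "x = 0") (simp_all add: powr_powr flip: powr_numeral)
    moreover have "(norm x)\<^sup>2 \<le> 1 \<longleftrightarrow> norm x \<le> 1" by (simp add: abs_square_le_1)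
    ultimately show "ennreal (norm x powr (-s)) * indicator (cball 0 1) x = ennreal (((norm x)\<^sup>2) powr (-s/2)) * indicator {..1} ((norm x)\<^sup>2)"
      by (simp add: indicator_def)
  qed
  also have "\<dots> = ennreal pi * ennreal (1 / (1 - s / 2))"
    using nn_integral_radial[of "\<lambda>r. ennreal (r powr (-s/2)) * indicator {..1} r"] 1 by simp
  also have "\<dots> = ennreal (pi / (1 - s / 2))" using s by (simp add: ennreal_mult[symmetric])
  finally show ?thesis .
qed

text \<open>sqrt (1 + |x|^2) is the norm of the vector (1, x), and the claim is the triangle
  inequality for such vectors.\<close>

lemma bracket_triangle:
  fixes x y :: "'a::real_inner"
  shows "sqrt (1 + (norm y)\<^sup>2) \<le> sqrt (1 + (norm x)\<^sup>2) + norm (x - y)"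
proof -
  have "norm ((1::real), y) \<le> norm ((1::real), x) + norm ((1, y) - ((1::real), x))"
    by (metis norm_triangle_sub)
  thus ?thesis by (simp add: norm_Pair norm_minus_commute)
qed

text \<open>For X = sqrt (1 + |x|^2), Y = sqrt (1 + |y|^2), r = |x - y| the left side is a chordal
  power times the spherical area density. The inequality Y \<le> X + r eliminates Y. Each of the
  three terms on the right depends on x alone or on x - y alone, so its integral over x does not
  depend on y; at infinity 4 - s > 2 and at the pole s < 2 make it finite.\<close>

lemma chordal_powr_bound:
  fixes X Y r s :: real
  assumes "X \<ge> 1" "Y \<ge> 1" "r > 0" "Y \<le> X + r" and s: "0 \<le> s" "s < 2"
  shows "(r / (X * Y)) powr (-s) * X powr (-4) \<le>
    12 * (X powr (-(4 - s)) + sqrt (1 + r\<^sup>2) powr (-(4 - s)) + (if r \<le> 1 then r powr (-s) else 0))"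
proof -
  have pos: "X > 0" "Y > 0" using assms by linarith+
  define R where "R = sqrt (1 + r\<^sup>2)"
  have R: "R \<ge> 1" "R > 0" by (auto simp: R_def intro: add_pos_nonneg)
  \<comment> \<open>X Y / r is at most X^2 / r + X, hence at most 2 m. Taking the maximum lets the
    power s act on one of the summands at a time, and 2 powr s \<le> 4.\<close>
  define m where "m = max (X\<^sup>2 / r) X"
  have m: "m > 0" using pos by (simp add: m_def less_max_iff_disj)
  have "(r / (X * Y)) powr (-s) = (X * Y / r) powr s"
    using pos assms by (simp add: powr_minus powr_divide)
  also have "\<dots> \<le> (2 * m) powr s"
  proof (rule powr_mono2[OF s(1)])
    have "X * Y / r \<le> X * (X + r) / r" using pos assms by (intro divide_right_mono mult_left_mono) auto
    also have "\<dots> = X\<^sup>2 / r + X" using assms by (simp add: field_simps power2_eq_square)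
    also have "\<dots> \<le> 2 * m" by (auto simp: m_def)
    finally show "X * Y / r \<le> 2 * m" .
  qed (use pos assms in auto)
  also have "\<dots> = 2 powr s * m powr s" using m by (simp add: powr_mult)
  also have "\<dots> \<le> 4 * m powr s"
  proof (rule mult_right_mono)
    have "2 powr s \<le> 2 powr (2::real)" using s by (intro powr_mono) auto
    thus "2 powr s \<le> 4" by simp
  qed simp
  also have "m powr s \<le> (X\<^sup>2 / r) powr s + X powr s" by (auto simp: m_def max_def)
  finally have 1: "(r / (X * Y)) powr (-s) \<le> 4 * ((X\<^sup>2 / r) powr s + X powr s)" by simp
  have t2: "X powr s * X powr (-4) = X powr (-(4 - s))" using pos by (simp flip: powr_add)
  have t1: "(X\<^sup>2 / r) powr s * X powr (-4) = X powr (-(4 - 2 * s)) * r powr (-s)"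
  proof -
    have "(X\<^sup>2 / r) powr s = X powr (2 * s) * r powr (-s)"
      using pos assms by (simp add: powr_divide powr_powr powr_minus_divide flip: powr_numeral)
    thus ?thesis using pos by (simp add: mult_ac flip: powr_add)
  qed
  \<comment> \<open>For r \<le> 1 the power of X is at most 1. For r > 1 the quantity r is
    comparable to R, and the product of powers of X and R is at most the full power of the smaller
    of the two.\<close>
  have t3: "X powr (-(4 - 2 * s)) * r powr (-s) \<le> 2 * (X powr (-(4 - s)) + R powr (-(4 - s))) + (if r \<le> 1 then r powr (-s) else 0)"
  proof (cases "r \<le> 1")
    case True
    have "X powr (-(4 - 2 * s)) \<le> X powr 0" using assms by (intro powr_mono) auto
    hence "X powr (-(4 - 2 * s)) * r powr (-s) \<le> 1 * r powr (-s)" using pos by (intro mult_right_mono) auto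
    thus ?thesis using True by (simp add: add_nonneg_nonneg add_increasing)
  next
    case False
    have "R \<le> sqrt (2 * r\<^sup>2)" unfolding R_def using False one_le_power[of r 2] by (intro real_sqrt_le_mono) simp
    hence "R / sqrt 2 \<le> r" using assms(3) by (simp add: real_sqrt_mult field_simps)
    hence "r powr (-s) \<le> (R / sqrt 2) powr (-s)" using R s by (intro powr_mono2') auto
    also have "\<dots> = sqrt 2 powr s * R powr (-s)" using R by (simp add: powr_divide powr_minus field_simps)
    also have "\<dots> \<le> 2 * R powr (-s)"
    proof (rule mult_right_mono)
      have "sqrt 2 powr s \<le> sqrt 2 powr (2::real)" using s by (intro powr_mono) auto
      thus "sqrt 2 powr s \<le> 2" by simp
    qed simp
    finally have r: "r powr (-s) \<le> 2 * R powr (-s)" .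
    have "X powr (-(4 - 2 * s)) * R powr (-s) \<le> X powr (-(4 - s)) + R powr (-(4 - s))"
    proof (cases "X \<le> R")
      case True
      hence "R powr (-s) \<le> X powr (-s)" using pos s by (intro powr_mono2') auto
      hence "X powr (-(4 - 2 * s)) * R powr (-s) \<le> X powr (-(4 - 2 * s)) * X powr (-s)" by (intro mult_left_mono) auto
      also have "\<dots> = X powr (-(4 - s))" by (simp flip: powr_add)
      finally show ?thesis by (simp add: add_increasing2)
    next
      case False
      hence "X powr (-(4 - 2 * s)) \<le> R powr (-(4 - 2 * s))" using R s by (intro powr_mono2') auto
      hence "X powr (-(4 - 2 * s)) * R powr (-s) \<le> R powr (-(4 - 2 * s)) * R powr (-s)" by (intro mult_right_mono) auto
      also have "\<dots> = R powr (-(4 - s))" by (simp flip: powr_add)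
      finally show ?thesis by (simp add: add_increasing)
    qed
    moreover have "X powr (-(4 - 2 * s)) * r powr (-s) \<le> X powr (-(4 - 2 * s)) * (2 * R powr (-s))"
      using r by (intro mult_left_mono) auto
    ultimately show ?thesis using False by simp
  qed
  have "(r / (X * Y)) powr (-s) * X powr (-4) \<le> 4 * ((X\<^sup>2 / r) powr s + X powr s) * X powr (-4)"
    using 1 by (intro mult_right_mono) auto
  also have "\<dots> = 4 * (X powr (-(4 - 2 * s)) * r powr (-s) + X powr (-(4 - s)))"
    using t1 t2 by (simp add: algebra_simps)
  also have "\<dots> \<le> 4 * (2 * (X powr (-(4 - s)) + R powr (-(4 - s))) + (if r \<le> 1 then r powr (-s) else 0) + X powr (-(4 - s)))"
    using t3 by simp
  also have "\<dots> \<le> 12 * (X powr (-(4 - s)) + R powr (-(4 - s)) + (if r \<le> 1 then r powr (-s) else 0))"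
    by (simp add: algebra_simps)
  finally show ?thesis by (simp add: R_def)
qed

section \<open>Geometry of the chordal distance\<close>

definition chord :: "real^2 \<Rightarrow> real^2 \<Rightarrow> real" where
  "chord x y = norm (x - y) / (sqrt (1 + (norm x)\<^sup>2) * sqrt (1 + (norm y)\<^sup>2))"

text \<open>Unit vectors whose mutual distances are \<open>sqrt 2\<close> times the chordal distances, with nonnegative inner products.\<close>

definition sphere_emb :: "real^2 \<Rightarrow> real \<times> (real^2) \<times> real" where
  "sphere_emb x = (1 / (1 + (norm x)\<^sup>2)) *\<^sub>R (1, sqrt 2 *\<^sub>R x, (norm x)\<^sup>2)"

lemma bracket_pos: "0 < 1 + (norm x)\<^sup>2" by (simp add: add_pos_nonneg)

lemma chord_sq: "(chord x y)\<^sup>2 = (norm (x - y))\<^sup>2 / ((1 + (norm x)\<^sup>2) * (1 + (norm y)\<^sup>2))"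
  using bracket_pos[of x] bracket_pos[of y]
  by (simp add: chord_def power_divide power_mult_distrib)

lemma inner_sphere_emb_eq:
  "sphere_emb x \<bullet> sphere_emb y = (1 + 2 * (x \<bullet> y) + (norm x)\<^sup>2 * (norm y)\<^sup>2) / ((1 + (norm x)\<^sup>2) * (1 + (norm y)\<^sup>2))"
  by (simp add: sphere_emb_def add_divide_distrib field_simps)

text \<open>Identifies -2 ln of the chordal distance with the kernel -ln (1 - <.,.>), whose positive
  definiteness is known from the power series.\<close>

lemma inner_sphere_emb: "sphere_emb x \<bullet> sphere_emb y = 1 - (chord x y)\<^sup>2"
proof -
  have "(norm (x - y))\<^sup>2 = (norm x)\<^sup>2 + (norm y)\<^sup>2 - 2 * (x \<bullet> y)"
    by (simp add: power2_norm_eq_inner inner_diff_left inner_diff_right inner_commute)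
  hence "1 + 2 * (x \<bullet> y) + (norm x)\<^sup>2 * (norm y)\<^sup>2 = (1 + (norm x)\<^sup>2) * (1 + (norm y)\<^sup>2) - (norm (x - y))\<^sup>2"
    by (simp add: algebra_simps)
  moreover have "(1 + (norm x)\<^sup>2) * (1 + (norm y)\<^sup>2) \<noteq> 0"
    using bracket_pos[of x] bracket_pos[of y] by simp
  ultimately show ?thesis unfolding chord_sq inner_sphere_emb_eq by (simp add: diff_divide_distrib)
qed

lemma norm_sphere_emb: "norm (sphere_emb x) = 1"
  using inner_sphere_emb[of x x] by (simp add: norm_eq_sqrt_inner chord_def)

lemma dist_sphere_emb: "dist (sphere_emb x) (sphere_emb y) = sqrt 2 * chord x y"
proof -
  have "(dist (sphere_emb x) (sphere_emb y))\<^sup>2 = 2 - 2 * (sphere_emb x \<bullet> sphere_emb y)"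
    using norm_sphere_emb[of x] norm_sphere_emb[of y]
    by (simp add: dist_norm power2_norm_eq_inner inner_diff_left inner_diff_right inner_commute norm_eq_1)
  hence "(dist (sphere_emb x) (sphere_emb y))\<^sup>2 = (sqrt 2 * chord x y)\<^sup>2"
    by (simp add: inner_sphere_emb power_mult_distrib)
  moreover have "0 \<le> chord x y" by (simp add: chord_def)
  ultimately show ?thesis by (simp add: power2_eq_iff_nonneg)
qed

lemma chord_nonneg: "0 \<le> chord x y" by (simp add: chord_def)

lemma chord_eq_0_iff: "chord x y = 0 \<longleftrightarrow> x = y"
  using bracket_pos[of x] bracket_pos[of y] by (simp add: chord_def)

lemma chord_pos_iff: "0 < chord x y \<longleftrightarrow> x \<noteq> y"
  using chord_nonneg[of x y] chord_eq_0_iff[of x y] by linarith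

lemma chord_commute: "chord x y = chord y x"
  by (simp add: chord_def norm_minus_commute mult.commute)

lemma chord_triangle: "chord x z \<le> chord x y + chord y z"
  using dist_triangle[of "sphere_emb x" "sphere_emb z" "sphere_emb y"]
  by (simp add: dist_sphere_emb flip: distrib_left)

lemma inner_sphere_emb_nonneg: "0 \<le> sphere_emb x \<bullet> sphere_emb y"
proof -
  have "- (x \<bullet> y) \<le> norm x * norm y"
    using norm_cauchy_schwarz[of "-x" y] by simp
  \<comment> \<open>Completing the square in |x| |y| leaves only a multiple of the Cauchy-Schwarz
    defect.\<close>
  hence "0 \<le> (1 - norm x * norm y)\<^sup>2 + 2 * (x \<bullet> y + norm x * norm y)" by (intro add_nonneg_nonneg) auto
  also have "\<dots> = 1 + 2 * (x \<bullet> y) + (norm x)\<^sup>2 * (norm y)\<^sup>2"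
    by (simp add: power2_eq_square algebra_simps)
  finally show ?thesis using bracket_pos[of x] bracket_pos[of y] by (simp add: inner_sphere_emb_eq)
qed

text \<open>\<open>chord\<close> is normalized to half the distance on the unit sphere. Diameter 1
  is what makes -ln of the distance nonnegative.\<close>

lemma chord_le_1: "chord x y \<le> 1"
  using inner_sphere_emb_nonneg[of x y] chord_nonneg[of x y]
  by (simp add: inner_sphere_emb abs_square_le_1)

lemma continuous_chord: "continuous_on UNIV (\<lambda>(x, y). chord x y)"
proof -
  have "sqrt (1 + (norm z)\<^sup>2) \<noteq> 0" for z :: "real^2" using bracket_pos[of z] by simp
  thus ?thesis unfolding chord_def case_prod_unfold by (intro continuous_intros ballI) simp
qed

lemma chord_meas[measurable]: "case_prod chord \<in> borel_measurable (borel \<Otimes>\<^sub>M borel)"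
  using borel_measurable_continuous_onI[OF continuous_chord] by (simp add: borel_prod)

lemma nn_integral_lborel_shift:
  fixes f :: "'a::euclidean_space \<Rightarrow> ennreal"
  assumes [measurable]: "f \<in> borel_measurable borel"
  shows "(\<integral>\<^sup>+x. f (x - y) \<partial>lborel) = (\<integral>\<^sup>+x. f x \<partial>lborel)"
proof -
  have "(\<integral>\<^sup>+x. f x \<partial>lborel) = (\<integral>\<^sup>+x. f x \<partial>distr lborel borel ((+) (- y)))"
    by (simp only: lborel_distr_plus)
  also have "\<dots> = (\<integral>\<^sup>+x. f (x - y) \<partial>lborel)" by (subst nn_integral_distr) auto
  finally show ?thesis by simp
qed

text \<open>On the sphere this would be rotation invariance and compactness: (1 + |x|^2)^(-2) is the
  area density and s < 2 is integrability in dimension two. In the plane the uniformity in y comes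
  from \<open>chordal_powr_bound\<close> and translation invariance.\<close>

lemma nn_integral_chord_powr_bounded:
  assumes s: "0 \<le> s" "s < 2"
  shows "\<exists>A\<ge>0. \<forall>y. (\<integral>\<^sup>+x. ennreal (chord x y powr (-s) * (1 + (norm x)\<^sup>2) powr (-2)) \<partial>lborel) \<le> ennreal A"
proof -
  let ?c = "\<lambda>y x. chord x y powr (-s) * (1 + (norm x)\<^sup>2) powr (-2)"
  define p where "p = (4 - s) / 2"
  have p: "p > 1" using s by (simp add: p_def)
  have sq: "sqrt (1 + t\<^sup>2) powr (-(4 - s)) = (1 + t\<^sup>2) powr (-p)" for t :: real
  proof -
    have "sqrt (1 + t\<^sup>2) = (1 + t\<^sup>2) powr (1/2)" by (simp add: powr_half_sqrt)
    moreover have "1 / 2 * (- (4 - s)) = - p" unfolding p_def by argo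
    ultimately show ?thesis by (simp only: powr_powr)
  qed
  have sq4: "sqrt (1 + t\<^sup>2) powr (-4) = (1 + t\<^sup>2) powr (-2)" for t :: real
  proof -
    have "sqrt (1 + t\<^sup>2) = (1 + t\<^sup>2) powr (1/2)" by (simp add: powr_half_sqrt)
    thus ?thesis by (simp add: powr_powr)
  qed
  define A where "A = 12 * (pi / (p - 1) + pi / (p - 1) + pi / (1 - s / 2))"
  have A0: "pi / (p - 1) \<ge> 0" "pi / (1 - s / 2) \<ge> 0" using p s by simp_all
  define f where "f z = ennreal ((1 + (norm z)\<^sup>2) powr (-p))" for z :: "real^2"
  define g where "g z = ennreal (norm z powr (-s)) * indicator (cball 0 1) z" for z :: "real^2"
  have fm: "f \<in> borel_measurable borel" unfolding f_def by measurable
  have gm: "g \<in> borel_measurable borel"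
    unfolding g_def by (intro borel_measurable_times_ennreal borel_measurable_indicator) auto
  have fi: "(\<integral>\<^sup>+x. f x \<partial>lborel) = ennreal (pi / (p - 1))" unfolding f_def by (rule nn_integral_bracket_powr[OF p])
  have gi: "(\<integral>\<^sup>+x. g x \<partial>lborel) = ennreal (pi / (1 - s / 2))" unfolding g_def by (rule nn_integral_norm_powr_ball[OF s])
  have "(\<integral>\<^sup>+x. ennreal (?c y x) \<partial>lborel) \<le> ennreal A" for y
  proof -
    have fy: "(\<lambda>x. f (x - y)) \<in> borel_measurable lborel" "(\<lambda>x. g (x - y)) \<in> borel_measurable lborel"
      "f \<in> borel_measurable lborel"
      using measurable_compose[OF _ fm, of "\<lambda>x. x - y" lborel] measurable_compose[OF _ gm, of "\<lambda>x. x - y" lborel] fm by simp_all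
    have "(\<integral>\<^sup>+x. ennreal (?c y x) \<partial>lborel) \<le>
      (\<integral>\<^sup>+x. ennreal 12 * (f x + f (x - y) + g (x - y)) \<partial>lborel)"
    proof (rule nn_integral_mono)
      fix x :: "real^2"
      have "?c y x \<le>
         12 * ((1 + (norm x)\<^sup>2) powr (-p) + (1 + (norm (x - y))\<^sup>2) powr (-p) + (if norm (x - y) \<le> 1 then norm (x - y) powr (-s) else 0))"
      \<comment> \<open>On the diagonal the left side is 0, because 0 raised by \<open>powr\<close>
        to any exponent is 0.\<close>
      proof (cases "x = y")
        case False
        show ?thesis unfolding chord_def sq[symmetric] sq4[symmetric]
          by (rule chordal_powr_bound[OF _ _ _ bracket_triangle s]) (use False in auto)
      qed (simp add: chord_def)
      hence "ennreal (?c y x) \<le>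
         ennreal (12 * ((1 + (norm x)\<^sup>2) powr (-p) + (1 + (norm (x - y))\<^sup>2) powr (-p) + (if norm (x - y) \<le> 1 then norm (x - y) powr (-s) else 0)))"
        by (rule ennreal_leI)
      also have "\<dots> = ennreal 12 * (f x + f (x - y) + g (x - y))"
        unfolding f_def g_def by (subst ennreal_mult) (auto simp: indicator_def)
      finally show "ennreal (?c y x) \<le> ennreal 12 * (f x + f (x - y) + g (x - y))" .
    qed
    also have "\<dots> = ennreal 12 * ((\<integral>\<^sup>+x. f x \<partial>lborel) + (\<integral>\<^sup>+x. f (x - y) \<partial>lborel) + (\<integral>\<^sup>+x. g (x - y) \<partial>lborel))"
      using fy by (simp only: nn_integral_cmult nn_integral_add borel_measurable_add)
    also have "\<dots> = ennreal 12 * (ennreal (pi / (p - 1)) + ennreal (pi / (p - 1)) + ennreal (pi / (1 - s / 2)))"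
      by (simp only: nn_integral_lborel_shift[OF fm] nn_integral_lborel_shift[OF gm] fi gi)
    also have "\<dots> = ennreal A"
      unfolding A_def using A0 by (simp only: ennreal_plus ennreal_mult add_nonneg_nonneg zero_le_numeral)
    finally show ?thesis .
  qed
  moreover have "A \<ge> 0" using A0 by (simp add: A_def)
  ultimately show ?thesis by blast
qed

text \<open>A point can be close to only one pole. If l0 is the nearest pole, the triangle
  inequality keeps all others at distance at least \<delta>, half the minimal separation, so that
  only the factor of l0 is not bounded by a constant.\<close>

lemma prod_chord_powr_le_sum:
  fixes P :: "nat \<Rightarrow> real^2" and \<beta> :: "nat \<Rightarrow> real"
  assumes I: "finite I" "I \<noteq> {}" "inj_on P I" and \<beta>: "\<And>l. l \<in> I \<Longrightarrow> 0 \<le> \<beta> l"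
  shows "\<exists>D\<ge>0. \<forall>x. x \<notin> P ` I \<longrightarrow> (\<Prod>l\<in>I. chord x (P l) powr (- (2 * \<beta> l))) \<le> D * (\<Sum>l\<in>I. chord x (P l) powr (- (2 * \<beta> l)))"
proof -
  \<comment> \<open>Inserting 1 makes the set nonempty when there is a single pole, and forces
    \<delta> \<le> 1, so that every factor of D is at least 1 and the missing factor l0 may be
    added.\<close>
  define T where "T = insert 1 ((\<lambda>(l,k). chord (P l) (P k) / 2) ` {p \<in> I \<times> I. fst p \<noteq> snd p})"
  define \<delta> where "\<delta> = Min T"
  have T: "finite T" "T \<noteq> {}" using I(1) by (auto simp: T_def)
  have Tpos: "t > 0" if t: "t \<in> T" for t
  proof -
    have "chord (P l) (P k) > 0" if "l \<in> I" "k \<in> I" "l \<noteq> k" for l k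
      using inj_onD[OF I(3)] that by (auto simp: chord_pos_iff)
    thus ?thesis using t by (auto simp: T_def)
  qed
  have d0: "\<delta> > 0" using Tpos Min_in[OF T] by (simp add: \<delta>_def)
  have d1: "\<delta> \<le> 1" unfolding \<delta>_def by (rule Min_le[OF T(1)]) (simp add: T_def)
  have d2: "2 * \<delta> \<le> chord (P l) (P k)" if "l \<in> I" "k \<in> I" "l \<noteq> k" for l k
  proof -
    have "chord (P l) (P k) / 2 \<in> T" using that by (force simp: T_def)
    from Min_le[OF T(1) this] show ?thesis by (simp add: \<delta>_def)
  qed
  define D where "D = (\<Prod>l\<in>I. \<delta> powr (- (2 * \<beta> l)))"
  have D1: "1 \<le> \<delta> powr (- (2 * \<beta> l))" if "l \<in> I" for l
    using powr_mono2'[of "- (2 * \<beta> l)" \<delta> 1] d0 d1 \<beta>[OF that] by simp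
  show ?thesis
  proof (intro exI[of _ D] conjI allI impI)
    show "D \<ge> 0" unfolding D_def by (intro prod_nonneg) simp
    fix x assume x: "x \<notin> P ` I"
    have cpos: "chord x (P l) > 0" if "l \<in> I" for l
      using x that by (auto simp: chord_pos_iff)
    obtain l0 where l0: "l0 \<in> I" "\<And>l. l \<in> I \<Longrightarrow> chord x (P l0) \<le> chord x (P l)"
    proof -
      have "Min ((\<lambda>l. chord x (P l)) ` I) \<in> (\<lambda>l. chord x (P l)) ` I" using I by (intro Min_in) auto
      then obtain l where "l \<in> I" "chord x (P l) = Min ((\<lambda>l. chord x (P l)) ` I)" by auto
      moreover have "Min ((\<lambda>l. chord x (P l)) ` I) \<le> chord x (P k)" if "k \<in> I" for k using I(1) that by simp
      ultimately show thesis using that by metis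
    qed
    have "(\<Prod>l\<in>I. chord x (P l) powr (- (2 * \<beta> l))) =
        chord x (P l0) powr (- (2 * \<beta> l0)) * (\<Prod>l\<in>I-{l0}. chord x (P l) powr (- (2 * \<beta> l)))"
      using I(1) l0(1) by (rule prod.remove)
    also have "\<dots> \<le> chord x (P l0) powr (- (2 * \<beta> l0)) * (\<Prod>l\<in>I-{l0}. \<delta> powr (- (2 * \<beta> l)))"
    proof (intro mult_left_mono prod_mono conjI)
      fix l assume l: "l \<in> I - {l0}"
      have "2 * \<delta> \<le> chord (P l) x + chord x (P l0)"
        using d2[of l l0] l l0(1) chord_triangle[of "P l" "P l0" x] by auto
      hence "\<delta> \<le> chord x (P l)" using l0(2)[of l] l chord_commute[of "P l" x] by auto
      thus "chord x (P l) powr (- (2 * \<beta> l)) \<le> \<delta> powr (- (2 * \<beta> l))"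
        using d0 \<beta>[of l] l by (intro powr_mono2') auto
    qed auto
    also have "\<dots> \<le> chord x (P l0) powr (- (2 * \<beta> l0)) * D"
    proof (rule mult_left_mono)
      have "1 * (\<Prod>l\<in>I-{l0}. \<delta> powr (- (2 * \<beta> l))) \<le> \<delta> powr (- (2 * \<beta> l0)) * (\<Prod>l\<in>I-{l0}. \<delta> powr (- (2 * \<beta> l)))"
        by (intro mult_right_mono D1 l0(1) prod_nonneg) simp
      also have "\<dots> = D" unfolding D_def using I(1) l0(1) by (rule prod.remove[symmetric])
      finally show "(\<Prod>l\<in>I-{l0}. \<delta> powr (- (2 * \<beta> l))) \<le> D" by simp
    qed simp
    also have "\<dots> \<le> (\<Sum>l\<in>I. chord x (P l) powr (- (2 * \<beta> l))) * D"
      using \<open>D \<ge> 0\<close> I(1) l0(1) by (intro mult_right_mono member_le_sum) auto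
    finally show "(\<Prod>l\<in>I. chord x (P l) powr (- (2 * \<beta> l))) \<le> D * (\<Sum>l\<in>I. chord x (P l) powr (- (2 * \<beta> l)))"
      by (simp add: mult.commute)
  qed
qed

section \<open>The singular weights seen from the sphere\<close>

definition sphere_weight where
  "sphere_weight m \<beta> P i x = singular_weight m \<beta> P i x * (1 + (norm x)\<^sup>2) powr (- (2 - (\<Sum>l=1..m. \<beta> i l)))"

text \<open>Replacing |x - P l| by the chordal distance releases (1 + |x|^2)^(-\<beta> i l) for
  every l. Together with the factor in the definition the exponents add up to -2, that of the area
  density: infinity carries no singularity.\<close>

lemma sphere_weight_eq:
  assumes x: "x \<notin> P ` {1..m}"
  shows "sphere_weight m \<beta> P i x =
    (\<Prod>l=1..m. (1 + (norm (P l))\<^sup>2) powr (- \<beta> i l)) * (\<Prod>l=1..m. chord x (P l) powr (- (2 * \<beta> i l))) * (1 + (norm x)\<^sup>2) powr (-2)"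
proof -
  define a where "a y = 1 + (norm y)\<^sup>2" for y :: "real^2"
  have a: "a y > 0" for y unfolding a_def by (rule bracket_pos)
  have "1 / norm (x - P l) powr (2 * \<beta> i l) = a (P l) powr (- \<beta> i l) * chord x (P l) powr (- (2 * \<beta> i l)) * a x powr (- \<beta> i l)"
    if l: "l \<in> {1..m}" for l
  proof -
    have n: "norm (x - P l) > 0" using x l by auto
    have "chord x (P l) powr (- (2 * \<beta> i l)) = norm (x - P l) powr (- (2 * \<beta> i l)) * (sqrt (a x) powr (2 * \<beta> i l) * sqrt (a (P l)) powr (2 * \<beta> i l))"
      unfolding chord_def a_def[symmetric] using a[of x] a[of "P l"] n
      by (simp add: powr_divide powr_mult powr_minus field_simps)
    moreover have "sqrt (a y) powr (2 * \<beta> i l) = a y powr \<beta> i l" for y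
      using a[of y] by (simp add: powr_powr flip: powr_half_sqrt)
    ultimately have c: "chord x (P l) powr (- (2 * \<beta> i l)) = norm (x - P l) powr (- (2 * \<beta> i l)) * (a x powr \<beta> i l * a (P l) powr \<beta> i l)"
      by simp
    have "a (P l) powr (- \<beta> i l) * a (P l) powr \<beta> i l = 1" "a x powr \<beta> i l * a x powr (- \<beta> i l) = 1"
      using a[of x] a[of "P l"] by (simp_all flip: powr_add)
    hence "a (P l) powr (- \<beta> i l) * chord x (P l) powr (- (2 * \<beta> i l)) * a x powr (- \<beta> i l) = norm (x - P l) powr (- (2 * \<beta> i l))"
      unfolding c by algebra
    thus ?thesis by (simp add: powr_minus_divide)
  qed
  hence "singular_weight m \<beta> P i x = (\<Prod>l=1..m. a (P l) powr (- \<beta> i l) * chord x (P l) powr (- (2 * \<beta> i l)) * a x powr (- \<beta> i l))"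
    unfolding singular_weight_def by (intro prod.cong) auto
  also have "\<dots> = (\<Prod>l=1..m. a (P l) powr (- \<beta> i l)) * (\<Prod>l=1..m. chord x (P l) powr (- (2 * \<beta> i l))) * a x powr (- (\<Sum>l=1..m. \<beta> i l))"
  proof -
    have "(\<Prod>l=1..m. a x powr (- \<beta> i l)) = a x powr (\<Sum>l=1..m. - \<beta> i l)"
      using a[of x] by (intro powr_sum[symmetric]) auto
    thus ?thesis by (simp only: prod.distrib sum_negf)
  qed
  finally show ?thesis
    unfolding sphere_weight_def a_def[symmetric] by (simp only: mult.assoc powr_add[symmetric]) simp
qed

lemma sphere_weight_nonneg: "0 \<le> sphere_weight m \<beta> P i x"
  unfolding sphere_weight_def singular_weight_def by (intro mult_nonneg_nonneg prod_nonneg) auto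

lemma sphere_weight_pos: assumes "x \<notin> P ` {1..m}" shows "0 < sphere_weight m \<beta> P i x"
proof -
  have "chord x (P l) > 0" if "l \<in> {1..m}" for l
    using assms that by (auto simp: chord_pos_iff)
  moreover have "1 + (norm y)\<^sup>2 \<noteq> 0" for y :: "real^2" using bracket_pos[of y] by simp
  ultimately show ?thesis unfolding sphere_weight_eq[OF assms]
    by (intro mult_pos_pos prod_pos) (simp_all add: less_imp_neq[symmetric])
qed

lemma sphere_weight_singular: assumes "x \<in> P ` {1..m}" shows "sphere_weight m \<beta> P i x = 0"
  using assms unfolding sphere_weight_def singular_weight_def by (auto intro!: prod_zero)

lemma sphere_weight_meas[measurable]: "sphere_weight m \<beta> P i \<in> borel_measurable borel"
  unfolding sphere_weight_def singular_weight_def by measurable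

text \<open>The product is at most the full power of the smaller base. This splits two singularities
  with different centres.\<close>

lemma powr_mult_le_add:
  fixes u v a b :: real assumes "u > 0" "v > 0" "a \<ge> 0" "b \<ge> 0"
  shows "u powr (-a) * v powr (-b) \<le> u powr (-(a + b)) + v powr (-(a + b))"
proof (cases "u \<le> v")
  case True
  hence "v powr (-b) \<le> u powr (-b)" using assms by (intro powr_mono2') auto
  hence "u powr (-a) * v powr (-b) \<le> u powr (-a) * u powr (-b)" by (intro mult_left_mono) auto
  also have "\<dots> = u powr (-(a + b))" by (simp flip: powr_add)
  finally show ?thesis by (simp add: add_increasing2)
next
  case False
  hence "u powr (-a) \<le> v powr (-a)" using assms by (intro powr_mono2') auto
  hence "u powr (-a) * v powr (-b) \<le> v powr (-a) * v powr (-b)" by (intro mult_right_mono) auto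
  also have "\<dots> = v powr (-(a + b))" by (simp flip: powr_add)
  finally show ?thesis by (simp add: add_increasing)
qed

text \<open>The product over the poles is first reduced to a sum, then each chord(x,y)^(-a)
  chord(x,P l)^(-2 \<beta> i l) is split into single powers of exponent a + 2 \<beta> i l < 2
  centred at y and at P l. The worst case is y = P l, where the exponents really add.\<close>

lemma sphere_weight_integral_bound:
  assumes "m \<ge> 1" "inj_on P {1..m}" "a \<ge> 0"
    and \<beta>: "\<And>l. l \<in> {1..m} \<Longrightarrow> 0 \<le> \<beta> i l" "\<And>l. l \<in> {1..m} \<Longrightarrow> a + 2 * \<beta> i l < 2"
  shows "\<exists>C\<ge>0. \<forall>y. (\<integral>\<^sup>+x. ennreal (chord x y powr (-a) * sphere_weight m \<beta> P i x) \<partial>lborel) \<le> ennreal C"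
proof -
  define Q where "Q = (\<Prod>l=1..m. (1 + (norm (P l))\<^sup>2) powr (- \<beta> i l))"
  have Q: "Q \<ge> 0" unfolding Q_def by (intro prod_nonneg) simp
  obtain D where D: "D \<ge> 0" "\<And>x. x \<notin> P ` {1..m} \<Longrightarrow> (\<Prod>l=1..m. chord x (P l) powr (- (2 * \<beta> i l))) \<le> D * (\<Sum>l=1..m. chord x (P l) powr (- (2 * \<beta> i l)))"
    using prod_chord_powr_le_sum[of "{1..m}" P "\<beta> i"] assms by auto
  define J where "J l y = (\<integral>\<^sup>+x. ennreal (chord x y powr (-(a + 2 * \<beta> i l)) * (1 + (norm x)\<^sup>2) powr (-2)) \<partial>lborel)" for l y
  have "\<forall>l\<in>{1..m}. \<exists>A. A \<ge> 0 \<and> (\<forall>y. J l y \<le> ennreal A)"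
    using nn_integral_chord_powr_bounded[of "a + 2 * \<beta> i l" for l] \<beta> assms(3) unfolding J_def by simp
  then obtain A where "\<forall>l\<in>{1..m}. A l \<ge> 0 \<and> (\<forall>y. J l y \<le> ennreal (A l))"
    by (rule bchoice[THEN exE])
  hence A: "\<And>l. l \<in> {1..m} \<Longrightarrow> A l \<ge> 0" "\<And>l y. l \<in> {1..m} \<Longrightarrow> J l y \<le> ennreal (A l)" by blast+
  define t where "t l y x = chord x y powr (-(a + 2 * \<beta> i l)) * (1 + (norm x)\<^sup>2) powr (-2)" for l y and x :: "real^2"
  have t0: "t l y x \<ge> 0" for l y x by (simp add: t_def)
  have tm: "(\<lambda>x. ennreal (t l y x)) \<in> borel_measurable lborel" for l y
    unfolding t_def chord_def by measurable
  have "(\<integral>\<^sup>+x. ennreal (chord x y powr (-a) * sphere_weight m \<beta> P i x) \<partial>lborel) \<le> ennreal (Q * D * (\<Sum>l=1..m. A l + A l))" for y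
  proof -
    have "(\<integral>\<^sup>+x. ennreal (chord x y powr (-a) * sphere_weight m \<beta> P i x) \<partial>lborel) \<le>
       (\<integral>\<^sup>+x. ennreal (Q * D) * (\<Sum>l=1..m. ennreal (t l y x) + ennreal (t l (P l) x)) \<partial>lborel)"
    proof (rule nn_integral_mono)
      fix x
      have le: "chord x y powr (-a) * sphere_weight m \<beta> P i x \<le> Q * D * (\<Sum>l=1..m. t l y x + t l (P l) x)"
      proof (cases "x \<in> P ` {1..m} \<or> x = y")
        case True
        hence "chord x y powr (-a) * sphere_weight m \<beta> P i x = 0"
          using sphere_weight_singular[of x P m \<beta> i] chord_eq_0_iff[of x y] by auto
        moreover have "0 \<le> Q * D * (\<Sum>l=1..m. t l y x + t l (P l) x)"
          using Q D(1) t0 by (intro mult_nonneg_nonneg sum_nonneg add_nonneg_nonneg) auto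
        ultimately show ?thesis by (simp only:)
      next
        case False
        have cy: "chord x y > 0" using False by (simp add: chord_pos_iff)
        have "chord x y powr (-a) * sphere_weight m \<beta> P i x =
           Q * (chord x y powr (-a) * (1 + (norm x)\<^sup>2) powr (-2)) * (\<Prod>l=1..m. chord x (P l) powr (- (2 * \<beta> i l)))"
          using sphere_weight_eq[of x P m \<beta> i] False by (simp add: Q_def)
        also have "\<dots> \<le> Q * (chord x y powr (-a) * (1 + (norm x)\<^sup>2) powr (-2)) * (D * (\<Sum>l=1..m. chord x (P l) powr (- (2 * \<beta> i l))))"
          using D(2)[of x] False Q by (intro mult_left_mono mult_nonneg_nonneg) auto
        also have "\<dots> = Q * D * (\<Sum>l=1..m. chord x y powr (-a) * chord x (P l) powr (- (2 * \<beta> i l)) * (1 + (norm x)\<^sup>2) powr (-2))"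
          by (simp add: sum_distrib_left mult_ac)
        also have "\<dots> \<le> Q * D * (\<Sum>l=1..m. t l y x + t l (P l) x)"
        proof (intro mult_left_mono sum_mono)
          fix l assume l: "l \<in> {1..m}"
          have cl: "chord x (P l) > 0" using False l by (auto simp: chord_pos_iff)
          have "chord x y powr (-a) * chord x (P l) powr (- (2 * \<beta> i l)) \<le> chord x y powr (-(a + 2 * \<beta> i l)) + chord x (P l) powr (-(a + 2 * \<beta> i l))"
            using powr_mult_le_add[OF cy cl assms(3)] \<beta>(1)[OF l] by simp
          from mult_right_mono[OF this, of "(1 + (norm x)\<^sup>2) powr (-2)"]
          show "chord x y powr (-a) * chord x (P l) powr (- (2 * \<beta> i l)) * (1 + (norm x)\<^sup>2) powr (-2) \<le> t l y x + t l (P l) x"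
            by (simp add: t_def distrib_right)
        qed (use Q D(1) in auto)
        finally show ?thesis .
      qed
      show "ennreal (chord x y powr (-a) * sphere_weight m \<beta> P i x) \<le> ennreal (Q * D) * (\<Sum>l=1..m. ennreal (t l y x) + ennreal (t l (P l) x))"
      proof -
        have "ennreal (Q * D * (\<Sum>l=1..m. t l y x + t l (P l) x)) = ennreal (Q * D) * ennreal (\<Sum>l=1..m. t l y x + t l (P l) x)"
          using Q D(1) t0 by (intro ennreal_mult mult_nonneg_nonneg sum_nonneg add_nonneg_nonneg) auto
        also have "ennreal (\<Sum>l=1..m. t l y x + t l (P l) x) = (\<Sum>l=1..m. ennreal (t l y x + t l (P l) x))"
          using t0 by (intro sum_ennreal[symmetric] add_nonneg_nonneg)
        also have "\<dots> = (\<Sum>l=1..m. ennreal (t l y x) + ennreal (t l (P l) x))"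
          using t0 by (intro sum.cong refl ennreal_plus)
        finally show ?thesis using ennreal_leI[OF le] by simp
      qed
    qed
    also have "\<dots> = ennreal (Q * D) * (\<Sum>l=1..m. (\<integral>\<^sup>+x. ennreal (t l y x) \<partial>lborel) + (\<integral>\<^sup>+x. ennreal (t l (P l) x) \<partial>lborel))"
      by (simp only: nn_integral_cmult nn_integral_sum nn_integral_add tm borel_measurable_add borel_measurable_sum)
    also have "\<dots> \<le> ennreal (Q * D) * (\<Sum>l=1..m. ennreal (A l) + ennreal (A l))"
      using A(2) unfolding t_def J_def by (intro mult_left_mono sum_mono add_mono) auto
    also have "(\<Sum>l=1..m. ennreal (A l) + ennreal (A l)) = (\<Sum>l=1..m. ennreal (A l + A l))"
      using A(1) by (intro sum.cong refl ennreal_plus[symmetric])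
    also have "\<dots> = ennreal (\<Sum>l=1..m. A l + A l)"
      using A(1) by (intro sum_ennreal) simp
    also have "ennreal (Q * D) * ennreal (\<Sum>l=1..m. A l + A l) = ennreal (Q * D * (\<Sum>l=1..m. A l + A l))"
      using Q D(1) by (intro ennreal_mult[symmetric] mult_nonneg_nonneg sum_nonneg) (use A(1) in auto)
    finally show ?thesis .
  qed
  moreover have "0 \<le> Q * D * (\<Sum>l=1..m. A l + A l)"
    using Q D(1) A(1) by (intro mult_nonneg_nonneg sum_nonneg) auto
  ultimately show ?thesis by blast
qed

section \<open>The distributional Laplacian of the logarithm\<close>

lemma integral_lborel_shift:
  fixes f :: "'a::euclidean_space \<Rightarrow> real"
  assumes "f \<in> borel_measurable borel"
  shows "(\<integral>x. f (x + c) \<partial>lborel) = (\<integral>x. f x \<partial>lborel)"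
proof -
  have "(\<integral>x. f x \<partial>lborel) = (\<integral>x. f x \<partial>distr lborel borel ((+) c))"
    by (simp only: lborel_distr_plus)
  also have "\<dots> = (\<integral>x. f (x + c) \<partial>lborel)" using assms by (subst integral_distr) (simp_all add: add.commute)
  finally show ?thesis by simp
qed

lemma integrable_lborel_shift:
  fixes f :: "'a::euclidean_space \<Rightarrow> real"
  assumes "integrable lborel f"
  shows "integrable lborel (\<lambda>x. f (x + c))"
proof -
  have "integrable (distr lborel borel ((+) c)) f" using assms by (simp only: lborel_distr_plus)
  hence "integrable lborel (\<lambda>x. f (c + x))" using assms by (subst (asm) integrable_distr_eq) auto
  thus ?thesis by (simp add: add.commute)
qed

lemma integrable_indicator_cball:
  "integrable lborel (indicator (cball (x::'a::euclidean_space) R) :: 'a \<Rightarrow> real)"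
  by (intro integrable_real_indicator) (use emeasure_bounded_finite[OF bounded_cball, of x R] in auto)

lemma integrable_continuous_compact_support:
  fixes f :: "'a::euclidean_space \<Rightarrow> real"
  assumes "continuous_on UNIV f" "\<And>x. norm x > R \<Longrightarrow> f x = 0"
  shows "integrable lborel f"
proof -
  have "integrable lborel (\<lambda>x. indicator (cball 0 R) x *\<^sub>R f x)"
    by (rule borel_integrable_compact) (use assms(1) continuous_on_subset in auto)
  moreover have "(\<lambda>x. indicator (cball 0 R) x *\<^sub>R f x) = f"
    using assms(2) by (auto simp: indicator_def fun_eq_iff)
  ultimately show ?thesis by simp
qed

text \<open>The difference quotients have integral zero by translation invariance.\<close>

lemma integral_directional_derivative_eq_0:
  fixes f :: "'a::euclidean_space \<Rightarrow> real"
  assumes D: "\<And>x. (f has_derivative D x) (at x)" and cont: "continuous_on UNIV (\<lambda>x. D x b)"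
    and supp: "\<And>x. norm x > R \<Longrightarrow> f x = 0"
  shows "(\<integral>x. D x b \<partial>lborel) = 0"
proof -
  have cf: "continuous_on UNIV f"
    using D by (auto simp: continuous_on_eq_continuous_at intro: has_derivative_continuous)
  have fi: "integrable lborel f" by (rule integrable_continuous_compact_support[OF cf supp])
  have fm: "f \<in> borel_measurable borel" using cf by (rule borel_measurable_continuous_onI)
  define q where "q n x = (f (x + (1 / real (Suc n)) *\<^sub>R b) - f x) * real (Suc n)" for n x
  have qi: "(\<integral>x. q n x \<partial>lborel) = 0" for n
    unfolding q_def using fi integrable_lborel_shift[OF fi] integral_lborel_shift[OF fm] by simp
  have line: "((\<lambda>t. f (x + t *\<^sub>R b)) has_real_derivative D (x + t *\<^sub>R b) b) (at t)" for x t
  proof -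
    have "((\<lambda>t. f (x + t *\<^sub>R b)) has_derivative (\<lambda>h. D (x + t *\<^sub>R b) (h *\<^sub>R b))) (at t)"
      by (rule has_derivative_compose[OF _ D]) (auto intro!: derivative_eq_intros)
    moreover have "D (x + t *\<^sub>R b) (h *\<^sub>R b) = D (x + t *\<^sub>R b) b * h" for h
      using linear_cmul[OF has_derivative_linear[OF D]] by simp
    ultimately show ?thesis by (simp add: has_field_derivative_def)
  qed
  \<comment> \<open>The difference quotients q are supported in the ball of radius R + |b|; the
    intermediate points of the mean value theorem move by at most another |b|.\<close>
  define S where "S = cball (0::'a) (R + 2 * norm b)"
  have "bounded ((\<lambda>x. D x b) ` S)"
    unfolding S_def by (intro compact_imp_bounded compact_continuous_image continuous_on_subset[OF cont]) auto
  then obtain M where M: "\<And>x. x \<in> S \<Longrightarrow> \<bar>D x b\<bar> \<le> M" unfolding bounded_iff by auto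
  have qb: "\<bar>q n x\<bar> \<le> indicator (cball 0 (R + norm b)) x * M" for n x
  proof (cases "norm x \<le> R + norm b")
    case True
    have pos: "(0::real) < 1 / real (Suc n)" by simp
    obtain t where t: "0 < t" "t < 1 / real (Suc n)"
      "f (x + (1 / real (Suc n)) *\<^sub>R b) - f (x + 0 *\<^sub>R b) = (1 / real (Suc n) - 0) * D (x + t *\<^sub>R b) b"
      using MVT2[OF pos, of "\<lambda>t. f (x + t *\<^sub>R b)" "\<lambda>t. D (x + t *\<^sub>R b) b"] line by blast
    have q: "q n x = D (x + t *\<^sub>R b) b" using t(3) by (simp add: q_def)
    have "t \<le> 1" using t(2) by (rule less_imp_le[THEN order_trans]) simp
    hence "norm (x + t *\<^sub>R b) \<le> norm x + norm b"
      using norm_triangle_ineq[of x "t *\<^sub>R b"] t(1) mult_right_mono[of t 1 "norm b"] by simp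
    hence "x + t *\<^sub>R b \<in> S" using True by (simp add: S_def)
    thus ?thesis using M True by (simp add: q indicator_def)
  next
    case False
    have "norm x - norm ((1 / real (Suc n)) *\<^sub>R b) \<le> norm (x + (1 / real (Suc n)) *\<^sub>R b)" by (rule norm_diff_ineq)
    moreover have "norm ((1 / real (Suc n)) *\<^sub>R b) \<le> norm b"
      using mult_right_mono[of "1 / real (Suc n)" 1 "norm b"] by simp
    ultimately have "norm (x + (1 / real (Suc n)) *\<^sub>R b) > R" using False by linarith
    moreover have "norm x > R" using False norm_ge_zero[of b] by linarith
    ultimately show ?thesis using supp False by (simp add: q_def)
  qed
  have "(\<lambda>n. \<integral>x. q n x \<partial>lborel) \<longlonglongrightarrow> (\<integral>x. D x b \<partial>lborel)"
  proof (rule integral_dominated_convergence[where w="\<lambda>x. indicator (cball 0 (R + norm b)) x * M"])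
    show "(\<lambda>x. D x b) \<in> borel_measurable lborel" using borel_measurable_continuous_onI[OF cont] by simp
    show "q n \<in> borel_measurable lborel" for n
      unfolding q_def using fm by (intro borel_measurable_times borel_measurable_diff borel_measurable_const measurable_compose[OF _ fm]) auto
    show "integrable lborel (\<lambda>x. indicator (cball 0 (R + norm b)) x * M)"
      by (intro integrable_mult_left integrable_indicator_cball)
    show "AE x in lborel. (\<lambda>n. q n x) \<longlonglongrightarrow> D x b"
    proof (rule AE_I2)
      fix x
      have "((\<lambda>h. (f (x + (0 + h) *\<^sub>R b) - f (x + 0 *\<^sub>R b)) / h) \<longlongrightarrow> D x b) (at 0)"
        using line[of x 0] unfolding DERIV_def by simp
      moreover have "filterlim (\<lambda>n. 1 / real (Suc n)) (at 0) sequentially"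
        using LIMSEQ_Suc[OF lim_1_over_n] by (auto simp: filterlim_at)
      ultimately have "(\<lambda>n. (f (x + (0 + 1 / real (Suc n)) *\<^sub>R b) - f (x + 0 *\<^sub>R b)) / (1 / real (Suc n))) \<longlonglongrightarrow> D x b"
        by (rule filterlim_compose)
      thus "(\<lambda>n. q n x) \<longlonglongrightarrow> D x b" by (simp add: q_def)
    qed
    show "AE x in lborel. norm (q n x) \<le> indicator (cball 0 (R + norm b)) x * M" for n using qb by simp
  qed
  thus ?thesis unfolding qi using LIMSEQ_unique tendsto_const by metis
qed

definition supp_in :: "real \<Rightarrow> ('a::real_normed_vector \<Rightarrow> real) \<Rightarrow> bool" where
  "supp_in R f \<longleftrightarrow> (\<forall>x. norm x > R \<longrightarrow> f x = 0)"

lemma supp_in_partial_deriv: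
  fixes f :: "'a::euclidean_space \<Rightarrow> real"
  assumes "supp_in R f" shows "supp_in R (partial_deriv b f)"
  unfolding supp_in_def
proof (intro allI impI)
  fix x :: 'a assume x: "norm x > R"
  have "((\<lambda>_. 0) has_derivative (\<lambda>_. 0)) (at x)" by simp
  moreover have "open {y::'a. norm y > R}" by (intro open_Collect_less continuous_intros)
  ultimately have "(f has_derivative (\<lambda>_. 0)) (at x)"
    by (rule has_derivative_transform_within_open) (use x assms in \<open>auto simp: supp_in_def\<close>)
  thus "partial_deriv b f x = 0"
    unfolding partial_deriv_def using frechet_derivative_at by metis
qed

lemma test_functionD:
  fixes \<phi> :: "'a::euclidean_space \<Rightarrow> real"
  assumes "test_function \<phi>"
  shows "\<And>x. (\<phi> has_derivative frechet_derivative \<phi> (at x)) (at x)"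
    "\<And>b x. b \<in> Basis \<Longrightarrow> (partial_deriv b \<phi> has_derivative frechet_derivative (partial_deriv b \<phi>) (at x)) (at x)"
    "continuous_on UNIV \<phi>"
    "\<And>b. b \<in> Basis \<Longrightarrow> continuous_on UNIV (partial_deriv b \<phi>)"
    "\<And>b. b \<in> Basis \<Longrightarrow> continuous_on UNIV (partial_deriv b (partial_deriv b \<phi>))"
    "continuous_on UNIV (laplacian \<phi>)"
    "\<exists>R. supp_in R \<phi> \<and> supp_in R (laplacian \<phi>)"
proof -
  have Ck: "C_k k \<phi>" for k using assms by (simp add: test_function_def)
  show "(\<phi> has_derivative frechet_derivative \<phi> (at x)) (at x)" for x
    using Ck[of 1] by (simp add: frechet_derivative_works)
  show "(partial_deriv b \<phi> has_derivative frechet_derivative (partial_deriv b \<phi>) (at x)) (at x)" if "b \<in> Basis" for b x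
    using Ck[of "Suc (Suc 0)"] that by (simp add: frechet_derivative_works)
  show "continuous_on UNIV \<phi>" using Ck[of 0] by simp
  show "continuous_on UNIV (partial_deriv b \<phi>)" if "b \<in> Basis" for b using Ck[of "Suc 0"] that by simp
  show c2: "continuous_on UNIV (partial_deriv b (partial_deriv b \<phi>))" if "b \<in> Basis" for b
    using Ck[of "Suc (Suc 0)"] that by simp
  show "continuous_on UNIV (laplacian \<phi>)"
    unfolding laplacian_def[abs_def] by (intro continuous_on_sum c2)
  have "bounded (closure {x. \<phi> x \<noteq> 0})" using assms by (simp add: test_function_def compact_imp_bounded)
  then obtain R where R: "\<And>x. x \<in> closure {x. \<phi> x \<noteq> 0} \<Longrightarrow> norm x \<le> R" unfolding bounded_iff by blast
  have s: "supp_in R \<phi>" unfolding supp_in_def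
    using R closure_subset[of "{x. \<phi> x \<noteq> 0}"] by (metis (mono_tags, lifting) linorder_not_le mem_Collect_eq subsetD)
  have "supp_in R (laplacian \<phi>)"
    using supp_in_partial_deriv[OF supp_in_partial_deriv[OF s]] unfolding supp_in_def laplacian_def by simp
  thus "\<exists>R. supp_in R \<phi> \<and> supp_in R (laplacian \<phi>)" using s by blast
qed

lemma integral_laplacian_eq_0:
  assumes "test_function \<phi>" shows "(\<integral>x. laplacian \<phi> x \<partial>lborel) = 0"
proof -
  note t = test_functionD[OF assms]
  obtain R where R: "supp_in R \<phi>" using t(7) by blast
  have s: "supp_in R (partial_deriv b \<phi>)" for b by (rule supp_in_partial_deriv[OF R])
  have "(\<integral>x. partial_deriv b (partial_deriv b \<phi>) x \<partial>lborel) = 0" if "b \<in> Basis" for b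
    unfolding partial_deriv_def[of b "partial_deriv b \<phi>"]
    by (rule integral_directional_derivative_eq_0[OF t(2)[OF that], of b R])
       (use t(5)[OF that] s in \<open>auto simp: partial_deriv_def[abs_def] supp_in_def\<close>)
  moreover have "integrable lborel (partial_deriv b (partial_deriv b \<phi>))" if "b \<in> Basis" for b
    by (rule integrable_continuous_compact_support[OF t(5)[OF that], of R])
       (use supp_in_partial_deriv[OF s] in \<open>auto simp: supp_in_def\<close>)
  ultimately show ?thesis unfolding laplacian_def by (subst Bochner_Integration.integral_sum) auto
qed

text \<open>A smooth approximation of ln |x - y|. Its Laplacian 2 \<epsilon>^2 / (|x - y|^2 +
  \<epsilon>^2)^2 is an approximate identity of total mass 2 pi.\<close>

definition reg_log :: "real \<Rightarrow> real^2 \<Rightarrow> real^2 \<Rightarrow> real" where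
  "reg_log \<epsilon> y x = ln ((norm (x - y))\<^sup>2 + \<epsilon>\<^sup>2) / 2"

text \<open>Green's second identity for the smooth function \<open>reg_log\<close>: in every
  coordinate direction the component reg_log * (derivative of \<phi>) - \<phi> * (derivative of
  reg_log) has compact support, so the integral of its derivative vanishes.\<close>

lemma integral_reg_log_laplacian:
  assumes \<phi>: "test_function \<phi>" and \<epsilon>: "\<epsilon> > 0"
  shows "(\<integral>x. reg_log \<epsilon> y x * laplacian \<phi> x \<partial>lborel) = (\<integral>x. \<phi> x * (2 * \<epsilon>\<^sup>2 / ((norm (x - y))\<^sup>2 + \<epsilon>\<^sup>2)\<^sup>2) \<partial>lborel)"
proof -
  note t = test_functionD[OF \<phi>]
  obtain R where R: "supp_in R \<phi>" using t(7) by blast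
  define q where "q x = (norm (x - y))\<^sup>2 + \<epsilon>\<^sup>2" for x
  have q0: "q x > 0" for x using \<epsilon> by (simp add: q_def add_nonneg_pos)
  have qne: "q x \<noteq> 0" for x using q0[of x] by simp
  have qD: "(q has_derivative (\<lambda>h. 2 * ((x - y) \<bullet> h))) (at x)" for x
    unfolding q_def power2_norm_eq_inner
    by (auto intro!: derivative_eq_intros simp: inner_commute)
  have qc: "continuous_on UNIV q" unfolding q_def by (intro continuous_intros)
  have logD: "(reg_log \<epsilon> y has_derivative (\<lambda>h. ((x - y) \<bullet> h) / q x)) (at x)" for x
  proof -
    have "((\<lambda>x. ln (q x)) has_derivative (\<lambda>h. 2 * ((x - y) \<bullet> h) * inverse (q x))) (at x)"
      by (rule has_derivative_ln[OF q0 qD])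
    from has_derivative_mult_right[OF this, of "1 / 2"]
    have "((\<lambda>x. 1 / 2 * ln (q x)) has_derivative (\<lambda>h. 1 / 2 * (2 * ((x - y) \<bullet> h) * inverse (q x)))) (at x)" .
    moreover have "(\<lambda>h. 1 / 2 * (2 * ((x - y) \<bullet> h) * inverse (q x))) = (\<lambda>h. ((x - y) \<bullet> h) / q x)"
      by (simp add: fun_eq_iff inverse_eq_divide)
    moreover have "(\<lambda>x. 1 / 2 * ln (q x)) = (\<lambda>x. ln (q x) / 2)" by simp
    ultimately have "((\<lambda>x. ln (q x) / 2) has_derivative (\<lambda>h. ((x - y) \<bullet> h) / q x)) (at x)" by metis
    thus ?thesis by (simp add: reg_log_def[abs_def] q_def)
  qed
  \<comment> \<open>First derivative of \<open>reg_log\<close> in direction b; \<open>d\<close>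
    below is the second one, and \<open>D\<close> the full derivative of the Green
    component.\<close>
  define w where "w b x = ((x - y) \<bullet> b) / q x" for b x
  have wD: "(w b has_derivative (\<lambda>h. (h \<bullet> b) / q x - ((x - y) \<bullet> b) * (2 * ((x - y) \<bullet> h)) / (q x)\<^sup>2)) (at x)" for b x
    unfolding w_def[abs_def]
    by (rule derivative_eq_intros qD qne refl)+ (simp add: fun_eq_iff field_simps power2_eq_square qne)
  define d where "d b x = (b \<bullet> b) / q x - ((x - y) \<bullet> b) * (2 * ((x - y) \<bullet> b)) / (q x)\<^sup>2" for b x
  define D where "D b x h = (((x - y) \<bullet> h) / q x * partial_deriv b \<phi> x + reg_log \<epsilon> y x * frechet_derivative (partial_deriv b \<phi>) (at x) h)
     - (frechet_derivative \<phi> (at x) h * w b x + \<phi> x * ((h \<bullet> b) / q x - ((x - y) \<bullet> b) * (2 * ((x - y) \<bullet> h)) / (q x)\<^sup>2))" for b x h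
  have Db: "D b x b = reg_log \<epsilon> y x * partial_deriv b (partial_deriv b \<phi>) x - \<phi> x * d b x" for b x
    unfolding D_def d_def w_def by (simp add: partial_deriv_def)
  have cl: "continuous_on UNIV (reg_log \<epsilon> y)"
    unfolding reg_log_def[abs_def] q_def[symmetric] by (intro continuous_intros qc) (use qne in auto)
  have cd: "continuous_on UNIV (d b)" for b
    unfolding d_def[abs_def] by (intro continuous_intros qc) (use qne in auto)
  have supp: "supp_in R (partial_deriv b \<phi>)" for b by (rule supp_in_partial_deriv[OF R])
  have supp2: "supp_in R (partial_deriv b (partial_deriv b \<phi>))" for b by (rule supp_in_partial_deriv[OF supp])
  have i1: "integrable lborel (\<lambda>x. reg_log \<epsilon> y x * partial_deriv b (partial_deriv b \<phi>) x)" if "b \<in> Basis" for b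
    by (rule integrable_continuous_compact_support[of _ R])
       (use supp2 in \<open>auto simp: supp_in_def intro!: continuous_intros cl t(5) that\<close>)
  have i2: "integrable lborel (\<lambda>x. \<phi> x * d b x)" for b
    by (rule integrable_continuous_compact_support[of _ R])
       (use R in \<open>auto simp: supp_in_def intro!: continuous_intros cd t(3)\<close>)
  have "(\<integral>x. reg_log \<epsilon> y x * partial_deriv b (partial_deriv b \<phi>) x \<partial>lborel) = (\<integral>x. \<phi> x * d b x \<partial>lborel)" if b: "b \<in> Basis" for b
  proof -
    have "(\<integral>x. D b x b \<partial>lborel) = 0"
    proof (rule integral_directional_derivative_eq_0[where R=R and D="D b" and b=b and f="\<lambda>x. reg_log \<epsilon> y x * partial_deriv b \<phi> x - \<phi> x * w b x"])
      show "((\<lambda>x. reg_log \<epsilon> y x * partial_deriv b \<phi> x - \<phi> x * w b x) has_derivative D b x) (at x)" for x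
        unfolding D_def
        by (rule derivative_eq_intros logD wD t(1) t(2)[OF b] refl)+ (simp add: fun_eq_iff algebra_simps)
      show "continuous_on UNIV (\<lambda>x. D b x b)"
        unfolding Db by (intro continuous_intros cl cd t(3) t(5)[OF b])
      show "reg_log \<epsilon> y x * partial_deriv b \<phi> x - \<phi> x * w b x = 0" if "norm x > R" for x
        using R supp that by (simp add: supp_in_def)
    qed
    thus ?thesis unfolding Db using i1[OF b] i2[of b] by simp
  qed
  hence "(\<integral>x. reg_log \<epsilon> y x * laplacian \<phi> x \<partial>lborel) = (\<Sum>b\<in>Basis. \<integral>x. \<phi> x * d b x \<partial>lborel)"
    unfolding laplacian_def sum_distrib_left using i1 by (subst Bochner_Integration.integral_sum) auto
  also have "\<dots> = (\<integral>x. (\<Sum>b\<in>Basis. \<phi> x * d b x) \<partial>lborel)"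
    using i2 by (subst Bochner_Integration.integral_sum) auto
  also have "(\<lambda>x. \<Sum>b\<in>Basis. \<phi> x * d b x) = (\<lambda>x. \<phi> x * (2 * \<epsilon>\<^sup>2 / (q x)\<^sup>2))"
  proof
    fix x
    have "d b x = 1 / q x - 2 / (q x)\<^sup>2 * ((x - y) \<bullet> b)\<^sup>2" if "b \<in> Basis" for b
      unfolding d_def using inner_same_Basis[OF that] by (simp add: power2_eq_square)
    hence "(\<Sum>b\<in>Basis. d b x) = (\<Sum>b\<in>(Basis::(real^2) set). 1 / q x) - 2 / (q x)\<^sup>2 * (\<Sum>b\<in>Basis. ((x - y) \<bullet> b)\<^sup>2)"
      by (simp only: sum_subtractf sum_distrib_left cong: sum.cong)
    also have "(\<Sum>b\<in>Basis. ((x - y) \<bullet> b)\<^sup>2) = (norm (x - y))\<^sup>2"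
      using euclidean_inner[of "x - y" "x - y"] by (simp only: power2_norm_eq_inner power2_eq_square[of "(x - y) \<bullet> b" for b])
    \<comment> \<open>The dimension enters here: two basis vectors give 2 / q, which cancels the
      other term up to the \<epsilon>^2 in the numerator. This is the harmonicity of the logarithm
      in the plane.\<close>
    also have "(\<Sum>b\<in>(Basis::(real^2) set). 1 / q x) = 2 / q x" by simp
    also have "2 / q x - 2 / (q x)\<^sup>2 * (norm (x - y))\<^sup>2 = (2 * q x - 2 * (norm (x - y))\<^sup>2) / (q x)\<^sup>2"
      using qne[of x] by (simp add: field_simps power2_eq_square)
    also have "2 * q x - 2 * (norm (x - y))\<^sup>2 = 2 * \<epsilon>\<^sup>2" by (simp add: q_def)
    finally show "(\<Sum>b\<in>Basis. \<phi> x * d b x) = \<phi> x * (2 * \<epsilon>\<^sup>2 / (q x)\<^sup>2)" by (simp only: sum_distrib_left[symmetric])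
  qed
  finally show ?thesis by (simp add: q_def)
qed

lemma integral_lborel_affine:
  fixes f :: "'a::euclidean_space \<Rightarrow> real"
  assumes f: "f \<in> borel_measurable borel" and c: "c > 0"
  shows "(\<integral>x. f x \<partial>lborel) = (\<integral>x. c ^ DIM('a) * f (t + c *\<^sub>R x) \<partial>lborel)"
proof -
  have "(\<integral>x. f x \<partial>lborel) = (\<integral>x. f x \<partial>density (distr lborel borel (\<lambda>x. t + c *\<^sub>R x)) (\<lambda>_. ennreal (c ^ DIM('a))))"
    using lborel_affine[of c t] c by (simp add: ennreal_power)
  also have "\<dots> = (\<integral>x. c ^ DIM('a) * f x \<partial>distr lborel borel (\<lambda>x. t + c *\<^sub>R x))"
    using f c by (subst integral_density) auto
  also have "\<dots> = (\<integral>x. c ^ DIM('a) * f (t + c *\<^sub>R x) \<partial>lborel)"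
    using f by (subst integral_distr) auto
  finally show ?thesis .
qed

lemma integrable_bracket_sq:
  "integrable lborel (\<lambda>x::real^2. 2 / (1 + (norm x)\<^sup>2)\<^sup>2)" "(\<integral>x. 2 / (1 + (norm (x::real^2))\<^sup>2)\<^sup>2 \<partial>lborel) = 2 * pi"
proof -
  have e: "1 / (1 + (norm x)\<^sup>2)\<^sup>2 = (1 + (norm x)\<^sup>2) powr (-2)" for x :: "real^2"
    using bracket_pos[of x] by (simp add: powr_minus_divide)
  have "has_bochner_integral lborel (\<lambda>x::real^2. 1 / (1 + (norm x)\<^sup>2)\<^sup>2) pi"
    by (rule has_bochner_integral_nn_integral) (use nn_integral_bracket_powr[of 2] in \<open>auto simp: e\<close>)
  from has_bochner_integral_mult_right[OF this, of 2]
  have "has_bochner_integral lborel (\<lambda>x::real^2. 2 / (1 + (norm x)\<^sup>2)\<^sup>2) (2 * pi)" by simp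
  thus "integrable lborel (\<lambda>x::real^2. 2 / (1 + (norm x)\<^sup>2)\<^sup>2)" "(\<integral>x. 2 / (1 + (norm (x::real^2))\<^sup>2)\<^sup>2 \<partial>lborel) = 2 * pi"
    by (simp_all add: has_bochner_integral_iff)
qed

text \<open>1 / |x - y| is a convenient majorant for the logarithmic singularity, still integrable
  in the plane.\<close>

lemma integrable_inverse_norm_cball:
  "integrable lborel (\<lambda>x::real^2. indicator (cball 0 R) x * (1 / norm (x - y)))"
proof -
  have "(\<integral>\<^sup>+x. ennreal (norm (x - y) powr (-1)) * indicator (cball 0 1) (x - y) \<partial>lborel) = ennreal (pi / (1 - 1 / 2))"
    using nn_integral_lborel_shift[of "\<lambda>x::real^2. ennreal (norm x powr (-1)) * indicator (cball 0 1) x" y]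
      nn_integral_norm_powr_ball[of 1] by (simp add: borel_measurable_times_ennreal borel_measurable_indicator)
  also have "(\<integral>\<^sup>+x. ennreal (norm (x - y) powr (-1)) * indicator (cball 0 1) (x - y) \<partial>lborel) =
      (\<integral>\<^sup>+x. ennreal (norm (x - y) powr (-1) * indicator (cball 0 1) (x - y)) \<partial>lborel)"
    by (intro nn_integral_cong) (simp add: indicator_def)
  finally have fin: "(\<integral>\<^sup>+x. ennreal (norm (x - y) powr (-1) * indicator (cball 0 1) (x - y)) \<partial>lborel) < \<infinity>"
    by simp
  have m: "(\<lambda>x. norm (x - y) powr (-1) * indicator (cball 0 1) (x - y)) \<in> borel_measurable lborel"
  proof -
    have "(\<lambda>z. norm z powr (-1) * indicator (cball 0 1) z) \<in> borel_measurable (borel :: (real^2) measure)"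
    proof (intro borel_measurable_times borel_measurable_indicator)
      show "(\<lambda>z::real^2. norm z powr (-1)) \<in> borel_measurable borel" by measurable
    qed simp
    from measurable_compose[OF _ this, of "\<lambda>x. x - y" lborel] show ?thesis by simp
  qed
  have i1: "integrable lborel (\<lambda>x. norm (x - y) powr (-1) * indicator (cball 0 1) (x - y))"
    by (rule integrableI_nonneg[OF m _ fin]) simp
  note i2 = integrable_indicator_cball[of "0::real^2" R]
  show ?thesis
  proof (rule Bochner_Integration.integrable_bound[OF Bochner_Integration.integrable_add[OF i1 i2]])
    show "(\<lambda>x::real^2. indicator (cball 0 R) x * (1 / norm (x - y))) \<in> borel_measurable lborel"
      by (intro borel_measurable_times borel_measurable_indicator borel_measurable_divide) auto
    have "norm (indicator (cball 0 R) x * (1 / norm (x - y))) \<le> norm (norm (x - y) powr (-1) * indicator (cball 0 1) (x - y) + indicator (cball (0::real^2) R) x)" for x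
    proof (cases "norm (x - y) \<le> 1")
      case True
      thus ?thesis by (auto simp: indicator_def powr_minus_divide)
    next
      case False
      thus ?thesis by (auto simp: indicator_def divide_le_eq)
    qed
    thus "AE x in lborel. norm (indicator (cball 0 R) x * (1 / norm (x - y))) \<le> norm (norm (x - y) powr (-1) * indicator (cball 0 1) (x - y) + indicator (cball (0::real^2) R) x)"
      by simp
  qed
qed

lemma abs_ln_le: fixes r :: real assumes "r > 0" shows "\<bar>ln r\<bar> \<le> 1 / r + r"
proof -
  have "ln r \<le> r" using ln_le_minus_one[OF assms] by simp
  moreover have "ln (1 / r) \<le> 1 / r" using ln_le_minus_one[of "1 / r"] assms by simp
  moreover have "ln (1 / r) = - ln r" using assms by (simp add: ln_div)
  moreover have "0 < 1 / r" using assms by simp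
  ultimately show ?thesis using assms by linarith
qed

text \<open>\<open>reg_log\<close> lies between ln |x - y| and |x - y|^2 / 2 when \<epsilon> \<le>
  1. The bound does not involve \<epsilon> and therefore serves as dominating function.\<close>

lemma abs_reg_log_le:
  assumes "0 < \<epsilon>" "\<epsilon> \<le> 1" "x \<noteq> y"
  shows "\<bar>reg_log \<epsilon> y x\<bar> \<le> 1 / norm (x - y) + norm (x - y) + (norm (x - y))\<^sup>2"
proof -
  define r where "r = norm (x - y)"
  have r: "r > 0" using assms by (simp add: r_def)
  have "ln (r\<^sup>2) \<le> ln (r\<^sup>2 + \<epsilon>\<^sup>2)" by (rule ln_mono) (use r in \<open>auto intro: add_pos_nonneg\<close>)
  hence l: "ln r \<le> ln (r\<^sup>2 + \<epsilon>\<^sup>2) / 2" using r by (simp add: ln_realpow)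
  have "\<epsilon>\<^sup>2 \<le> 1" using assms by (simp add: power_le_one)
  hence "ln (r\<^sup>2 + \<epsilon>\<^sup>2) \<le> ln (r\<^sup>2 + 1)" using r assms by (intro ln_mono add_pos_pos) auto
  also have "\<dots> \<le> r\<^sup>2" using ln_add_one_self_le_self[of "r\<^sup>2"] by (simp add: add.commute)
  finally have u: "ln (r\<^sup>2 + \<epsilon>\<^sup>2) / 2 \<le> r\<^sup>2 / 2" by simp
  have "0 \<le> r\<^sup>2" by simp
  moreover have "0 < 1 / r" using r by simp
  ultimately show ?thesis using abs_ln_le[OF r] l u r unfolding reg_log_def r_def[symmetric] by linarith
qed

lemma reg_log_tendsto:
  assumes "x \<noteq> y" shows "(\<lambda>n. reg_log (1 / real (Suc n)) y x) \<longlonglongrightarrow> ln (norm (x - y))"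
proof -
  have "(\<lambda>n. ln ((norm (x - y))\<^sup>2 + (1 / real (Suc n))\<^sup>2) / 2) \<longlonglongrightarrow> ln ((norm (x - y))\<^sup>2 + 0\<^sup>2) / 2"
    using assms by (intro tendsto_intros LIMSEQ_Suc[OF lim_1_over_n]) auto
  thus ?thesis using assms by (simp add: reg_log_def ln_realpow)
qed

lemma supp_bounded:
  fixes f :: "'a::euclidean_space \<Rightarrow> real"
  assumes "continuous_on UNIV f" "supp_in R f"
  shows "\<exists>M\<ge>0. \<forall>x. \<bar>f x\<bar> \<le> M * indicator (cball 0 R) x"
proof -
  have "bounded (f ` cball 0 R)"
    by (intro compact_imp_bounded compact_continuous_image continuous_on_subset[OF assms(1)]) auto
  then obtain M where "\<forall>z\<in>f ` cball 0 R. norm z \<le> M" unfolding bounded_iff by blast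
  hence M: "\<And>x. x \<in> cball 0 R \<Longrightarrow> \<bar>f x\<bar> \<le> M" by auto
  have "\<bar>f x\<bar> \<le> max 0 M * indicator (cball 0 R) x" for x
    using M[of x] assms(2) by (cases "norm x \<le> R") (auto simp: supp_in_def indicator_def le_max_iff_disj)
  thus ?thesis by (intro exI[of _ "max 0 M"]) auto
qed

text \<open>The same integrals are passed to the limit \<epsilon> \<rightarrow> 0 in two ways. On
  the left \<open>reg_log\<close> tends to the logarithm under an integrable majorant; on the right,
  Green's identity and the substitution x = y + \<epsilon> z turn them into averages of \<phi> near
  y with weight of mass 2 pi.\<close>

lemma log_laplacian:
  assumes \<phi>: "test_function \<phi>"
  shows "integrable lborel (\<lambda>x. ln (norm (x - y)) * laplacian \<phi> x)"
    "(\<integral>x. ln (norm (x - y)) * laplacian \<phi> x \<partial>lborel) = 2 * pi * \<phi> (y :: real^2)"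
proof -
  note t = test_functionD[OF \<phi>]
  obtain R where R: "supp_in R \<phi>" "supp_in R (laplacian \<phi>)" using t(7) by blast
  obtain M where M: "M \<ge> 0" "\<And>x. \<bar>laplacian \<phi> x\<bar> \<le> M * indicator (cball 0 R) x" using supp_bounded[OF t(6) R(2)] by blast
  obtain M' where M': "M' \<ge> 0" "\<And>x. \<bar>\<phi> x\<bar> \<le> M' * indicator (cball 0 R) x" using supp_bounded[OF t(3) R(1)] by blast
  have pm: "\<phi> \<in> borel_measurable borel" using t(3) by (rule borel_measurable_continuous_onI)
  have lm: "laplacian \<phi> \<in> borel_measurable borel" using t(6) by (rule borel_measurable_continuous_onI)
  \<comment> \<open>Bounds |x - y| + |x - y|^2 on the ball that contains the support.\<close>
  define N where "N = \<bar>R\<bar> + norm y + (\<bar>R\<bar> + norm y)\<^sup>2"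
  have N0: "N \<ge> 0" by (simp add: N_def)
  define e where "e n = 1 / real (Suc n)" for n
  have e: "0 < e n" "e n \<le> 1" for n by (simp_all add: e_def)
  define w where "w x = M * (indicator (cball 0 R) x * (1 / norm (x - y)) + N * indicator (cball 0 R) x)" for x
  note i2 = integrable_indicator_cball[of "0::real^2" R]
  have wi: "integrable lborel w" unfolding w_def
    by (intro integrable_mult_right Bochner_Integration.integrable_add integrable_inverse_norm_cball i2)
  have bound: "norm (l * laplacian \<phi> x) \<le> w x" if l: "\<bar>l\<bar> \<le> 1 / norm (x - y) + norm (x - y) + (norm (x - y))\<^sup>2" for l x
  proof (cases "norm x \<le> R")
    case True
    have r: "norm (x - y) \<le> \<bar>R\<bar> + norm y" using norm_triangle_ineq4[of x y] True by linarith
    have "(norm (x - y))\<^sup>2 \<le> (\<bar>R\<bar> + norm y)\<^sup>2" using r by (intro power_mono) auto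
    hence l': "\<bar>l\<bar> \<le> 1 / norm (x - y) + N" using l r unfolding N_def by linarith
    from mult_mono[OF l' M(2)[of x]] have "\<bar>l\<bar> * \<bar>laplacian \<phi> x\<bar> \<le> (1 / norm (x - y) + N) * (M * indicator (cball 0 R) x)"
      using N0 by simp
    thus ?thesis using True by (simp add: w_def abs_mult algebra_simps)
  next
    case False
    hence "laplacian \<phi> x = 0" using R(2) by (simp add: supp_in_def)
    thus ?thesis using M(1) N0 by (simp add: w_def)
  qed
  have ae: "AE x in lborel. x \<noteq> y" by (rule AE_lborel_singleton)
  have b1: "AE x in lborel. norm (reg_log (e n) y x * laplacian \<phi> x) \<le> w x" for n
    using ae by eventually_elim (rule bound[OF abs_reg_log_le[OF e]])
  have lim1: "(\<lambda>n. \<integral>x. reg_log (e n) y x * laplacian \<phi> x \<partial>lborel) \<longlonglongrightarrow> (\<integral>x. ln (norm (x - y)) * laplacian \<phi> x \<partial>lborel)"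
  proof (rule integral_dominated_convergence[OF _ _ wi])
    show "(\<lambda>x. ln (norm (x - y)) * laplacian \<phi> x) \<in> borel_measurable lborel" using lm by measurable
    show "(\<lambda>x. reg_log (e n) y x * laplacian \<phi> x) \<in> borel_measurable lborel" for n unfolding reg_log_def using lm by measurable
    show "AE x in lborel. (\<lambda>n. reg_log (e n) y x * laplacian \<phi> x) \<longlonglongrightarrow> ln (norm (x - y)) * laplacian \<phi> x"
      using ae unfolding e_def by eventually_elim (intro tendsto_intros reg_log_tendsto)
  qed (rule b1)
  have int: "(\<integral>x. reg_log (e n) y x * laplacian \<phi> x \<partial>lborel) = (\<integral>z. \<phi> (y + e n *\<^sub>R z) * (2 / (1 + (norm z)\<^sup>2)\<^sup>2) \<partial>lborel)" for n
  proof -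
    have m: "(\<lambda>x. \<phi> x * (2 * (e n)\<^sup>2 / ((norm (x - y))\<^sup>2 + (e n)\<^sup>2)\<^sup>2)) \<in> borel_measurable borel" using pm by measurable
    have "(\<integral>x. reg_log (e n) y x * laplacian \<phi> x \<partial>lborel) = (\<integral>x. \<phi> x * (2 * (e n)\<^sup>2 / ((norm (x - y))\<^sup>2 + (e n)\<^sup>2)\<^sup>2) \<partial>lborel)"
      by (rule integral_reg_log_laplacian[OF \<phi> e(1)])
    also have "\<dots> = (\<integral>z. (e n)\<^sup>2 * (\<phi> (y + e n *\<^sub>R z) * (2 * (e n)\<^sup>2 / ((norm ((y + e n *\<^sub>R z) - y))\<^sup>2 + (e n)\<^sup>2)\<^sup>2)) \<partial>lborel)"
      using integral_lborel_affine[OF m e(1)[of n], of y] by simp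
    also have "\<dots> = (\<integral>z. \<phi> (y + e n *\<^sub>R z) * (2 / (1 + (norm z)\<^sup>2)\<^sup>2) \<partial>lborel)"
    proof (rule Bochner_Integration.integral_cong[OF refl])
      fix z :: "real^2"
      have n: "(norm ((y + e n *\<^sub>R z) - y))\<^sup>2 + (e n)\<^sup>2 = (e n)\<^sup>2 * (1 + (norm z)\<^sup>2)"
        using e(1)[of n] by (simp add: power_mult_distrib algebra_simps)
      have E: "E * (p * (2 * E / (E * s)\<^sup>2)) = p * (2 / s\<^sup>2)" if "E \<noteq> 0" for E p s :: real
        using that by (simp add: power2_eq_square)
      have "(e n)\<^sup>2 \<noteq> 0" using e(1)[of n] by simp
      thus "(e n)\<^sup>2 * (\<phi> (y + e n *\<^sub>R z) * (2 * (e n)\<^sup>2 / ((norm ((y + e n *\<^sub>R z) - y))\<^sup>2 + (e n)\<^sup>2)\<^sup>2)) = \<phi> (y + e n *\<^sub>R z) * (2 / (1 + (norm z)\<^sup>2)\<^sup>2)"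
        unfolding n by (rule E)
    qed
    finally show ?thesis .
  qed
  have lim2: "(\<lambda>n. \<integral>z. \<phi> (y + e n *\<^sub>R z) * (2 / (1 + (norm z)\<^sup>2)\<^sup>2) \<partial>lborel) \<longlonglongrightarrow> (\<integral>z. \<phi> y * (2 / (1 + (norm (z::real^2))\<^sup>2)\<^sup>2) \<partial>lborel)"
  proof (rule integral_dominated_convergence[where w="\<lambda>z. M' * (2 / (1 + (norm z)\<^sup>2)\<^sup>2)"])
    show "integrable lborel (\<lambda>z::real^2. M' * (2 / (1 + (norm z)\<^sup>2)\<^sup>2))"
      by (intro integrable_mult_right integrable_bracket_sq(1))
    show "AE z in lborel. (\<lambda>n. \<phi> (y + e n *\<^sub>R z) * (2 / (1 + (norm z)\<^sup>2)\<^sup>2)) \<longlonglongrightarrow> \<phi> y * (2 / (1 + (norm z)\<^sup>2)\<^sup>2)"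
    proof (rule AE_I2)
      fix z :: "real^2"
      have "(\<lambda>n. y + e n *\<^sub>R z) \<longlonglongrightarrow> y + 0 *\<^sub>R z"
        unfolding e_def by (intro tendsto_intros LIMSEQ_Suc[OF lim_1_over_n])
      hence "(\<lambda>n. y + e n *\<^sub>R z) \<longlonglongrightarrow> y" by simp
      hence "(\<lambda>n. \<phi> (y + e n *\<^sub>R z)) \<longlonglongrightarrow> \<phi> y"
        using t(3) by (intro isCont_tendsto_compose[of y \<phi>]) (simp_all add: continuous_on_eq_continuous_at)
      thus "(\<lambda>n. \<phi> (y + e n *\<^sub>R z) * (2 / (1 + (norm z)\<^sup>2)\<^sup>2)) \<longlonglongrightarrow> \<phi> y * (2 / (1 + (norm z)\<^sup>2)\<^sup>2)"
        by (intro tendsto_mult tendsto_const)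
    qed
    show "AE z in lborel. norm (\<phi> (y + e n *\<^sub>R z) * (2 / (1 + (norm z)\<^sup>2)\<^sup>2)) \<le> M' * (2 / (1 + (norm z)\<^sup>2)\<^sup>2)" for n
    proof (rule AE_I2)
      fix z :: "real^2"
      have "\<bar>\<phi> (y + e n *\<^sub>R z)\<bar> \<le> M'"
        by (rule order_trans[OF M'(2)]) (use M'(1) in \<open>simp add: indicator_def\<close>)
      thus "norm (\<phi> (y + e n *\<^sub>R z) * (2 / (1 + (norm z)\<^sup>2)\<^sup>2)) \<le> M' * (2 / (1 + (norm z)\<^sup>2)\<^sup>2)"
        unfolding norm_mult by (intro mult_mono) auto
    qed
    show "(\<lambda>z. \<phi> (y + e n *\<^sub>R z) * (2 / (1 + (norm z)\<^sup>2)\<^sup>2)) \<in> borel_measurable lborel" for n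
      using measurable_compose[OF _ pm, of "\<lambda>z. y + e n *\<^sub>R z" lborel] by measurable
  qed measurable
  have "(\<integral>z. \<phi> y * (2 / (1 + (norm (z::real^2))\<^sup>2)\<^sup>2) \<partial>lborel) = 2 * pi * \<phi> y"
    by (simp only: integral_mult_right_zero integrable_bracket_sq(2)) simp
  with LIMSEQ_unique[OF lim1 lim2[folded int]]
  show "(\<integral>x. ln (norm (x - y)) * laplacian \<phi> x \<partial>lborel) = 2 * pi * \<phi> y" by simp
  show "integrable lborel (\<lambda>x. ln (norm (x - y)) * laplacian \<phi> x)"
  proof (rule Bochner_Integration.integrable_bound[OF wi])
    show "(\<lambda>x. ln (norm (x - y)) * laplacian \<phi> x) \<in> borel_measurable lborel" using lm by measurable
    show "AE x in lborel. norm (ln (norm (x - y)) * laplacian \<phi> x) \<le> norm (w x)"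
      using ae
    proof eventually_elim
      case (elim x)
      have "\<bar>ln (norm (x - y))\<bar> \<le> 1 / norm (x - y) + norm (x - y)"
        by (rule abs_ln_le) (use elim in simp)
      hence "\<bar>ln (norm (x - y))\<bar> \<le> 1 / norm (x - y) + norm (x - y) + (norm (x - y))\<^sup>2"
        by (rule order_trans) simp
      from bound[OF this] show ?case by (rule order_trans) simp
    qed
  qed
qed

section \<open>The chordal logarithm and its potentials\<close>

lemma log_chord:
  assumes "x \<noteq> y"
  shows "ln (chord x y) = ln (norm (x - y)) - ln (1 + (norm x)\<^sup>2) / 2 - ln (1 + (norm y)\<^sup>2) / 2"
proof -
  have "norm (x - y) > 0" "sqrt (1 + (norm x)\<^sup>2) > 0" "sqrt (1 + (norm y)\<^sup>2) > 0"
    using assms bracket_pos[of x] bracket_pos[of y] by simp_all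
  thus ?thesis unfolding chord_def using bracket_pos[of x] bracket_pos[of y]
    by (simp only: ln_divide_pos ln_mult_pos mult_pos_pos ln_sqrt)
qed

lemma laplacian_integrable:
  fixes \<phi> :: "real^2 \<Rightarrow> real"
  assumes \<phi>: "test_function \<phi>"
  shows "integrable lborel (laplacian \<phi>)" "integrable lborel (\<lambda>x. ln (1 + (norm x)\<^sup>2) * laplacian \<phi> x)"
proof -
  note t = test_functionD[OF \<phi>]
  obtain R where R: "supp_in R (laplacian \<phi>)" using t(7) by blast
  show "integrable lborel (laplacian \<phi>)"
    by (rule integrable_continuous_compact_support[OF t(6), of R]) (use R in \<open>auto simp: supp_in_def\<close>)
  show "integrable lborel (\<lambda>x. ln (1 + (norm x)\<^sup>2) * laplacian \<phi> x)"
  proof (rule integrable_continuous_compact_support[of _ R])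
    have "1 + (norm x)\<^sup>2 \<noteq> 0" for x :: "real^2" using bracket_pos[of x] by simp
    thus "continuous_on UNIV (\<lambda>x. ln (1 + (norm x)\<^sup>2) * laplacian \<phi> x)"
      by (intro continuous_intros t(6)) auto
  qed (use R in \<open>auto simp: supp_in_def\<close>)
qed

text \<open>The summand depending only on y is a constant in x and disappears because a Laplacian of
  a test function has integral zero. The remaining error does not depend on y.\<close>

lemma log_chord_laplacian:
  fixes y :: "real^2"
  assumes \<phi>: "test_function \<phi>"
  shows "(\<integral>x. ln (chord x y) * laplacian \<phi> x \<partial>lborel) = 2 * pi * \<phi> y - (\<integral>x. ln (1 + (norm x)\<^sup>2) * laplacian \<phi> x \<partial>lborel) / 2"
proof -
  note t = test_functionD[OF \<phi>]
  have lm: "laplacian \<phi> \<in> borel_measurable borel" using t(6) by (rule borel_measurable_continuous_onI)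
  note i1 = laplacian_integrable(1)[OF \<phi>] and i2 = laplacian_integrable(2)[OF \<phi>]
  note i3 = log_laplacian(1)[OF \<phi>, of y]
  have "(\<integral>x. ln (chord x y) * laplacian \<phi> x \<partial>lborel) =
     (\<integral>x. ln (norm (x - y)) * laplacian \<phi> x - 1 / 2 * (ln (1 + (norm x)\<^sup>2) * laplacian \<phi> x) - ln (1 + (norm y)\<^sup>2) / 2 * laplacian \<phi> x \<partial>lborel)"
  proof (rule integral_cong_AE)
    show "(\<lambda>x. ln (chord x y) * laplacian \<phi> x) \<in> borel_measurable lborel"
      unfolding chord_def using lm by measurable
    show "(\<lambda>x. ln (norm (x - y)) * laplacian \<phi> x - 1 / 2 * (ln (1 + (norm x)\<^sup>2) * laplacian \<phi> x) - ln (1 + (norm y)\<^sup>2) / 2 * laplacian \<phi> x) \<in> borel_measurable lborel"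
      using lm by measurable
    have "AE x in lborel. x \<noteq> y" by (rule AE_lborel_singleton)
    thus "AE x in lborel. ln (chord x y) * laplacian \<phi> x =
       ln (norm (x - y)) * laplacian \<phi> x - 1 / 2 * (ln (1 + (norm x)\<^sup>2) * laplacian \<phi> x) - ln (1 + (norm y)\<^sup>2) / 2 * laplacian \<phi> x"
      by eventually_elim (simp add: log_chord algebra_simps)
  qed
  also have "\<dots> = (\<integral>x. ln (norm (x - y)) * laplacian \<phi> x \<partial>lborel) - 1 / 2 * (\<integral>x. ln (1 + (norm x)\<^sup>2) * laplacian \<phi> x \<partial>lborel)
      - ln (1 + (norm y)\<^sup>2) / 2 * (\<integral>x. laplacian \<phi> x \<partial>lborel)"
    using i1 i2 i3 by (simp only: Bochner_Integration.integral_diff Bochner_Integration.integrable_diff integrable_mult_right integral_mult_right_zero)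
  finally show ?thesis by (simp add: log_laplacian(2)[OF \<phi>] integral_laplacian_eq_0[OF \<phi>])
qed

text \<open>By Fubini the Laplacian falls on the chordal logarithm. Its error term is independent of
  y, so it only sees the total mass of f; for mass 2 pi B it is cancelled by the term -B/2 ln (1 +
  |x|^2) of U.\<close>

lemma log_chord_potential_distr:
  fixes f U :: "real^2 \<Rightarrow> real"
  assumes f: "integrable lborel f" and mass: "(\<integral>y. f y \<partial>lborel) = 2 * pi * B"
    and pi: "\<And>x. integrable lborel (\<lambda>y. ln (chord x y) * f y)"
    and pK: "\<And>x. (\<integral>y. \<bar>ln (chord x y) * f y\<bar> \<partial>lborel) \<le> K"
    and U: "\<And>x. U x = c - 1 / (2 * pi) * (\<integral>y. ln (chord x y) * f y \<partial>lborel) - B / 2 * ln (1 + (norm x)\<^sup>2)"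
    and \<phi>: "test_function \<phi>"
  shows "- (\<integral>x. U x * laplacian \<phi> x \<partial>lborel) = (\<integral>x. f x * \<phi> x \<partial>lborel)"
proof -
  note t = test_functionD[OF \<phi>]
  obtain R where R: "supp_in R \<phi>" "supp_in R (laplacian \<phi>)" using t(7) by blast
  obtain M' where M': "M' \<ge> 0" "\<And>x. \<bar>\<phi> x\<bar> \<le> M' * indicator (cball 0 R) x" using supp_bounded[OF t(3) R(1)] by blast
  have pm[measurable]: "\<phi> \<in> borel_measurable borel" using t(3) by (rule borel_measurable_continuous_onI)
  have lm[measurable]: "laplacian \<phi> \<in> borel_measurable borel" using t(6) by (rule borel_measurable_continuous_onI)
  have fm[measurable]: "f \<in> borel_measurable borel" using f by (simp add: borel_measurable_integrable)
  have cm: "(\<lambda>p. chord (fst p) (snd p)) \<in> borel_measurable (borel \<Otimes>\<^sub>M borel)"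
    using chord_meas by (simp add: case_prod_unfold)
  note i1 = laplacian_integrable(1)[OF \<phi>]
  define L where "L x = ln (1 + (norm x)\<^sup>2)" for x :: "real^2"
  define J where "J = (\<integral>x. L x * laplacian \<phi> x \<partial>lborel)"
  have i2: "integrable lborel (\<lambda>x. L x * laplacian \<phi> x)"
    unfolding L_def by (rule laplacian_integrable(2)[OF \<phi>])
  define V where "V x = (\<integral>y. ln (chord x y) * f y \<partial>lborel)" for x
  have m2: "(\<lambda>(x, y). ln (chord x y) * f y * laplacian \<phi> x) \<in> borel_measurable (lborel \<Otimes>\<^sub>M lborel)"
    using cm unfolding case_prod_unfold by measurable
  have Vm: "V \<in> borel_measurable borel"
  proof -
    have "(\<lambda>(x, y). ln (chord x y) * f y) \<in> borel_measurable (borel \<Otimes>\<^sub>M lborel)"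
      using cm unfolding case_prod_unfold by measurable
    thus ?thesis unfolding V_def by (intro lborel.borel_measurable_lebesgue_integral) simp
  qed
  have Vb: "\<bar>V x\<bar> \<le> K" for x unfolding V_def by (rule order_trans[OF integral_abs_bound pK])
  have i3: "integrable lborel (\<lambda>x. V x * laplacian \<phi> x)"
  proof (rule Bochner_Integration.integrable_bound)
    show "integrable lborel (\<lambda>x. K * laplacian \<phi> x)" using i1 by simp
    have "K \<ge> 0" using Vb[of 0] by linarith
    thus "AE x in lborel. norm (V x * laplacian \<phi> x) \<le> norm (K * laplacian \<phi> x)"
      using Vb by (intro AE_I2) (simp add: abs_mult mult_right_mono)
  qed (use Vm in measurable)
  \<comment> \<open>Absolute integrability for Fubini: the inner integral is at most K uniformly in
    x, and the Laplacian of \<phi> is integrable.\<close>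
  have int2: "integrable (lborel \<Otimes>\<^sub>M lborel) (\<lambda>(x, y). ln (chord x y) * f y * laplacian \<phi> x)"
  proof (rule lborel_pair.Fubini_integrable[OF m2])
    have e: "(\<integral>y. norm (case (x, y) of (x, y) \<Rightarrow> ln (chord x y) * f y * laplacian \<phi> x) \<partial>lborel) = (\<integral>y. \<bar>ln (chord x y) * f y\<bar> \<partial>lborel) * \<bar>laplacian \<phi> x\<bar>" for x
      by (simp add: abs_mult)
    have "(\<lambda>x. \<integral>y. \<bar>ln (chord x y) * f y\<bar> \<partial>lborel) \<in> borel_measurable borel"
    proof -
      have "(\<lambda>(x, y). \<bar>ln (chord x y) * f y\<bar>) \<in> borel_measurable (borel \<Otimes>\<^sub>M lborel)"
        using cm unfolding case_prod_unfold by measurable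
      thus ?thesis by (intro lborel.borel_measurable_lebesgue_integral) simp
    qed
    hence m: "(\<lambda>x. (\<integral>y. \<bar>ln (chord x y) * f y\<bar> \<partial>lborel) * \<bar>laplacian \<phi> x\<bar>) \<in> borel_measurable lborel" by simp
    show "integrable lborel (\<lambda>x. \<integral>y. norm (case (x, y) of (x, y) \<Rightarrow> ln (chord x y) * f y * laplacian \<phi> x) \<partial>lborel)"
      unfolding e
    proof (rule Bochner_Integration.integrable_bound[OF _ m])
      show "integrable lborel (\<lambda>x. K * laplacian \<phi> x)" using i1 by simp
      have "K \<ge> 0" using Vb[of 0] by linarith
      thus "AE x in lborel. norm ((\<integral>y. \<bar>ln (chord x y) * f y\<bar> \<partial>lborel) * \<bar>laplacian \<phi> x\<bar>) \<le> norm (K * laplacian \<phi> x)"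
        using pK by (intro AE_I2) (simp add: abs_mult mult_right_mono)
    qed
    show "AE x in lborel. integrable lborel (\<lambda>y. case (x, y) of (x, y) \<Rightarrow> ln (chord x y) * f y * laplacian \<phi> x)"
      using pi by simp
  qed
  have fp: "integrable lborel (\<lambda>x. f x * \<phi> x)"
  proof (rule Bochner_Integration.integrable_bound)
    show "integrable lborel (\<lambda>x. M' * f x)" using f by simp
    have "\<bar>\<phi> x\<bar> \<le> M'" for x
      by (rule order_trans[OF M'(2)]) (use M'(1) in \<open>simp add: indicator_def\<close>)
    thus "AE x in lborel. norm (f x * \<phi> x) \<le> norm (M' * f x)"
      using M'(1) by (intro AE_I2) (simp add: abs_mult mult.commute mult_right_mono)
  qed measurable
  have "(\<integral>x. V x * laplacian \<phi> x \<partial>lborel) = (\<integral>x. (\<integral>y. ln (chord x y) * f y * laplacian \<phi> x \<partial>lborel) \<partial>lborel)"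
    unfolding V_def by simp
  also have "\<dots> = (\<integral>y. (\<integral>x. ln (chord x y) * f y * laplacian \<phi> x \<partial>lborel) \<partial>lborel)"
    by (rule lborel_pair.Fubini_integral[symmetric]) (rule int2)
  also have "\<dots> = (\<integral>y. f y * (2 * pi * \<phi> y - J / 2) \<partial>lborel)"
  proof (rule Bochner_Integration.integral_cong[OF refl])
    fix y
    have "(\<integral>x. ln (chord x y) * f y * laplacian \<phi> x \<partial>lborel) = (\<integral>x. f y * (ln (chord x y) * laplacian \<phi> x) \<partial>lborel)"
      by (simp only: mult_ac)
    also have "\<dots> = f y * (\<integral>x. ln (chord x y) * laplacian \<phi> x \<partial>lborel)" by simp
    finally show "(\<integral>x. ln (chord x y) * f y * laplacian \<phi> x \<partial>lborel) = f y * (2 * pi * \<phi> y - J / 2)"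
      by (simp only: log_chord_laplacian[OF \<phi>] J_def L_def)
  qed
  also have "\<dots> = (\<integral>y. 2 * pi * (f y * \<phi> y) - J / 2 * f y \<partial>lborel)"
    by (simp add: algebra_simps)
  also have "\<dots> = 2 * pi * (\<integral>y. f y * \<phi> y \<partial>lborel) - J / 2 * (2 * pi * B)"
    using fp f by (simp add: mass)
  finally have V: "(\<integral>x. V x * laplacian \<phi> x \<partial>lborel) = 2 * pi * (\<integral>y. f y * \<phi> y \<partial>lborel) - J / 2 * (2 * pi * B)" .
  have "(\<integral>x. U x * laplacian \<phi> x \<partial>lborel) = (\<integral>x. c * laplacian \<phi> x - 1 / (2 * pi) * (V x * laplacian \<phi> x) - B / 2 * (L x * laplacian \<phi> x) \<partial>lborel)"
    unfolding U V_def[symmetric] L_def[symmetric] by (simp only: left_diff_distrib mult.assoc)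
  also have "\<dots> = c * (\<integral>x. laplacian \<phi> x \<partial>lborel) - 1 / (2 * pi) * (\<integral>x. V x * laplacian \<phi> x \<partial>lborel) - B / 2 * J"
    unfolding J_def using i1 i2 i3
    by (simp only: Bochner_Integration.integral_diff Bochner_Integration.integrable_diff integrable_mult_right integral_mult_right_zero)
  also have "\<dots> = - (\<integral>y. f y * \<phi> y \<partial>lborel)"
    unfolding V integral_laplacian_eq_0[OF \<phi>] by (simp add: field_simps)
  finally show ?thesis by simp
qed

section \<open>The singular Toda system\<close>

locale toda_data =
  fixes m :: nat and \<beta> :: "nat \<Rightarrow> nat \<Rightarrow> real" and P :: "nat \<Rightarrow> real^2"
  assumes m: "m \<ge> 1"
    and beta: "\<And>i l. i \<in> {1, 2} \<Longrightarrow> l \<in> {1..m} \<Longrightarrow> \<beta> i l \<in> {0..<1}"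
    and sub: "\<And>i j. i \<in> {1, 2} \<Longrightarrow> j \<in> {1..m} \<Longrightarrow>
           3 * (1 + \<beta> i j) < 2 * (\<Sum>l=1..m. \<beta> i l) + (\<Sum>l=1..m. \<beta> (3 - i) l)"
    and less2: "\<And>i. i \<in> {1, 2} \<Longrightarrow> (\<Sum>l=1..m. \<beta> i l) < 2"
    and inj: "inj_on P {1..m}"
begin

definition ix :: "bool \<Rightarrow> nat" where "ix i = (if i then 1 else 2)"

lemma ix: "ix i \<in> {1, 2}" "3 - ix i = ix (\<not> i)" by (auto simp: ix_def)

text \<open>The growth exponent \<beta>_i of the theorem.\<close>

definition bt :: "bool \<Rightarrow> real" where "bt i = 2 - (\<Sum>l=1..m. \<beta> (ix i) l)"

lemma bt_pos: "bt i > 0" using less2[OF ix(1)[of i]] by (simp add: bt_def)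

text \<open>Solution of 2 F i - F (\<not> i) = 2 pi * bt i, the total mass that the right-hand side
  must have for logarithmic growth with coefficient -bt i.\<close>

definition F :: "bool \<Rightarrow> real" where "F i = 2 * pi * (2 * bt i + bt (\<not> i)) / 3"

text \<open>Midpoint between \<open>F i / pi\<close> and the largest exponent for which \<open>chord x y powr (- a i)\<close> is still integrable
  against the weight at every singular point.\<close>

definition a :: "bool \<Rightarrow> real" where
  "a i = (2 * (2 * bt i + bt (\<not> i)) / 3 + (2 - 2 * Max (\<beta> (ix i) ` {1..m}))) / 2"

lemma F_pos: "F i > 0" using bt_pos[of i] bt_pos[of "\<not> i"] by (simp add: F_def)

lemma a_bounds: "F i < pi * a i" "0 < a i" "\<And>l. l \<in> {1..m} \<Longrightarrow> a i + 2 * \<beta> (ix i) l < 2"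
proof -
  define M where "M = Max (\<beta> (ix i) ` {1..m})"
  have "M \<in> \<beta> (ix i) ` {1..m}" unfolding M_def using m by (intro Max_in) auto
  then obtain j where j: "j \<in> {1..m}" "M = \<beta> (ix i) j" by auto
  have le: "\<beta> (ix i) l \<le> M" if "l \<in> {1..m}" for l unfolding M_def using that by (intro Max_ge) auto
  define c where "c = 2 * (2 * bt i + bt (\<not> i)) / 3"
  \<comment> \<open>The first hypothesis at the index j of the largest \<beta>, rewritten: it opens
    the gap in which \<open>a i\<close> is placed.\<close>
  have c: "c < 2 - 2 * M"
    using sub[OF ix(1)[of i] j(1)] unfolding j(2) c_def bt_def ix(2) by argo
  have c0: "0 < c" using bt_pos[of i] bt_pos[of "\<not> i"] by (simp add: c_def)
  have ai: "a i = (c + (2 - 2 * M)) / 2" by (simp add: a_def c_def M_def)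
  have Fi: "F i = pi * c" by (simp add: F_def c_def)
  show "F i < pi * a i" unfolding Fi ai using c by simp
  show "0 < a i" unfolding ai using c c0 by simp
  show "a i + 2 * \<beta> (ix i) l < 2" if "l \<in> {1..m}" for l
    using le[OF that] c unfolding ai by argo
qed

definition k :: "bool \<Rightarrow> real^2 \<Rightarrow> real" where "k i = sphere_weight m \<beta> P (ix i)"

definition \<mu> :: "bool \<Rightarrow> (real^2) measure" where "\<mu> i = density lborel (\<lambda>x. ennreal (k i x))"

text \<open>On the diagonal \<open>G\<close> takes the value 0, since \<open>ln 0 = 0\<close>.\<close>

definition G :: "real^2 \<Rightarrow> real^2 \<Rightarrow> real" where "G x y = - ln (chord x y) / pi"

lemma k_nonneg: "0 \<le> k i x" unfolding k_def by (rule sphere_weight_nonneg)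

lemma k_meas: "k i \<in> borel_measurable borel" unfolding k_def by (rule sphere_weight_meas)

lemma k_meas': "(\<lambda>x. ennreal (k i x)) \<in> borel_measurable lborel" using k_meas[of i] by simp

lemma sets_mu: "sets (\<mu> i) = sets borel" by (simp add: \<mu>_def)

lemma AE_mu_neq: "AE y in \<mu> i. y \<noteq> x"
  unfolding \<mu>_def AE_density[OF k_meas'] using AE_lborel_singleton[of x] by eventually_elim simp

lemma G_nonneg: "0 \<le> G x y"
proof (cases "x = y")
  case False
  hence "chord x y > 0" by (simp add: chord_pos_iff)
  hence "ln (chord x y) \<le> 0" using chord_le_1[of x y] by simp
  thus ?thesis by (simp add: G_def divide_nonpos_pos)
qed (simp add: G_def chord_def)

lemma G_meas: "case_prod G \<in> borel_measurable (borel \<Otimes>\<^sub>M borel)"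
proof -
  have "(\<lambda>p. - ln (case_prod chord p) / pi) \<in> borel_measurable (borel \<Otimes>\<^sub>M borel)"
    by measurable
  thus ?thesis by (simp add: G_def[abs_def] case_prod_unfold)
qed

lemma G_section_meas: "(\<lambda>x. G x y) \<in> borel_measurable borel"
  unfolding G_def chord_def by measurable

abbreviation exp_int :: "bool \<Rightarrow> real^2 \<Rightarrow> ennreal" where
  "exp_int i y \<equiv> (\<integral>\<^sup>+x. ennreal (exp (pi * a i * G x y)) \<partial>\<mu> i)"

text \<open>Off the diagonal exp (pi * a i * G) is the chordal distance to the power -a i, so the
  claim is the weight estimate with a i + 2 \<beta> < 2 at every pole.\<close>

lemma exp_G_bound: "\<exists>C\<ge>0. \<forall>y. exp_int i y \<le> ennreal C"
proof -
  have "\<exists>C\<ge>0. \<forall>y. (\<integral>\<^sup>+x. ennreal (chord x y powr (- a i) * k i x) \<partial>lborel) \<le> ennreal C"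
    unfolding k_def
  proof (rule sphere_weight_integral_bound[OF m inj less_imp_le[OF a_bounds(2)[of i]]])
    show "0 \<le> \<beta> (ix i) l" if "l \<in> {1..m}" for l using beta[OF ix(1)[of i] that] by simp
    show "a i + 2 * \<beta> (ix i) l < 2" if "l \<in> {1..m}" for l by (rule a_bounds(3)[OF that])
  qed
  then obtain C where C: "C \<ge> 0" "\<And>y. (\<integral>\<^sup>+x. ennreal (chord x y powr (- a i) * k i x) \<partial>lborel) \<le> ennreal C"
    by blast
  have "exp_int i y \<le> ennreal C" for y
  proof -
    have "exp_int i y = (\<integral>\<^sup>+x. ennreal (k i x) * ennreal (exp (pi * a i * G x y)) \<partial>lborel)"
      unfolding \<mu>_def using G_section_meas[of y] by (intro nn_integral_density k_meas') simp
    also have "\<dots> = (\<integral>\<^sup>+x. ennreal (chord x y powr (- a i) * k i x) \<partial>lborel)"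
    proof (rule nn_integral_cong_AE)
      show "AE x in lborel. ennreal (k i x) * ennreal (exp (pi * a i * G x y)) = ennreal (chord x y powr (- a i) * k i x)"
        using AE_lborel_singleton[of y]
      proof eventually_elim
        case (elim x)
        hence "chord x y \<noteq> 0" by (simp add: chord_eq_0_iff)
        hence "exp (pi * a i * G x y) = chord x y powr (- a i)" by (simp add: G_def powr_def)
        thus ?case using k_nonneg[of i x] by (simp add: ennreal_mult mult.commute)
      qed
    qed
    finally show ?thesis using C(2)[of y] by simp
  qed
  thus ?thesis using C(1) by blast
qed

lemma finite_mu: "finite_measure (\<mu> i)"
proof (rule finite_measureI)
  obtain C where C: "C \<ge> 0" "\<And>y. exp_int i y \<le> ennreal C" using exp_G_bound by blast
  have "emeasure (\<mu> i) (space (\<mu> i)) = (\<integral>\<^sup>+x. 1 \<partial>\<mu> i)" by simp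
  \<comment> \<open>Since \<open>G\<close> is nonnegative the exponential is at least 1; the base
    point 0 is arbitrary.\<close>
  also have "\<dots> \<le> exp_int i 0"
    using G_nonneg a_bounds(2)[of i] by (intro nn_integral_mono) (simp add: zero_le_mult_iff)
  also have "\<dots> \<le> ennreal C" by (rule C(2))
  finally show "emeasure (\<mu> i) (space (\<mu> i)) \<noteq> \<infinity>" by (auto simp: top_unique)
qed

text \<open>The weight vanishes only at the finitely many poles, a null set.\<close>

lemma mu_pos: "0 < measure (\<mu> i) UNIV"
proof -
  interpret finite_measure "\<mu> i" by (rule finite_mu)
  have "emeasure (\<mu> i) UNIV \<noteq> 0"
  proof
    assume "emeasure (\<mu> i) UNIV = 0"
    moreover have "emeasure (\<mu> i) UNIV = (\<integral>\<^sup>+x. ennreal (k i x) \<partial>lborel)"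
      unfolding \<mu>_def by (subst emeasure_density[OF k_meas']) simp_all
    ultimately have "AE x in lborel. ennreal (k i x) = 0" using k_meas' by (simp add: nn_integral_0_iff_AE)
    moreover have "AE x in lborel. x \<notin> P ` {1..m}" by (intro AE_not_in finite_imp_null_set_lborel) simp
    ultimately have "AE x in (lborel :: (real^2) measure). False"
    proof eventually_elim
      case (elim x)
      thus ?case using sphere_weight_pos[of x P m \<beta> "ix i"] by (simp add: k_def ennreal_eq_0_iff)
    qed
    thus False by (simp add: trivial_limit_def[symmetric] ae_filter_eq_bot_iff)
  qed
  thus ?thesis using emeasure_eq_measure[of UNIV] measure_nonneg[of "\<mu> i" UNIV] by (simp add: zero_less_measure_iff)
qed

lemma toda_kernel_exists: "\<exists>C. toda_kernel \<mu> G F (\<lambda>i. pi * a i) C"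
proof -
  have "\<forall>i. \<exists>C. C \<ge> 0 \<and> (\<forall>y. exp_int i y \<le> ennreal C)"
    using exp_G_bound by blast
  then obtain C where C: "\<And>i. C i \<ge> 0" "\<And>i y. exp_int i y \<le> ennreal (C i)"
    by metis
  have em: "(\<lambda>x. exp (pi * a i * G x y)) \<in> borel_measurable (\<mu> i)" for i y
    using G_section_meas[of y] measurable_cong_sets[OF sets_mu refl] by (simp add: \<mu>_def)
  show ?thesis
  proof (intro exI[of _ C] toda_kernel.intro two_finite_measures.intro toda_kernel_axioms.intro)
    show "finite_measure (\<mu> i)" for i by (rule finite_mu)
    show "sets (\<mu> i) = sets borel" for i by (rule sets_mu)
    show "0 < measure (\<mu> i) UNIV" for i by (rule mu_pos)
    show "0 < F i" "F i < pi * a i" for i by (rule F_pos, rule a_bounds(1))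
    show "case_prod G \<in> borel_measurable (borel \<Otimes>\<^sub>M borel)" by (rule G_meas)
    show "0 \<le> G x y" for x y by (rule G_nonneg)
    show "G x y = G y x" for x y by (simp add: G_def chord_commute)
    show int: "integrable (\<mu> i) (\<lambda>x. exp (pi * a i * G x y))" for i y
      by (rule integrableI_nonneg[OF em]) (use C(2)[of i y] in \<open>auto simp: less_top[symmetric] top_unique\<close>)
    show "(\<integral>x. exp (pi * a i * G x y) \<partial>\<mu> i) \<le> C i" for i y
    proof -
      have "ennreal (\<integral>x. exp (pi * a i * G x y) \<partial>\<mu> i) = exp_int i y"
        by (rule nn_integral_eq_integral[symmetric, OF int]) simp
      thus ?thesis using C(1)[of i] C(2)[of i y] by (simp add: ennreal_le_iff[symmetric])
    qed
    show "AE y in \<mu> i. isCont (\<lambda>z. G z y) x" for i x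
      using AE_mu_neq[where x=x and i=i]
    proof eventually_elim
      case (elim y)
      have "chord x y \<noteq> 0" using elim by (simp add: chord_eq_0_iff)
      moreover have "isCont (\<lambda>z. chord z y) x"
        unfolding chord_def using bracket_pos[of x] bracket_pos[of y] by (intro continuous_intros) simp
      ultimately show ?case unfolding G_def by (intro continuous_intros) auto
    qed
  qed
qed

text \<open>The identity holds on the diagonal too, where both sides are 0 by the convention
  \<open>ln 0 = 0\<close>.\<close>

lemma two_pi_G: "- ln (1 - sphere_emb x \<bullet> sphere_emb y) = 2 * pi * G x y"
proof (cases "x = y")
  case False
  hence "chord x y > 0" by (simp add: chord_pos_iff)
  thus ?thesis by (simp add: inner_sphere_emb G_def ln_realpow)
qed (simp add: inner_sphere_emb G_def chord_def)

text \<open>Up to the factor 2 pi the kernel is the logarithmic kernel of the unit vectors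
  \<open>sphere_emb\<close>, so positive definiteness is inherited from
  \<open>toda_form_log_nonneg\<close>.\<close>

lemma toda_potential_exists: "\<exists>C. toda_potential \<mu> G F (\<lambda>i. pi * a i) C"
proof -
  obtain C where "toda_kernel \<mu> G F (\<lambda>i. pi * a i) C" using toda_kernel_exists by blast
  then interpret T: toda_kernel \<mu> G F "\<lambda>i. pi * a i" C .
  have pd: "0 \<le> toda_form \<mu> G h" if h: "\<And>i. h i \<in> borel_measurable borel" "\<And>i x. \<bar>h i x\<bar> \<le> B" for h B
  proof -
    define D where "D i = C i / (pi * a i)" for i
    have "0 \<le> toda_form \<mu> (\<lambda>x y. - ln (1 - sphere_emb x \<bullet> sphere_emb y)) h"
    proof (rule T.toda_form_log_nonneg[where B=B and K="2 * pi * (\<bar>D True\<bar> + \<bar>D False\<bar>)"])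
      have "continuous_on UNIV sphere_emb" unfolding sphere_emb_def[abs_def]
      proof (intro continuous_intros ballI)
        show "1 + (norm x)\<^sup>2 \<noteq> 0" for x :: "real^2" using bracket_pos[of x] by simp
      qed
      thus "sphere_emb \<in> borel_measurable borel" by (rule borel_measurable_continuous_onI)
      show "AE y in \<mu> i. sphere_emb x \<bullet> sphere_emb y < 1" for i x
        using AE_mu_neq[where x=x and i=i]
        by eventually_elim (auto simp: inner_sphere_emb chord_eq_0_iff)
      show "integrable (\<mu> i) (\<lambda>y. - ln (1 - sphere_emb x \<bullet> sphere_emb y))" for i x
        unfolding two_pi_G using T.G_integrable by simp
      show "(\<integral>y. - ln (1 - sphere_emb x \<bullet> sphere_emb y) \<partial>\<mu> i) \<le> 2 * pi * (\<bar>D True\<bar> + \<bar>D False\<bar>)" for i x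
      proof -
        have "D i \<le> \<bar>D True\<bar> + \<bar>D False\<bar>" by (cases i) simp_all
        hence "(\<integral>y. G x y \<partial>\<mu> i) \<le> \<bar>D True\<bar> + \<bar>D False\<bar>" using T.G_bound[where x=x and i=i] by (simp add: D_def)
        thus ?thesis unfolding two_pi_G by simp
      qed
    qed (use h norm_sphere_emb inner_sphere_emb_nonneg in auto)
    also have "toda_form \<mu> (\<lambda>x y. - ln (1 - sphere_emb x \<bullet> sphere_emb y)) h = 2 * pi * toda_form \<mu> G h"
    proof -
      have "(2 * (2 * pi * s) - 2 * pi * t) * r = 2 * pi * ((2 * s - t) * r)" for s t r :: real by algebra
      thus ?thesis unfolding toda_form_def two_pi_G by (simp only: mult.assoc integral_mult_right_zero sum_distrib_left)
    qed
    finally show ?thesis using pi_gt_zero by (simp add: zero_le_mult_iff)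
  qed
  have "toda_potential \<mu> G F (\<lambda>i. pi * a i) C"
    by (intro toda_potential.intro T.toda_kernel_axioms toda_potential_axioms.intro) (rule pd)
  thus ?thesis by blast
qed

end

section \<open>Local integrability and the return to the plane\<close>

lemma locally_integrable_continuous:
  fixes u :: "'a::euclidean_space \<Rightarrow> real"
  assumes "continuous_on UNIV u" shows "locally_integrable u"
  unfolding locally_integrable_def set_integrable_def
proof (intro allI impI)
  fix S :: "'a set" assume S: "compact S"
  have i: "integrable lborel (\<lambda>x. indicator S x *\<^sub>R u x)"
    by (rule borel_integrable_compact[OF S continuous_on_subset[OF assms]]) simp
  thus "integrable lebesgue (\<lambda>x. indicator S x *\<^sub>R u x)"
    using integrable_completion[OF borel_measurable_integrable[OF i]] by simp
qed

lemma locally_integrable_integrable: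
  fixes f :: "'a::euclidean_space \<Rightarrow> real"
  assumes "integrable lborel f" shows "locally_integrable f"
  unfolding locally_integrable_def set_integrable_def
proof (intro allI impI integrable_mult_indicator)
  fix S :: "'a set" assume "compact S"
  thus "S \<in> sets lebesgue" by (simp add: lmeasurable_compact fmeasurableD)
  show "integrable lebesgue f"
    using integrable_completion[OF borel_measurable_integrable[OF assms]] assms by simp
qed

context toda_data
begin

theorem toda_solution_exists:
  "\<exists>u. \<forall>i. continuous_on UNIV (u i) \<and>
     neg_laplace_eq_distr (u i) (\<lambda>x. 2 * singular_weight m \<beta> P (ix i) x * exp (2 * u i x)
        - singular_weight m \<beta> P (ix (\<not> i)) x * exp (2 * u (\<not> i) x)) \<and>
     (\<exists>h. continuous_on (- ball 0 1) h \<and> bounded (h ` (- ball 0 1)) \<and>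
        (\<forall>x \<in> - ball 0 1. u i x = - (2 - (\<Sum>l=1..m. \<beta> (ix i) l)) * ln (norm x) + h x))"
proof -
  obtain C where "toda_potential \<mu> G F (\<lambda>i. pi * a i) C" using toda_potential_exists by blast
  then interpret T: toda_potential \<mu> G F "\<lambda>i. pi * a i" C .
  obtain g where g: "T.adm g" "T.step g = g" using T.fixed_point_exists by blast
  note gb = T.admD(1)[OF g(1)]
  \<comment> \<open>Being a potential plus a constant, w is continuous; being the logarithm of an
    admissible density, it is bounded. Continuity of the solution and its behaviour at infinity both
    come from here.\<close>
  define w where "w i x = ln (g i x)" for i x
  define c where "c i = ln (F i / (\<integral>z. exp (T.W g i z) \<partial>\<mu> i))" for i
  have wW: "w i x = T.W g i x + c i" for i x
    using T.ln_step[of g i x, OF gb] by (simp add: w_def c_def g(2))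
  have gw: "exp (w i x) = g i x" for i x using T.admD(3)[OF g(1)] by (simp add: w_def)
  have wc: "continuous_on UNIV (w i)" for i
    unfolding wW[abs_def] by (intro continuous_intros T.continuous_W gb)
  have wb: "T.bmeas (w i)" for i unfolding w_def by (rule T.adm_ln[OF g(1)])
  define L where "L x = ln (1 + (norm x)\<^sup>2)" for x :: "real^2"
  have br: "1 + (norm x)\<^sup>2 \<noteq> 0" for x :: "real^2" using bracket_pos[of x] by simp
  have Lc: "continuous_on S L" for S unfolding L_def by (intro continuous_intros) (use br in auto)
  \<comment> \<open>Undoes the change of unknown: 2 u = w - bt i * ln (1 + |x|^2), the factor 2
    coming from the exponent in the equation. The singular weight times exp (2 u) is then k times
    g.\<close>
  define u where "u i x = w i x / 2 - bt i / 2 * L x" for i x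
  have uc: "continuous_on UNIV (u i)" for i unfolding u_def by (intro continuous_intros wc Lc) simp
  define f where "f i x = k i x * g i x" for i x
  have fe: "singular_weight m \<beta> P (ix i) x * exp (2 * u i x) = f i x" for i x
  proof -
    have "exp (2 * u i x) = exp (w i x) * (1 + (norm x)\<^sup>2) powr (- bt i)"
    proof -
      have "2 * u i x = w i x + - bt i * L x" unfolding u_def by (simp add: field_simps)
      moreover have "(1 + (norm x)\<^sup>2) powr (- bt i) = exp (- bt i * L x)" using br[of x] by (simp add: powr_def L_def)
      ultimately show ?thesis by (simp only: exp_add)
    qed
    thus ?thesis by (simp add: gw f_def k_def sphere_weight_def bt_def)
  qed
  have gm: "g i \<in> borel_measurable borel" for i by (rule T.bmeas_meas[OF gb])
  have kAE: "AE x in lborel. 0 \<le> k i x" and km: "k i \<in> borel_measurable lborel" for i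
    using k_nonneg[of i] k_meas[of i] by simp_all
  have dens1: "integrable (\<mu> i) \<phi> \<longleftrightarrow> integrable lborel (\<lambda>x. k i x * \<phi> x)"
    if "\<phi> \<in> borel_measurable borel" for \<phi> :: "real^2 \<Rightarrow> real" and i
    unfolding \<mu>_def using integrable_density[OF _ km kAE, of \<phi> i] that by simp
  have dens2: "(\<integral>x. \<phi> x \<partial>\<mu> i) = (\<integral>x. k i x * \<phi> x \<partial>lborel)"
    if "\<phi> \<in> borel_measurable borel" for \<phi> :: "real^2 \<Rightarrow> real" and i
    unfolding \<mu>_def using integral_density[OF _ km kAE, of \<phi> i] that by simp
  have f_eq: "f i = (\<lambda>x. k i x * g i x)" for i by (rule ext) (rule f_def)
  have fi: "integrable lborel (f i)" "(\<integral>x. f i x \<partial>lborel) = F i" for i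
  proof -
    show "integrable lborel (f i)"
      unfolding f_eq dens1[OF gm, symmetric] by (rule T.bmeas_integrable[OF gb])
    show "(\<integral>x. f i x \<partial>lborel) = F i"
      unfolding f_eq dens2[OF gm, symmetric] by (rule T.admD(2)[OF g(1)])
  qed
  have Gg: "(\<lambda>y. G x y * g i y) \<in> borel_measurable borel" for x i
  proof (rule borel_measurable_times[OF _ gm])
    show "(\<lambda>y. G x y) \<in> borel_measurable borel" unfolding T.G_sym[of x] by (rule G_section_meas)
  qed
  have Gi: "integrable lborel (\<lambda>y. ln (chord x y) * f i y)" for x i
  proof -
    have "integrable (\<mu> i) (\<lambda>y. G x y * g i y)"
    proof -
      obtain M where "\<And>x. \<bar>g i x\<bar> \<le> M" using gb[of i] unfolding T.bmeas_def by blast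
      thus ?thesis by (rule T.pot_integrable[OF gm])
    qed
    hence "integrable lborel (\<lambda>y. - pi * (k i y * (G x y * g i y)))" using dens1[OF Gg] by simp
    thus ?thesis by (simp add: G_def f_def mult_ac)
  qed
  let ?V = "\<lambda>i x. \<integral>y. ln (chord x y) * f i y \<partial>lborel"
  have pot: "T.pot i (g i) x = - 1 / pi * ?V i x" for i x
  proof -
    have "T.pot i (g i) x = (\<integral>y. k i y * (G x y * g i y) \<partial>lborel)"
      unfolding T.pot_def by (rule dens2[OF Gg])
    also have "\<dots> = (\<integral>y. - 1 / pi * (ln (chord x y) * f i y) \<partial>lborel)"
      by (intro Bochner_Integration.integral_cong refl) (simp add: G_def f_def)
    finally show ?thesis by (simp only: integral_mult_right_zero)
  qed
  \<comment> \<open>The right-hand side of equation i. Its mass 2 pi * bt i is the compatibility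
    condition of \<open>log_chord_potential_distr\<close>.\<close>
  define \<rho> where "\<rho> i x = 2 * f i x - f (\<not> i) x" for i x
  let ?R = "\<lambda>i x. \<integral>y. ln (chord x y) * \<rho> i y \<partial>lborel"
  let ?A = "\<lambda>i x. \<integral>y. \<bar>ln (chord x y) * \<rho> i y\<bar> \<partial>lborel"
  have \<rho>i: "integrable lborel (\<rho> i)" for i unfolding \<rho>_def using fi by simp
  have mass: "(\<integral>x. \<rho> i x \<partial>lborel) = 2 * pi * bt i" for i
  proof -
    have "(\<integral>x. \<rho> i x \<partial>lborel) = 2 * F i - F (\<not> i)" unfolding \<rho>_def using fi(1) by (simp add: fi(2))
    also have "\<dots> = 2 * pi * bt i" by (simp add: F_def field_simps)
    finally show ?thesis .
  qed
  have \<rho>G: "integrable lborel (\<lambda>y. ln (chord x y) * \<rho> i y)" for i x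
  proof -
    have "integrable lborel (\<lambda>y. 2 * (ln (chord x y) * f i y) - ln (chord x y) * f (\<not> i) y)"
      by (intro Bochner_Integration.integrable_diff integrable_mult_right Gi)
    thus ?thesis by (simp add: \<rho>_def algebra_simps)
  qed
  have potW: "T.W g i x = - 1 / pi * ?R i x" for i x
  proof -
    have "?R i x = (\<integral>y. 2 * (ln (chord x y) * f i y) - ln (chord x y) * f (\<not> i) y \<partial>lborel)"
      by (simp add: \<rho>_def algebra_simps)
    also have "\<dots> = 2 * ?V i x - ?V (\<not> i) x"
      using Gi by simp
    finally have e: "?R i x =
        2 * ?V i x - ?V (\<not> i) x" .
    show ?thesis unfolding T.W_def pot e by algebra
  qed
  have lnc: "\<bar>ln (chord x y)\<bar> = - ln (chord x y)" for x y
  proof -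
    have "- ln (chord x y) = pi * G x y" by (simp add: G_def)
    moreover have "0 \<le> pi * G x y" using G_nonneg[of x y] by simp
    ultimately show ?thesis by linarith
  qed
  have fpos: "f i y \<ge> 0" for i y using k_nonneg T.admD(3)[OF g(1)] by (simp add: f_def less_imp_le)
  \<comment> \<open>As -ln of the distance and both f are nonnegative, the integral of the absolute
    value is dominated by a sum of potentials, which are already known to be bounded.\<close>
  have "\<exists>K. \<forall>x. ?A i x \<le> K" for i
  proof -
    obtain B1 B2 where B: "\<And>x. \<bar>T.pot i (g i) x\<bar> \<le> B1" "\<And>x. \<bar>T.pot (\<not> i) (g (\<not> i)) x\<bar> \<le> B2"
      using T.bmeas_pot[OF gb, of i i] T.bmeas_pot[OF gb, of "\<not> i" "\<not> i"] unfolding T.bmeas_def by blast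
    have "?A i x \<le> pi * (2 * B1 + B2)" for x
    proof -
      have "?A i x \<le> (\<integral>y. 2 * (- (ln (chord x y) * f i y)) + - (ln (chord x y) * f (\<not> i) y) \<partial>lborel)"
      proof (rule integral_mono)
        show "integrable lborel (\<lambda>y. \<bar>ln (chord x y) * \<rho> i y\<bar>)" using \<rho>G by simp
        show "integrable lborel (\<lambda>y. 2 * (- (ln (chord x y) * f i y)) + - (ln (chord x y) * f (\<not> i) y))"
          using Gi by simp
        fix y
        have "\<bar>\<rho> i y\<bar> \<le> 2 * f i y + f (\<not> i) y" using fpos[of i y] fpos[of "\<not> i" y] by (simp add: \<rho>_def)
        moreover have n: "0 \<le> - ln (chord x y)" unfolding lnc[symmetric] by (rule abs_ge_zero)
        ultimately have "- ln (chord x y) * \<bar>\<rho> i y\<bar> \<le> - ln (chord x y) * (2 * f i y + f (\<not> i) y)"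
          by (rule mult_left_mono)
        thus "\<bar>ln (chord x y) * \<rho> i y\<bar> \<le> 2 * (- (ln (chord x y) * f i y)) + - (ln (chord x y) * f (\<not> i) y)"
          unfolding abs_mult lnc by (simp add: algebra_simps)
      qed
      also have "\<dots> = 2 * (- ?V i x) + - ?V (\<not> i) x"
        using Gi by simp
      also have "\<dots> = pi * (2 * T.pot i (g i) x + T.pot (\<not> i) (g (\<not> i)) x)"
        unfolding pot by (simp add: right_diff_distrib)
      also have "\<dots> \<le> pi * (2 * B1 + B2)"
        using B(1)[of x] B(2)[of x] by (intro mult_left_mono) auto
      finally show ?thesis .
    qed
    thus ?thesis by blast
  qed
  then obtain K where K: "\<And>i x. ?A i x \<le> K i" by metis
  have ueq: "u i x = c i / 2 - 1 / (2 * pi) * ?R i x - bt i / 2 * ln (1 + (norm x)\<^sup>2)" for i x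
    unfolding u_def wW potW L_def by (simp add: field_simps)
  have eq: "neg_laplace_eq_distr (u i) (\<rho> i)" for i
    unfolding neg_laplace_eq_distr_def
  proof (intro conjI allI impI)
    show "locally_integrable (u i)" by (rule locally_integrable_continuous[OF uc])
    show "locally_integrable (\<rho> i)" by (rule locally_integrable_integrable[OF \<rho>i])
    fix \<phi> :: "real^2 \<Rightarrow> real" assume \<phi>: "test_function \<phi>"
    have um: "u i \<in> borel_measurable borel" "\<phi> \<in> borel_measurable borel" "laplacian \<phi> \<in> borel_measurable borel"
      using uc test_functionD(3,6)[OF \<phi>] by (auto intro: borel_measurable_continuous_onI)
    have rm: "\<rho> i \<in> borel_measurable borel" using \<rho>i by (simp add: borel_measurable_integrable)
    have "(\<integral>x. u i x * laplacian \<phi> x \<partial>lebesgue) = (\<integral>x. u i x * laplacian \<phi> x \<partial>lborel)"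
      by (rule integral_completion) (use um in simp)
    moreover have "(\<integral>x. \<rho> i x * \<phi> x \<partial>lebesgue) = (\<integral>x. \<rho> i x * \<phi> x \<partial>lborel)"
      by (rule integral_completion) (use um rm in simp)
    moreover have "- (\<integral>x. u i x * laplacian \<phi> x \<partial>lborel) = (\<integral>x. \<rho> i x * \<phi> x \<partial>lborel)"
      by (rule log_chord_potential_distr[OF \<rho>i mass \<rho>G K ueq \<phi>])
    ultimately show "- (\<integral>x. u i x * laplacian \<phi> x \<partial>lebesgue) = (\<integral>x. \<rho> i x * \<phi> x \<partial>lebesgue)" by simp
  qed
  have rhs: "(\<lambda>x. 2 * singular_weight m \<beta> P (ix i) x * exp (2 * u i x) - singular_weight m \<beta> P (ix (\<not> i)) x * exp (2 * u (\<not> i) x)) = \<rho> i" for i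
    by (simp add: fun_eq_iff \<rho>_def fe mult.assoc)
  have asym: "\<exists>h. continuous_on (- ball 0 1) h \<and> bounded (h ` (- ball 0 1)) \<and>
        (\<forall>x \<in> - ball 0 1. u i x = - (2 - (\<Sum>l=1..m. \<beta> (ix i) l)) * ln (norm x) + h x)" for i
  proof -
    define h where "h x = u i x + bt i * ln (norm x)" for x
    obtain B where B: "\<And>x. \<bar>w i x\<bar> \<le> B" using wb[of i] unfolding T.bmeas_def by blast
    have "continuous_on (- ball 0 1) h" unfolding h_def
      by (intro continuous_intros continuous_on_subset[OF uc]) auto
    moreover have "bounded (h ` (- ball 0 1))"
      unfolding bounded_iff
    proof (intro exI ballI)
      fix z assume "z \<in> h ` (- ball 0 1)"
      then obtain x where "x \<in> - ball 0 1" "z = h x" by blast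
      hence x: "norm x \<ge> 1" "z = h x" by simp_all
      have x0: "0 < norm x" using x(1) by linarith
      \<comment> \<open>For |x| \<ge> 1 the quantity 1 + |x|^2 lies between |x|^2 and 2 |x|^2, so
        replacing ln (1 + |x|^2) by 2 ln |x| costs at most ln 2.\<close>
      have "ln ((norm x)\<^sup>2) \<le> L x" unfolding L_def by (rule ln_mono) (use x0 in \<open>auto intro: add_pos_nonneg\<close>)
      moreover have "L x \<le> ln (2 * (norm x)\<^sup>2)"
        unfolding L_def using one_le_power[OF x(1), of 2] bracket_pos[of x] by (intro ln_mono) auto
      moreover have "ln (2 * (norm x)\<^sup>2) = ln 2 + 2 * ln (norm x)" "ln ((norm x)\<^sup>2) = 2 * ln (norm x)"
        using x0 by (simp_all add: ln_mult_pos ln_realpow)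
      ultimately have l: "0 \<le> L x - 2 * ln (norm x)" "L x - 2 * ln (norm x) \<le> ln 2" by linarith+
      have "z = w i x / 2 - bt i / 2 * (L x - 2 * ln (norm x))"
        unfolding x(2) h_def u_def by (simp add: algebra_simps)
      moreover have "0 \<le> bt i / 2 * (L x - 2 * ln (norm x))" using l bt_pos[of i] by simp
      moreover have "bt i / 2 * (L x - 2 * ln (norm x)) \<le> bt i / 2 * ln 2"
        using l bt_pos[of i] by (intro mult_left_mono) auto
      ultimately show "norm z \<le> B / 2 + bt i / 2 * ln 2" using B[of x] unfolding real_norm_def by linarith
    qed
    moreover have "\<forall>x \<in> - ball 0 1. u i x = - (2 - (\<Sum>l=1..m. \<beta> (ix i) l)) * ln (norm x) + h x"
      unfolding h_def bt_def by (intro ballI) algebra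
    ultimately show ?thesis by blast
  qed
  show ?thesis
    by (intro exI[of _ u] allI conjI uc asym) (simp only: rhs eq)
qed

end

theorem theorem1p1:
  fixes m :: nat and \<beta> :: "nat \<Rightarrow> nat \<Rightarrow> real" and P :: "nat \<Rightarrow> real^2"
  assumes "m \<ge> 3"
    and "\<And>i l. i \<in> {1, 2} \<Longrightarrow> l \<in> {1..m} \<Longrightarrow> \<beta> i l \<in> {0..<1}"
    and "\<And>i j. i \<in> {1, 2} \<Longrightarrow> j \<in> {1..m} \<Longrightarrow>
           3 * (1 + \<beta> i j) < 2 * (\<Sum>l=1..m. \<beta> i l) + (\<Sum>l=1..m. \<beta> (3 - i) l)"
    and "\<And>i. i \<in> {1, 2} \<Longrightarrow> (\<Sum>l=1..m. \<beta> i l) < 2"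
    and "inj_on P {1..m}"
  defines "K \<equiv> singular_weight m \<beta> P"
  shows "\<exists>u\<^sub>1 u\<^sub>2 :: real^2 \<Rightarrow> real.
    continuous_on UNIV u\<^sub>1 \<and> continuous_on UNIV u\<^sub>2 \<and>
    neg_laplace_eq_distr u\<^sub>1 (\<lambda>x. 2 * K 1 x * exp (2 * u\<^sub>1 x) - K 2 x * exp (2 * u\<^sub>2 x)) \<and>
    neg_laplace_eq_distr u\<^sub>2 (\<lambda>x. 2 * K 2 x * exp (2 * u\<^sub>2 x) - K 1 x * exp (2 * u\<^sub>1 x)) \<and>
    (\<forall>(i, u) \<in> {(1, u\<^sub>1), (2, u\<^sub>2)}.
       \<exists>h. continuous_on (- ball 0 1) h \<and> bounded (h ` (- ball 0 1)) \<and>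
           (\<forall>x \<in> - ball 0 1. u x = - (2 - (\<Sum>l=1..m. \<beta> i l)) * ln (norm x) + h x))"
proof -
  interpret toda_data m \<beta> P
    by (rule toda_data.intro[of m \<beta> P, OF _ assms(2-5)]) (use assms(1) in auto)
  obtain u where u: "\<And>i. continuous_on UNIV (u i)"
    "\<And>i. neg_laplace_eq_distr (u i) (\<lambda>x. 2 * K (ix i) x * exp (2 * u i x) - K (ix (\<not> i)) x * exp (2 * u (\<not> i) x))"
    "\<And>i. \<exists>h. continuous_on (- ball 0 1) h \<and> bounded (h ` (- ball 0 1)) \<and>
        (\<forall>x \<in> - ball 0 1. u i x = - (2 - (\<Sum>l=1..m. \<beta> (ix i) l)) * ln (norm x) + h x)"
    using toda_solution_exists unfolding K_def by blast
  have ix: "ix True = 1" "ix False = 2" by (simp_all add: ix_def)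
  show ?thesis
  proof (rule exI[of _ "u True"], rule exI[of _ "u False"], intro conjI)
    show "neg_laplace_eq_distr (u True) (\<lambda>x. 2 * K 1 x * exp (2 * u True x) - K 2 x * exp (2 * u False x))"
      using u(2)[of True] by (simp add: ix)
    show "neg_laplace_eq_distr (u False) (\<lambda>x. 2 * K 2 x * exp (2 * u False x) - K 1 x * exp (2 * u True x))"
      using u(2)[of False] by (simp add: ix)
    show "\<forall>(i, v) \<in> {(1, u True), (2, u False)}.
       \<exists>h. continuous_on (- ball 0 1) h \<and> bounded (h ` (- ball 0 1)) \<and>
           (\<forall>x \<in> - ball 0 1. v x = - (2 - (\<Sum>l=1..m. \<beta> i l)) * ln (norm x) + h x)"
      using u(3)[of True] u(3)[of False] unfolding ix by blast
  qed (rule u(1))+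
qed

end
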